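(* Consider the semi-discrete chain $t_{1x}=f(x,t,t_1,t_x)$ with $f_{t_x}\neq0$ and $f_{t_xt_x}=0$ (identically), and set $$m=\frac{-(f_{xt_x}+t_xf_{t_xt}+ff_{t_xt_1})+f_t+f_{t_x}f_{t_1}}{f_{t_x}}.$$ Assume $m\neq0$. Then the characteristic $x$-ring $L_x$ of the chain has dimension four if and only if the identity $$D\left(\frac{K(m)}{m}-m+\frac{f_t}{f_{t_x}}\right)=\frac{K(m)}{m}+m-f_{t_1}$$ holds (as an identity in the independent variables $x,t,t_1,t_2,t_x$). In this case the characteristic ring $L_x$ is generated by the vector fields $X,K,C_1,Z_1$, where $C_1=[X,K]$ and $Z_1=[K,C_1]$.
   Context: Chain and notation: the unknown $t=t(n,x)$ depends on a discrete variable $n\in\mathbb{Z}$ and a continuous variable $x$; $t_m=t(n+m,x)$ for $m\in\mathbb{Z}$ (so $t_0=t$), $t_x=\partial t/\partial x$, $t_{mx}=\partial t_m/\partial x$. The chain is $t_{1x}=f(x,t,t_1,t_x)$. Subscripts on $f$ denote partial derivatives with respect to its arguments $x,t,t_1,t_x$. The considerations are local, $f$ is (locally) analytic, $f_{t_x}\neq0$, and $x$, $t_x$ and all shifts $t_k$, $k\in\mathbb{Z}$, are regarded as independent variables ("dynamical variables"). A condition that a function is $\ne0$ means that it does not vanish on the domain considered. (In the claim, $m$ without index role denotes the displayed function, not an integer.) Since $f_{t_x}\neq 0$, the equation $t_x=f(x,t_{-1},t,t_{-1x})$ can be solved for $t_{-1x}$, giving $t_{-1x}=g(x,t_{-1},t,t_x)$.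 Shift operator: $D$ acts on functions of the dynamical variables by $D:\ x\mapsto x,\ t_k\mapsto t_{k+1},\ t_x\mapsto f(x,t,t_1,t_x)$; for example $D\,h(x,t,t_1,t_x)=h(x,t_1,t_2,f(x,t,t_1,t_x))$. Its inverse is $D^{-1}:\ x\mapsto x,\ t_k\mapsto t_{k-1},\ t_x\mapsto g(x,t_{-1},t,t_x)$. Vector fields: $$X=\frac{\partial}{\partial t_x},\qquad K=\frac{\partial}{\partial x}+t_x\frac{\partial}{\partial t}+\sum_{k\ge1}\left(D^{k-1}f\right)\frac{\partial}{\partial t_k}+\sum_{k\ge1}\left(D^{-(k-1)}g\right)\frac{\partial}{\partial t_{-k}}.$$ $K(m)$ denotes the result of applying the vector field $K$ to the function $m$. The characteristic $x$-ring $L_x$ is the Lie ring generated by $X$ and $K$ (under commutators), where linear combinations with coefficients that are locally analytic functions, each depending on finitely many of the dynamical variables, are allowed. Its dimension is the maximal number of its elements that are linearly independent over such functions. "Generated by $X,K,C_1,Z_1$" means that these vector fields form a basis of $L_x$ over such functions. *)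

theory Defs
  imports "HOL-Analysis.Analysis"
begin

text \<open>
  The dynamical variables are \<open>x\<close> (\<open>Vx\<close>), \<open>t\<^sub>x\<close> (\<open>Vtx\<close>) and the shifts \<open>t\<^sub>k\<close> (\<open>Vt k\<close>), \<open>k \<in> \<int>\<close>.
  A function of the dynamical variables is a total function on \<open>dyn_var \<Rightarrow> 'k\<close>, but only its germ at
  a base point matters: neighbourhoods are taken in the product topology, so each of them
  restricts finitely many variables only.
  The scalars range over a complete normed field extending the reals, which covers both
  \<open>\<real>\<close> and \<open>\<complex>\<close>.
\<close>

datatype dyn_var = Vx | Vtx | Vt int

type_synonym 'k point = "dyn_var \<Rightarrow> 'k"
type_synonym 'k dyn_fun = "'k point \<Rightarrow> 'k"

definition pd :: "dyn_var \<Rightarrow> 'k::real_normed_field dyn_fun \<Rightarrow> 'k dyn_fun" where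
  "pd v h q = deriv (\<lambda>s. h (q(v := s))) (q v)"

text \<open>
  Near \<open>p\<close>, the function \<open>h\<close> depends only on the finitely many variables in \<open>S\<close>, and is the sum of
  a convergent power series in them; \<open>\<alpha>\<close> ranges over the multi-indices supported in \<open>S\<close>.
\<close>

definition analytic_germ :: "'k::{real_normed_field,banach} point \<Rightarrow> 'k dyn_fun \<Rightarrow> bool" where
  "analytic_germ p h \<longleftrightarrow>
     (\<exists>(S::dyn_var set) (r::real) (c::(dyn_var \<Rightarrow> nat) \<Rightarrow> 'k). finite S \<and> r > 0 \<and>
        (\<forall>q. (\<forall>v\<in>S. norm (q v - p v) < r) \<longrightarrow>
           ((\<lambda>\<alpha>. c \<alpha> * (\<Prod>v\<in>S. (q v - p v) ^ \<alpha> v)) has_sum h q) {\<alpha>. \<forall>v. v \<notin> S \<longrightarrow> \<alpha> v = 0}))"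

text \<open>
  The right-hand side \<open>f\<close> of the chain takes \<open>(x, t, t\<^sub>1, t\<^sub>x)\<close>, while the solution \<open>g\<close> for \<open>t\<^sub>-\<^sub>1\<^sub>x\<close>
  takes \<open>(x, t\<^sub>-\<^sub>1, t, t\<^sub>x)\<close>.
\<close>

definition fargs :: "'k point \<Rightarrow> 'k \<times> 'k \<times> 'k \<times> 'k" where
  "fargs q = (q Vx, q (Vt 0), q (Vt 1), q Vtx)"

definition gargs :: "'k point \<Rightarrow> 'k \<times> 'k \<times> 'k \<times> 'k" where
  "gargs q = (q Vx, q (Vt (- 1)), q (Vt 0), q Vtx)"

definition shift_point :: "('k \<times> 'k \<times> 'k \<times> 'k \<Rightarrow> 'k) \<Rightarrow> 'k point \<Rightarrow> 'k point" where
  "shift_point f q v =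
     (case v of Vx \<Rightarrow> q Vx | Vtx \<Rightarrow> f (fargs q) | Vt k \<Rightarrow> q (Vt (k + 1)))"

definition unshift_point :: "('k \<times> 'k \<times> 'k \<times> 'k \<Rightarrow> 'k) \<Rightarrow> 'k point \<Rightarrow> 'k point" where
  "unshift_point g q v =
     (case v of Vx \<Rightarrow> q Vx | Vtx \<Rightarrow> g (gargs q) | Vt k \<Rightarrow> q (Vt (k - 1)))"

text \<open>The shift operator \<open>D\<close> and its inverse act on functions by substitution.\<close>

definition Dop :: "('k \<times> 'k \<times> 'k \<times> 'k \<Rightarrow> 'k) \<Rightarrow> 'k dyn_fun \<Rightarrow> 'k dyn_fun" where
  "Dop f h q = h (shift_point f q)"

definition Dinv :: "('k \<times> 'k \<times> 'k \<times> 'k \<Rightarrow> 'k) \<Rightarrow> 'k dyn_fun \<Rightarrow> 'k dyn_fun" where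
  "Dinv g h q = h (unshift_point g q)"

text \<open>
  A vector field \<open>\<Sum>\<^sub>v V\<^sub>v \<partial>/\<partial>v\<close> is the family of its coefficients. Applied to a function that locally
  depends on finitely many variables, the sum over all \<open>v\<close> is finite; restricting it to the
  \<open>v\<close> with nonzero partial derivative only removes zero terms.
\<close>

type_synonym 'k vfield = "dyn_var \<Rightarrow> 'k dyn_fun"

definition vf_apply :: "'k::real_normed_field vfield \<Rightarrow> 'k dyn_fun \<Rightarrow> 'k dyn_fun" where
  "vf_apply V h q = (\<Sum>v | pd v h q \<noteq> 0. V v q * pd v h q)"

definition vf_bracket :: "'k::real_normed_field vfield \<Rightarrow> 'k vfield \<Rightarrow> 'k vfield" where
  "vf_bracket V W = (\<lambda>v q. vf_apply V (W v) q - vf_apply W (V v) q)"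

definition vf_eq_at :: "'k::topological_space point \<Rightarrow> 'k vfield \<Rightarrow> 'k vfield \<Rightarrow> bool" where
  "vf_eq_at p V W \<longleftrightarrow> (\<forall>v. \<forall>\<^sub>F q in nhds p. V v q = W v q)"

definition vf_X :: "'k::real_normed_field vfield" where
  "vf_X v q = (if v = Vtx then 1 else 0)"

definition vf_K ::
    "('k \<times> 'k \<times> 'k \<times> 'k \<Rightarrow> 'k) \<Rightarrow> ('k \<times> 'k \<times> 'k \<times> 'k \<Rightarrow> 'k) \<Rightarrow> 'k::real_normed_field vfield" where
  "vf_K f g v q =
     (case v of
        Vx \<Rightarrow> 1
      | Vtx \<Rightarrow> 0
      | Vt k \<Rightarrow> if k = 0 then q Vtx
                else if k > 0 then (Dop f ^^ nat (k - 1)) (\<lambda>z. f (fargs z)) q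
                else (Dinv g ^^ nat (- k - 1)) (\<lambda>z. g (gargs z)) q)"

text \<open>The characteristic \<open>x\<close>-ring, as a set of representatives of germs at \<open>p\<close>.\<close>

inductive_set x_ring ::
    "('k \<times> 'k \<times> 'k \<times> 'k \<Rightarrow> 'k) \<Rightarrow> ('k \<times> 'k \<times> 'k \<times> 'k \<Rightarrow> 'k) \<Rightarrow>
     'k::{real_normed_field,banach} point \<Rightarrow> 'k vfield set"
  for f g p where
  X: "vf_X \<in> x_ring f g p"
| K: "vf_K f g \<in> x_ring f g p"
| add: "V \<in> x_ring f g p \<Longrightarrow> W \<in> x_ring f g p \<Longrightarrow> (\<lambda>v q. V v q + W v q) \<in> x_ring f g p"
| scale: "analytic_germ p a \<Longrightarrow> V \<in> x_ring f g p \<Longrightarrow> (\<lambda>v q. a q * V v q) \<in> x_ring f g p"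
| bracket: "V \<in> x_ring f g p \<Longrightarrow> W \<in> x_ring f g p \<Longrightarrow> vf_bracket V W \<in> x_ring f g p"

definition lin_comb :: "(nat \<Rightarrow> 'k::comm_ring_1 dyn_fun) \<Rightarrow> 'k vfield list \<Rightarrow> 'k vfield" where
  "lin_comb a Vs = (\<lambda>v q. \<Sum>i<length Vs. a i q * (Vs ! i) v q)"

definition lin_indep_at ::
    "'k::{real_normed_field,banach} point \<Rightarrow> 'k vfield list \<Rightarrow> bool" where
  "lin_indep_at p Vs \<longleftrightarrow>
     (\<forall>a. (\<forall>i<length Vs. analytic_germ p (a i)) \<and> vf_eq_at p (lin_comb a Vs) (\<lambda>v q. 0) \<longrightarrow>
          (\<forall>i<length Vs. \<forall>\<^sub>F q in nhds p. a i q = 0))"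

definition has_dimension_at ::
    "'k::{real_normed_field,banach} point \<Rightarrow> 'k vfield set \<Rightarrow> nat \<Rightarrow> bool" where
  "has_dimension_at p L n \<longleftrightarrow>
     (\<exists>Vs. set Vs \<subseteq> L \<and> length Vs = n \<and> lin_indep_at p Vs) \<and>
     (\<forall>Vs. set Vs \<subseteq> L \<and> lin_indep_at p Vs \<longrightarrow> length Vs \<le> n)"

definition is_basis_at ::
    "'k::{real_normed_field,banach} point \<Rightarrow> 'k vfield set \<Rightarrow> 'k vfield list \<Rightarrow> bool" where
  "is_basis_at p L Vs \<longleftrightarrow>
     set Vs \<subseteq> L \<and> lin_indep_at p Vs \<and>
     (\<forall>W\<in>L. \<exists>a. (\<forall>i<length Vs. analytic_germ p (a i)) \<and> vf_eq_at p W (lin_comb a Vs))"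

definition m_fun :: "('k \<times> 'k \<times> 'k \<times> 'k \<Rightarrow> 'k) \<Rightarrow> 'k::real_normed_field dyn_fun" where
  "m_fun f q =
     (let F = (\<lambda>z. f (fargs z)) in
      (- (pd Vtx (pd Vx F) q + q Vtx * pd (Vt 0) (pd Vtx F) q + F q * pd (Vt 1) (pd Vtx F) q)
       + pd (Vt 0) F q + pd Vtx F q * pd (Vt 1) F q) / pd Vtx F q)"

text \<open>
  A doubly infinite trajectory \<open>P\<close> of the shift inside the domain \<open>U\<close> of \<open>f\<close>. Since \<open>D\<^sup>k h\<close> near
  \<open>P 0\<close> involves \<open>h\<close> near \<open>P k\<close>, the local study of the chain at \<open>P 0\<close> takes place near the points
  \<open>P k\<close>, \<open>k \<in> \<int>\<close>. The value \<open>P 0\<close> determines \<open>P\<close> when \<open>f\<close> is injective in \<open>t\<^sub>x\<close> on \<open>U\<close>.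
\<close>

definition trajectory ::
    "('k \<times> 'k \<times> 'k \<times> 'k) set \<Rightarrow> ('k \<times> 'k \<times> 'k \<times> 'k \<Rightarrow> 'k) \<Rightarrow> (int \<Rightarrow> 'k point) \<Rightarrow> bool" where
  "trajectory U f P \<longleftrightarrow> (\<forall>k. fargs (P k) \<in> U \<and> P (k + 1) = shift_point f (P k))"

end

theory Submission
  imports Defs "HOL-Complex_Analysis.Cauchy_Integral_Formula"
begin

text \<open>
  Since \<open>f\<close> is affine in \<open>t\<^sub>x\<close>, write \<open>f = a t\<^sub>x + b\<close> with \<open>a, b\<close> depending on \<open>x, t, t\<^sub>1\<close>, and
  \<open>a\<^sub>k = D\<^sup>k a\<close> etc. The coefficients of \<open>K\<close>, \<open>C\<^sub>1\<close>, \<open>Z\<^sub>1\<close> and \<open>W = [K, Z\<^sub>1]\<close> at \<open>\<partial>/\<partial>t\<^sub>k\<close> then satisfy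
  two-sided recursions in \<open>k\<close>: \<open>K\<^sub>k\<^sub>+\<^sub>1 = a\<^sub>k K\<^sub>k + b\<^sub>k\<close>, \<open>A\<^sub>k\<^sub>+\<^sub>1 = a\<^sub>k A\<^sub>k\<close>, \<open>Z\<^sub>k\<^sub>+\<^sub>1 = a\<^sub>k Z\<^sub>k - A\<^sub>k\<^sub>+\<^sub>1 m\<^sub>k\<close>, and
  for every function \<open>l\<close>,
  \<open>(W - l Z)\<^sub>k\<^sub>+\<^sub>1 = a\<^sub>k (W - l Z)\<^sub>k + (l - \<Lambda>\<^sub>k) A\<^sub>k\<^sub>+\<^sub>1 m\<^sub>k\<close> with explicit \<open>\<Lambda>\<^sub>k\<close>.
  As \<open>W\<close> and \<open>Z\<^sub>1\<close> vanish at \<open>x, t\<^sub>x, t\<close>, the field \<open>W\<close> is a multiple of \<open>Z\<^sub>1\<close> iff all \<open>\<Lambda>\<^sub>k\<close> coincide, and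
  \<open>\<Lambda>\<^sub>k\<^sub>+\<^sub>1 = \<Lambda>\<^sub>k\<close> is the \<open>k\<close>-th shift of the identity of the theorem. In that case
  \<open>[C\<^sub>1, Z\<^sub>1] = [X, W] = X(l) Z\<^sub>1\<close>, so the span of \<open>X, K, C\<^sub>1, Z\<^sub>1\<close> is closed under brackets. Conversely the
  four fields are triangular in the directions \<open>t\<^sub>x, x, t, t\<^sub>1\<close> with units on the diagonal, so every element of the
  ring differs from a combination of them by a field vanishing in these directions, which must be
  zero in dimension four because germs form an integral domain.
\<close>

subsection \<open>Unconditional sums\<close>

text \<open>Two obstacles shape the development. \<open>analytic_germ\<close> provides pointwise
  unconditional convergence but no bound to compute with; on a smaller radius it becomes a weighted
  absolute bound on the coefficients, and closure properties are proved for that bound. Moreover,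
  fields have infinitely many components and equations hold only near the base point, each component
  on its own neighbourhood; the finite support of every germ keeps this under control.

  The chain lives near all points \<open>P k\<close> at once. The slope of \<open>f\<close> in
  \<open>t\<^sub>x\<close> is constant near each \<open>P k\<close>, but the trajectory may visit
  different pieces of \<open>U\<close>, so every k has its own \<open>acoef k\<close> and
  \<open>bcoef k\<close>. They involve only \<open>x\<close>, \<open>t\<close>,
  \<open>t\<^sub>1\<close>, so shifting them renames variables, and the whole computation can take
  place at \<open>P 0\<close>. Dividing by \<open>a\<^sub>k\<close> runs the recursions backwards,
  which puts the coefficients built from \<open>g\<close> on the same footing as those built from
  \<open>f\<close>. Mixed derivatives are exchanged only for functions affine in
  \<open>t\<^sub>x\<close>, where this is an explicit calculation.\<close>

lemma has_sum_fibers: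
  fixes f :: "'i \<Rightarrow> 'b::banach"
  assumes "(f has_sum T) J" and "e ` J \<subseteq> B"
    and "\<And>\<beta>. \<beta> \<in> B \<Longrightarrow> (f has_sum g \<beta>) {i \<in> J. e i = \<beta>}"
  shows "(g has_sum T) B"
proof (rule has_sum_SigmaD)
  \<comment> \<open>J is sorted by the value of e. An empty fibre forces
    \<open>g \<beta> = 0\<close>, so B may exceed the image of e.\<close>
  have "bij_betw (\<lambda>i. (e i, i)) J (Sigma B (\<lambda>\<beta>. {i \<in> J. e i = \<beta>}))"
    using assms(2) by (auto simp: bij_betw_def inj_on_def)
  from has_sum_reindex_bij_betw[OF this, of "\<lambda>(\<beta>, i). f i" T] assms(1)
  show "((\<lambda>(\<beta>, i). f i) has_sum T) (Sigma B (\<lambda>\<beta>. {i \<in> J. e i = \<beta>}))"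
    by simp
qed (use assms(3) in auto)

text \<open>Outside some finite set X a single term is the difference of two partial sums, both
  within 1 of the total, so its norm is below 2; the finitely many terms in X are added to the
  bound.\<close>

lemma has_sum_norm_bounded:
  fixes f :: "'i \<Rightarrow> 'b::real_normed_vector"
  assumes "(f has_sum T) A"
  obtains B where "\<And>a. a \<in> A \<Longrightarrow> norm (f a) \<le> B"
proof -
  have "\<forall>\<^sub>F Y in finite_subsets_at_top A. dist (sum f Y) T < 1"
    using assms unfolding has_sum_def tendsto_iff by auto
  then obtain X where X: "finite X" "X \<subseteq> A"
    and close: "\<forall>Y. finite Y \<and> X \<subseteq> Y \<and> Y \<subseteq> A \<longrightarrow> dist (sum f Y) T < 1"
    unfolding eventually_finite_subsets_at_top by (elim exE conjE)
  have "norm (f a) \<le> 2 + (\<Sum>x\<in>X. norm (f x))" if "a \<in> A" for a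
  proof (cases "a \<in> X")
    case True
    then have "norm (f a) \<le> (\<Sum>x\<in>X. norm (f x))"
      using X by (intro member_le_sum) auto
    then show ?thesis by simp
  next
    case False
    have "dist (sum f (insert a X)) T < 1" "dist (sum f X) T < 1"
      using X that close by auto
    then have "dist (sum f (insert a X)) (sum f X) < 2"
      using dist_triangle2[of "sum f (insert a X)" "sum f X" T] by linarith
    then have "norm (f a) < 2"
      using X False by (simp add: dist_norm)
    moreover have "0 \<le> (\<Sum>x\<in>X. norm (f x))"
      by (intro sum_nonneg) auto
    ultimately show ?thesis by linarith
  qed
  then show ?thesis using that by blast
qed

text \<open>Separate from \<open>has_sum_times\<close> because nonnegative terms give summability on
  the product directly; applied to norms, this supplies the absolute summability needed
  there.\<close>

lemma has_sum_times_nonneg: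
  fixes f :: "'i \<Rightarrow> real" and g :: "'j \<Rightarrow> real"
  assumes "(f has_sum F) A" "(g has_sum G) B"
    and "\<And>a. a \<in> A \<Longrightarrow> 0 \<le> f a" "\<And>b. b \<in> B \<Longrightarrow> 0 \<le> g b"
  shows "((\<lambda>(a, b). f a * g b) has_sum F * G) (A \<times> B)"
proof (rule has_sum_SigmaI)
  show inner: "((\<lambda>b. case (a, b) of (a, b) \<Rightarrow> f a * g b) has_sum f a * G) B" for a
    using has_sum_cmult_right[OF assms(2)] by simp
  show outer: "((\<lambda>a. f a * G) has_sum F * G) A"
    using has_sum_cmult_left[OF assms(1)] by simp
  show "(\<lambda>(a, b). f a * g b) summable_on A \<times> B"
    by (rule summable_on_SigmaI[OF inner has_sum_imp_summable[OF outer]]) (use assms in auto)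
qed

lemma has_sum_times:
  fixes f :: "'i \<Rightarrow> 'k::{real_normed_field,banach}" and g :: "'j \<Rightarrow> 'k"
  assumes "(f has_sum F) A" "(g has_sum G) B"
    and "f abs_summable_on A" "g abs_summable_on B"
  shows "((\<lambda>(a, b). f a * g b) has_sum F * G) (A \<times> B)"
proof (rule has_sum_SigmaI)
  show "((\<lambda>b. case (a, b) of (a, b) \<Rightarrow> f a * g b) has_sum f a * G) B" for a
    using has_sum_cmult_right[OF assms(2)] by simp
  show "((\<lambda>a. f a * G) has_sum F * G) A"
    using has_sum_cmult_left[OF assms(1)] by simp
  have "(\<lambda>(a, b). norm (f a) * norm (g b)) summable_on A \<times> B"
    using has_sum_times_nonneg[OF has_sum_infsum[OF assms(3)] has_sum_infsum[OF assms(4)]]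
    by (auto intro: has_sum_imp_summable)
  then have "(\<lambda>(a, b). f a * g b) abs_summable_on A \<times> B"
    by (auto simp: case_prod_unfold norm_mult)
  then show "(\<lambda>(a, b). f a * g b) summable_on A \<times> B"
    by (rule abs_summable_summable)
qed

subsection \<open>Power series with a weighted absolute bound\<close>

definition multi_indices :: "dyn_var set \<Rightarrow> (dyn_var \<Rightarrow> nat) set" where
  "multi_indices S = {\<alpha>. \<forall>v. v \<notin> S \<longrightarrow> \<alpha> v = 0}"

definition multi_degree :: "dyn_var set \<Rightarrow> (dyn_var \<Rightarrow> nat) \<Rightarrow> nat" where
  "multi_degree S \<alpha> = (\<Sum>v\<in>S. \<alpha> v)"

definition monomial :: "'k::comm_ring_1 point \<Rightarrow> dyn_var set \<Rightarrow> (dyn_var \<Rightarrow> nat) \<Rightarrow> 'k dyn_fun" where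
  "monomial p S \<alpha> q = (\<Prod>v\<in>S. (q v - p v) ^ \<alpha> v)"

text \<open>Coordinates outside S are unconstrained, so this is a cylinder; for finite S it is a
  basic neighbourhood of the product topology.\<close>

definition polydisc :: "'k::real_normed_field point \<Rightarrow> dyn_var set \<Rightarrow> real \<Rightarrow> 'k point set" where
  "polydisc p S \<rho> = {q. \<forall>v\<in>S. norm (q v - p v) < \<rho>}"

text \<open>A bound on the weighted l1 norm of the coefficients, the norm of the Banach algebra of
  power series that converge absolutely on the closed polydisc of radius \<rho>. It is
  submultiplicative, so products, powers and substitutions become arithmetic with the bounds
  M.\<close>

definition bounded_series ::
  "'k::{real_normed_field,banach} point \<Rightarrow> dyn_var set \<Rightarrow> real \<Rightarrow> real \<Rightarrow> 'k dyn_fun \<Rightarrow> bool" where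
  "bounded_series p S \<rho> M h \<longleftrightarrow> (\<exists>c N. ((\<lambda>\<alpha>. norm (c \<alpha>) * \<rho> ^ multi_degree S \<alpha>) has_sum N) (multi_indices S) \<and> N \<le> M \<and>
     (\<forall>q\<in>polydisc p S \<rho>. ((\<lambda>\<alpha>. c \<alpha> * monomial p S \<alpha> q) has_sum h q) (multi_indices S)))"

lemma norm_monomial_le:
  assumes "q \<in> polydisc p S \<rho>"
  shows "norm (monomial p S \<alpha> q) \<le> \<rho> ^ multi_degree S \<alpha>"
proof -
  have "norm (monomial p S \<alpha> q) = (\<Prod>v\<in>S. norm (q v - p v) ^ \<alpha> v)"
    by (simp add: monomial_def prod_norm[symmetric] norm_power)
  also have "\<dots> \<le> (\<Prod>v\<in>S. \<rho> ^ \<alpha> v)"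
    using assms by (intro prod_mono) (auto simp: polydisc_def intro!: power_mono dest: less_imp_le)
  also have "\<dots> = \<rho> ^ multi_degree S \<alpha>"
    by (simp add: multi_degree_def power_sum)
  finally show ?thesis .
qed

lemma norm_coeff_monomial_le:
  fixes c :: "'k::real_normed_field"
  assumes "q \<in> polydisc p S \<rho>"
  shows "norm (c * monomial p S \<alpha> q) \<le> norm c * \<rho> ^ multi_degree S \<alpha>"
  using norm_monomial_le[OF assms] by (simp add: norm_mult mult_left_mono)

lemma monomial_add: "monomial p S (\<lambda>v. \<alpha> v + \<beta> v) q = monomial p S \<alpha> q * monomial p S \<beta> q"
  by (simp add: monomial_def power_add prod.distrib)

lemma multi_degree_add: "multi_degree S (\<lambda>v. \<alpha> v + \<beta> v) = multi_degree S \<alpha> + multi_degree S \<beta>"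
  by (simp add: multi_degree_def sum.distrib)

lemma bounded_series_mono: "bounded_series p S \<rho> M h \<Longrightarrow> M \<le> M' \<Longrightarrow> bounded_series p S \<rho> M' h"
  unfolding bounded_series_def by (meson order_trans)

text \<open>Monomials may be indexed arbitrarily and repeatedly; collecting equal ones does not increase the bound.\<close>

lemma bounded_seriesI:
  fixes c :: "'i \<Rightarrow> 'k::{real_normed_field,banach}"
  assumes \<rho>: "0 < \<rho>" and e: "e ` J \<subseteq> multi_indices S"
    and N: "((\<lambda>i. norm (c i) * \<rho> ^ multi_degree S (e i)) has_sum N) J"
    and h: "\<And>q. q \<in> polydisc p S \<rho> \<Longrightarrow> ((\<lambda>i. c i * monomial p S (e i) q) has_sum h q) J"
  shows "bounded_series p S \<rho> N h"
proof -
  define fib where "fib \<beta> = {i \<in> J. e i = \<beta>}" for \<beta>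
  define c' where "c' \<beta> = infsum c (fib \<beta>)" for \<beta>
  define T where "T \<beta> = infsum (\<lambda>i. norm (c i) * \<rho> ^ multi_degree S (e i)) (fib \<beta>)" for \<beta>
  have fibJ: "fib \<beta> \<subseteq> J" for \<beta> by (auto simp: fib_def)
  have T: "((\<lambda>i. norm (c i) * \<rho> ^ multi_degree S (e i)) has_sum T \<beta>) (fib \<beta>)" for \<beta>
    unfolding T_def
    by (intro has_sum_infsum summable_on_subset_banach[OF has_sum_imp_summable[OF N] fibJ])
  have TN: "(T has_sum N) (multi_indices S)"
    by (rule has_sum_fibers[OF N e]) (use T in \<open>simp add: fib_def\<close>)
  \<comment> \<open>All indices in a fibre carry the same weight, so it can be divided out; this
    makes c absolutely summable there and the collected coefficient \<open>c' \<beta>\<close>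
    meaningful.\<close>
  have norm_c: "((\<lambda>i. norm (c i)) has_sum T \<beta> / \<rho> ^ multi_degree S \<beta>) (fib \<beta>)" for \<beta>
  proof -
    have "((\<lambda>i. norm (c i) * \<rho> ^ multi_degree S \<beta>) has_sum T \<beta>) (fib \<beta>)"
      using T[of \<beta>] by (rule has_sum_cong[THEN iffD1, rotated]) (simp add: fib_def)
    from has_sum_cmult_left[OF this, of "inverse (\<rho> ^ multi_degree S \<beta>)"] show ?thesis
      using \<rho> by (simp add: field_simps)
  qed
  have c': "(c has_sum c' \<beta>) (fib \<beta>)" for \<beta>
    unfolding c'_def
    by (rule has_sum_infsum, rule abs_summable_summable, rule has_sum_imp_summable, rule norm_c)
  have le: "norm (c' \<beta>) * \<rho> ^ multi_degree S \<beta> \<le> T \<beta>" for \<beta>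
    using norm_infsum_le[OF c' norm_c] \<rho> by (simp add: field_simps)
  have sm: "(\<lambda>\<beta>. norm (c' \<beta>) * \<rho> ^ multi_degree S \<beta>) summable_on multi_indices S"
    by (rule summable_on_comparison_test[OF has_sum_imp_summable[OF TN]]) (use le \<rho> in auto)
  have sN: "infsum (\<lambda>\<beta>. norm (c' \<beta>) * \<rho> ^ multi_degree S \<beta>) (multi_indices S) \<le> N"
    by (rule has_sum_mono[OF has_sum_infsum[OF sm] TN]) (rule le)
  have "((\<lambda>\<beta>. c' \<beta> * monomial p S \<beta> q) has_sum h q) (multi_indices S)" if "q \<in> polydisc p S \<rho>" for q
  proof (rule has_sum_fibers[OF h[OF that] e])
    fix \<beta>
    from has_sum_cmult_left[OF c', of "monomial p S \<beta> q" \<beta>]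
    show "((\<lambda>i. c i * monomial p S (e i) q) has_sum c' \<beta> * monomial p S \<beta> q) {i \<in> J. e i = \<beta>}"
      unfolding fib_def by (rule has_sum_cong[THEN iffD1, rotated]) simp
  qed
  with has_sum_infsum[OF sm] sN show ?thesis
    unfolding bounded_series_def by blast
qed

text \<open>Brings several germs to a common S and \<rho>. The old exponents vanish on the new
  variables, so the coefficients are kept, and a smaller radius only lowers the weights.\<close>

lemma bounded_series_restrict:
  assumes "bounded_series p S \<rho> M h" "S \<subseteq> S'" "finite S'" "0 < \<rho>'" "\<rho>' \<le> \<rho>"
  shows "bounded_series p S' \<rho>' M h"
proof -
  from assms(1) obtain c N where N: "((\<lambda>\<alpha>. norm (c \<alpha>) * \<rho> ^ multi_degree S \<alpha>) has_sum N) (multi_indices S)" "N \<le> M"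
    and h: "\<And>q. q \<in> polydisc p S \<rho> \<Longrightarrow> ((\<lambda>\<alpha>. c \<alpha> * monomial p S \<alpha> q) has_sum h q) (multi_indices S)"
    unfolding bounded_series_def by blast
  have multi_degree: "multi_degree S' \<alpha> = multi_degree S \<alpha>" if "\<alpha> \<in> multi_indices S" for \<alpha>
    unfolding multi_degree_def using assms that by (intro sum.mono_neutral_right) (auto simp: multi_indices_def)
  have monomial: "monomial p S' \<alpha> q = monomial p S \<alpha> q" if "\<alpha> \<in> multi_indices S" for \<alpha> q
    unfolding monomial_def using assms that by (intro prod.mono_neutral_right) (auto simp: multi_indices_def)
  have le: "norm (c \<alpha>) * \<rho>' ^ multi_degree S' \<alpha> \<le> norm (c \<alpha>) * \<rho> ^ multi_degree S \<alpha>" if "\<alpha> \<in> multi_indices S" for \<alpha>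
    using assms by (auto simp: multi_degree[OF that] intro!: mult_left_mono power_mono)
  have sm: "(\<lambda>\<alpha>. norm (c \<alpha>) * \<rho>' ^ multi_degree S' \<alpha>) summable_on multi_indices S"
    by (rule summable_on_comparison_test[OF has_sum_imp_summable[OF N(1)]]) (use le assms in auto)
  have "bounded_series p S' \<rho>' (infsum (\<lambda>\<alpha>. norm (c \<alpha>) * \<rho>' ^ multi_degree S' \<alpha>) (multi_indices S)) h"
  proof (rule bounded_seriesI[where e = "\<lambda>\<alpha>. \<alpha>"])
    show "(\<lambda>\<alpha>. \<alpha>) ` multi_indices S \<subseteq> multi_indices S'" using assms(2) by (auto simp: multi_indices_def)
    show "((\<lambda>\<alpha>. c \<alpha> * monomial p S' \<alpha> q) has_sum h q) (multi_indices S)" if "q \<in> polydisc p S' \<rho>'" for q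
    proof -
      have "q \<in> polydisc p S \<rho>" using that assms by (fastforce simp: polydisc_def)
      from h[OF this] show ?thesis
        by (rule has_sum_cong[THEN iffD1, rotated]) (simp add: monomial)
    qed
  qed (use sm assms in auto)
  moreover have "infsum (\<lambda>\<alpha>. norm (c \<alpha>) * \<rho>' ^ multi_degree S' \<alpha>) (multi_indices S) \<le> N"
    by (rule has_sum_mono[OF has_sum_infsum[OF sm] N(1)]) (rule le)
  ultimately show ?thesis using N(2) bounded_series_mono order_trans by blast
qed

text \<open>The Cauchy product, indexed by pairs of exponents; \<open>bounded_seriesI\<close>
  collects the pairs with equal sum.\<close>

lemma bounded_series_mult:
  assumes "bounded_series p S \<rho> M1 h1" "bounded_series p S \<rho> M2 h2" "0 < \<rho>"
  shows "bounded_series p S \<rho> (M1 * M2) (\<lambda>q. h1 q * h2 q)"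
proof -
  from assms(1) obtain c1 N1 where 1: "((\<lambda>\<alpha>. norm (c1 \<alpha>) * \<rho> ^ multi_degree S \<alpha>) has_sum N1) (multi_indices S)" "N1 \<le> M1"
    "\<And>q. q \<in> polydisc p S \<rho> \<Longrightarrow> ((\<lambda>\<alpha>. c1 \<alpha> * monomial p S \<alpha> q) has_sum h1 q) (multi_indices S)"
    unfolding bounded_series_def by blast
  from assms(2) obtain c2 N2 where 2: "((\<lambda>\<alpha>. norm (c2 \<alpha>) * \<rho> ^ multi_degree S \<alpha>) has_sum N2) (multi_indices S)" "N2 \<le> M2"
    "\<And>q. q \<in> polydisc p S \<rho> \<Longrightarrow> ((\<lambda>\<alpha>. c2 \<alpha> * monomial p S \<alpha> q) has_sum h2 q) (multi_indices S)"
    unfolding bounded_series_def by blast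
  have nn: "0 \<le> N1" "0 \<le> N2"
    using has_sum_nonneg[OF 1(1)] has_sum_nonneg[OF 2(1)] assms(3) by auto
  have abs: "(\<lambda>\<alpha>. c \<alpha> * monomial p S \<alpha> q) abs_summable_on multi_indices S"
    if "((\<lambda>\<alpha>. norm (c \<alpha>) * \<rho> ^ multi_degree S \<alpha>) has_sum N) (multi_indices S)" "q \<in> polydisc p S \<rho>" for c q N
    by (rule Infinite_Sum.abs_summable_on_comparison_test'[OF has_sum_imp_summable[OF that(1)]])
       (rule norm_coeff_monomial_le[OF that(2)])
  have "bounded_series p S \<rho> (N1 * N2) (\<lambda>q. h1 q * h2 q)"
  proof (rule bounded_seriesI[where e = "\<lambda>(\<alpha>, \<beta>) v. \<alpha> v + \<beta> v" and c = "\<lambda>(\<alpha>, \<beta>). c1 \<alpha> * c2 \<beta>" and J = "multi_indices S \<times> multi_indices S"])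
    show "((\<lambda>i. norm (case i of (\<alpha>, \<beta>) \<Rightarrow> c1 \<alpha> * c2 \<beta>) * \<rho> ^ multi_degree S (case i of (\<alpha>, \<beta>) \<Rightarrow> \<lambda>v. \<alpha> v + \<beta> v))
        has_sum N1 * N2) (multi_indices S \<times> multi_indices S)"
      using has_sum_times_nonneg[OF 1(1) 2(1)] assms(3)
      by (simp add: case_prod_unfold multi_degree_add power_add norm_mult mult_ac)
    show "((\<lambda>i. (case i of (\<alpha>, \<beta>) \<Rightarrow> c1 \<alpha> * c2 \<beta>) * monomial p S (case i of (\<alpha>, \<beta>) \<Rightarrow> \<lambda>v. \<alpha> v + \<beta> v) q)
        has_sum h1 q * h2 q) (multi_indices S \<times> multi_indices S)" if "q \<in> polydisc p S \<rho>" for q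
      using has_sum_times[OF 1(3)[OF that] 2(3)[OF that] abs[OF 1(1) that] abs[OF 2(1) that]]
      by (simp add: case_prod_unfold monomial_add mult_ac)
  qed (use assms in \<open>auto simp: multi_indices_def\<close>)
  moreover have "N1 * N2 \<le> M1 * M2"
    using 1 2 nn by (intro mult_mono) auto
  ultimately show ?thesis by (rule bounded_series_mono)
qed

text \<open>Serves addition, with two summands, and substitution, with one summand for each monomial
  of the outer series. Summable bounds make the double family of all coefficients absolutely
  summable, so the order of summation may be exchanged.\<close>

lemma bounded_series_has_sum:
  fixes h :: "'i \<Rightarrow> 'k::{real_normed_field,banach} dyn_fun"
  assumes \<rho>: "0 < \<rho>" and bounded_series: "\<And>i. i \<in> J \<Longrightarrow> bounded_series p S \<rho> (M i) (h i)"
    and M: "(M has_sum N) J"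
    and H: "\<And>q. q \<in> polydisc p S \<rho> \<Longrightarrow> ((\<lambda>i. h i q) has_sum H q) J"
  shows "bounded_series p S \<rho> N H"
proof -
  have "\<forall>i\<in>J. \<exists>c n. ((\<lambda>\<alpha>. norm (c \<alpha>) * \<rho> ^ multi_degree S \<alpha>) has_sum n) (multi_indices S) \<and> n \<le> M i \<and>
     (\<forall>q\<in>polydisc p S \<rho>. ((\<lambda>\<alpha>. c \<alpha> * monomial p S \<alpha> q) has_sum h i q) (multi_indices S))"
    using bounded_series unfolding bounded_series_def by blast
  from bchoice[OF this] obtain c where "\<forall>i\<in>J. \<exists>n. ((\<lambda>\<alpha>. norm (c i \<alpha>) * \<rho> ^ multi_degree S \<alpha>) has_sum n) (multi_indices S) \<and> n \<le> M i \<and>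
     (\<forall>q\<in>polydisc p S \<rho>. ((\<lambda>\<alpha>. c i \<alpha> * monomial p S \<alpha> q) has_sum h i q) (multi_indices S))" ..
  from bchoice[OF this] obtain n where n: "\<And>i. i \<in> J \<Longrightarrow> ((\<lambda>\<alpha>. norm (c i \<alpha>) * \<rho> ^ multi_degree S \<alpha>) has_sum n i) (multi_indices S)"
    and nM: "\<And>i. i \<in> J \<Longrightarrow> n i \<le> M i"
    and c: "\<And>i q. i \<in> J \<Longrightarrow> q \<in> polydisc p S \<rho> \<Longrightarrow> ((\<lambda>\<alpha>. c i \<alpha> * monomial p S \<alpha> q) has_sum h i q) (multi_indices S)"
    by auto
  have n0: "0 \<le> n i" if "i \<in> J" for i
    using has_sum_nonneg[OF n[OF that]] \<rho> by auto
  have smn: "n summable_on J"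
    by (rule summable_on_comparison_test[OF has_sum_imp_summable[OF M]]) (use n0 nM in auto)
  have nN: "infsum n J \<le> N"
    by (rule has_sum_mono[OF has_sum_infsum[OF smn] M]) (rule nM)
  have sm: "(\<lambda>(i, \<alpha>). norm (c i \<alpha>) * \<rho> ^ multi_degree S \<alpha>) summable_on Sigma J (\<lambda>_. multi_indices S)"
    by (rule summable_on_SigmaI[OF _ smn]) (use n \<rho> in auto)
  have "bounded_series p S \<rho> (infsum n J) H"
  proof (rule bounded_seriesI[where e = snd and c = "\<lambda>(i, \<alpha>). c i \<alpha>" and J = "Sigma J (\<lambda>_. multi_indices S)"])
    show "((\<lambda>i. norm (case i of (i, \<alpha>) \<Rightarrow> c i \<alpha>) * \<rho> ^ multi_degree S (snd i)) has_sum infsum n J) (Sigma J (\<lambda>_. multi_indices S))"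
      by (rule has_sum_SigmaI[OF _ has_sum_infsum[OF smn]])
         (use n sm in \<open>auto simp: case_prod_unfold\<close>)
    show "((\<lambda>i. (case i of (i, \<alpha>) \<Rightarrow> c i \<alpha>) * monomial p S (snd i) q) has_sum H q) (Sigma J (\<lambda>_. multi_indices S))"
      if q: "q \<in> polydisc p S \<rho>" for q
    proof (rule has_sum_SigmaI[OF _ H[OF q]])
      show "(\<lambda>i. (case i of (i, \<alpha>) \<Rightarrow> c i \<alpha>) * monomial p S (snd i) q) summable_on Sigma J (\<lambda>_. multi_indices S)"
        by (rule abs_summable_summable, rule Infinite_Sum.abs_summable_on_comparison_test'[OF sm])
           (use norm_coeff_monomial_le[OF q] in auto)
    qed (use c q in auto)
  qed (use \<rho> in auto)
  then show ?thesis using nN by (rule bounded_series_mono)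
qed

section \<open>Geometric series in several variables and the shrinking of the radius\<close>

lemma has_sum_multi_indices_insert:
  fixes g :: "(dyn_var \<Rightarrow> nat) \<Rightarrow> 'b::banach"
  assumes "v \<notin> S" "((\<lambda>(\<alpha>, n). g (\<alpha>(v := n))) has_sum T) (multi_indices S \<times> UNIV)"
  shows "(g has_sum T) (multi_indices (insert v S))"
proof -
  have "bij_betw (\<lambda>(\<alpha>, n). \<alpha>(v := n)) (multi_indices S \<times> UNIV) (multi_indices (insert v S))"
  proof (rule bij_betwI[where g = "\<lambda>\<alpha>. (\<alpha>(v := 0), \<alpha> v)"])
  qed (use assms(1) in \<open>auto simp: multi_indices_def fun_eq_iff\<close>)
  from has_sum_reindex_bij_betw[OF this, of g T] assms(2) show ?thesis
    by (simp add: case_prod_unfold)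
qed

text \<open>The sum factors into one geometric series per variable; the induction on S splits off
  one factor at a time.\<close>

lemma summable_geometric_multi_indices:
  assumes "finite S" "0 \<le> x" "x < (1::real)"
  shows "(\<lambda>\<alpha>. x ^ multi_degree S \<alpha>) summable_on multi_indices S"
  using assms(1)
proof (induction S rule: finite_induct)
  case empty
  have "multi_indices {} = {\<lambda>_. 0}" by (auto simp: multi_indices_def)
  then show ?case by simp
next
  case (insert v S)
  have "(\<lambda>n. x ^ n) sums (1 / (1 - x))"
    using assms by (intro geometric_sums) auto
  then have "((\<lambda>n. x ^ n) has_sum (1 / (1 - x))) UNIV"
    using assms by (intro norm_summable_imp_has_sum) auto
  from has_sum_times_nonneg[OF has_sum_infsum[OF insert.IH] this]
  have "((\<lambda>(\<alpha>, n). x ^ multi_degree S \<alpha> * x ^ n) has_sum infsum (\<lambda>\<alpha>. x ^ multi_degree S \<alpha>) (multi_indices S) * (1 / (1 - x))) (multi_indices S \<times> UNIV)"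
    using assms by auto
  also have "(\<lambda>(\<alpha>, n). x ^ multi_degree S \<alpha> * x ^ n) = (\<lambda>(\<alpha>, n). x ^ multi_degree (insert v S) (\<alpha>(v := n)))"
  proof (intro ext, clarify)
    fix \<alpha> :: "dyn_var \<Rightarrow> nat" and n
    have "(\<Sum>u\<in>S. (\<alpha>(v := n)) u) = (\<Sum>u\<in>S. \<alpha> u)"
      using insert.hyps by (intro sum.cong) auto
    then show "x ^ multi_degree S \<alpha> * x ^ n = x ^ multi_degree (insert v S) (\<alpha>(v := n))"
      using insert.hyps by (simp add: multi_degree_def power_add)
  qed
  finally show ?case
    by (intro has_sum_imp_summable[OF has_sum_multi_indices_insert[OF insert.hyps(2)]])
qed

text \<open>Abel's lemma: the terms are bounded at one point displaced by r / 2 in every coordinate,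
  so at radius r / 4 they are dominated by a geometric series. This is where unconditional
  convergence turns into a weighted absolute bound.\<close>

lemma analytic_germ_iff_bounded_series:
  "analytic_germ p h \<longleftrightarrow> (\<exists>S \<rho> M. finite S \<and> 0 < \<rho> \<and> bounded_series p S \<rho> M h)"
proof
  assume "\<exists>S \<rho> M. finite S \<and> 0 < \<rho> \<and> bounded_series p S \<rho> M h"
  then show "analytic_germ p h"
    unfolding analytic_germ_def bounded_series_def multi_indices_def[symmetric] monomial_def[symmetric]
    by (auto simp: polydisc_def)
next
  assume "analytic_germ p h"
  then obtain S r c where S: "finite S" "0 < r"
    and h: "\<And>q. q \<in> polydisc p S r \<Longrightarrow> ((\<lambda>\<alpha>. c \<alpha> * monomial p S \<alpha> q) has_sum h q) (multi_indices S)"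
    unfolding analytic_germ_def multi_indices_def[symmetric] monomial_def[symmetric] by (auto simp: polydisc_def)
  have "0 < r / 4" using S by simp
  \<comment> \<open>The same real displacement in every coordinate makes the norm of each monomial
    exactly \<open>(r / 2) ^ multi_degree S \<alpha>\<close>.\<close>
  define q where "q v = p v + of_real (r / 2)" for v
  have "q \<in> polydisc p S r" using S by (simp add: polydisc_def q_def)
  from has_sum_norm_bounded[OF h[OF this]] obtain B where
    B: "\<And>\<alpha>. \<alpha> \<in> multi_indices S \<Longrightarrow> norm (c \<alpha> * monomial p S \<alpha> q) \<le> B" by blast
  have monomial: "norm (monomial p S \<alpha> q) = (r / 2) ^ multi_degree S \<alpha>" for \<alpha>
    using S by (simp add: monomial_def q_def multi_degree_def prod_norm[symmetric] norm_power power_sum)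
  have bd: "norm (c \<alpha>) * (r / 4) ^ multi_degree S \<alpha> \<le> B * (1 / 2) ^ multi_degree S \<alpha>" if "\<alpha> \<in> multi_indices S" for \<alpha>
  proof -
    have "norm (c \<alpha>) * (r / 4) ^ multi_degree S \<alpha> = norm (c \<alpha> * monomial p S \<alpha> q) * (1 / 2) ^ multi_degree S \<alpha>"
      by (simp add: norm_mult monomial power_divide power_mult_distrib[symmetric] mult.assoc)
    also have "\<dots> \<le> B * (1 / 2) ^ multi_degree S \<alpha>"
      by (intro mult_right_mono B that) auto
    finally show ?thesis .
  qed
  have sm: "(\<lambda>\<alpha>. norm (c \<alpha>) * (r / 4) ^ multi_degree S \<alpha>) summable_on multi_indices S"
  proof (rule summable_on_comparison_test)
    show "(\<lambda>\<alpha>. B * (1 / 2) ^ multi_degree S \<alpha>) summable_on multi_indices S"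
      by (intro summable_on_cmult_right summable_geometric_multi_indices S) auto
  qed (use bd S in auto)
  have "bounded_series p S (r / 4) (infsum (\<lambda>\<alpha>. norm (c \<alpha>) * (r / 4) ^ multi_degree S \<alpha>) (multi_indices S)) h"
    unfolding bounded_series_def
  proof (intro exI conjI ballI)
    show "((\<lambda>\<alpha>. norm (c \<alpha>) * (r / 4) ^ multi_degree S \<alpha>) has_sum infsum (\<lambda>\<alpha>. norm (c \<alpha>) * (r / 4) ^ multi_degree S \<alpha>) (multi_indices S)) (multi_indices S)"
      using sm by auto
    show "((\<lambda>\<alpha>. c \<alpha> * monomial p S \<alpha> q) has_sum h q) (multi_indices S)" if "q \<in> polydisc p S (r / 4)" for q
      by (rule h) (use that S in \<open>force simp: polydisc_def\<close>)
  qed auto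
  then show "\<exists>S \<rho> M. finite S \<and> 0 < \<rho> \<and> bounded_series p S \<rho> M h"
    using S(1) \<open>0 < r / 4\<close> by blast
qed

lemma bounded_series_imp_analytic_germ: "bounded_series p S \<rho> M h \<Longrightarrow> finite S \<Longrightarrow> 0 < \<rho> \<Longrightarrow> analytic_germ p h"
  unfolding analytic_germ_iff_bounded_series by blast

section \<open>Neighbourhoods in the product topology\<close>

lemma open_polydisc:
  assumes "finite S"
  shows "open (polydisc p S \<rho>)"
proof -
  have "polydisc p S \<rho> = {q. \<forall>v\<in>S. q (id v) \<in> ball (p v) \<rho>}"
    by (auto simp: polydisc_def dist_norm norm_minus_commute)
  then show ?thesis
    using product_topology_basis'[OF assms, of "\<lambda>v. ball (p v) \<rho>" id] by simp
qed

text \<open>A basic open set of the product topology restricts finitely many coordinates, so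
  polydiscs over finite sets form a neighbourhood base. Statements about germs can thus be unfolded
  into statements on one polydisc.\<close>

lemma eventually_nhds_point:
  fixes p :: "'k::real_normed_field point"
  shows "eventually Q (nhds p) \<longleftrightarrow> (\<exists>S \<rho>. finite S \<and> 0 < \<rho> \<and> (\<forall>q\<in>polydisc p S \<rho>. Q q))"
proof
  assume "eventually Q (nhds p)"
  then obtain T where T: "open T" "p \<in> T" "\<And>q. q \<in> T \<Longrightarrow> Q q"
    unfolding eventually_nhds by blast
  from product_topology_open_contains_basis[OF T(1)[unfolded open_fun_def] T(2)]
  obtain X where X: "p \<in> Pi\<^sub>E UNIV X" "\<And>i. open (X i)" "finite {i. X i \<noteq> UNIV}" "Pi\<^sub>E UNIV X \<subseteq> T"
    by auto
  define S where "S = {i. X i \<noteq> UNIV}"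
  have "\<forall>i. \<exists>e>0. ball (p i) e \<subseteq> X i"
    using X(1,2) by (metis PiE_mem UNIV_I open_contains_ball)
  then obtain e where e: "\<And>i. 0 < e i" "\<And>i. ball (p i) (e i) \<subseteq> X i" by metis
  \<comment> \<open>The element 1 keeps the minimum meaningful when S is empty.\<close>
  define \<rho> where "\<rho> = Min (insert 1 (e ` S))"
  have fin: "finite S" using X(3) by (simp add: S_def)
  have "0 < \<rho>" using e fin by (simp add: \<rho>_def)
  moreover have "Q q" if q: "q \<in> polydisc p S \<rho>" for q
  proof -
    have "q i \<in> X i" for i
    proof (cases "i \<in> S")
      case True
      then have "\<rho> \<le> e i" using fin by (simp add: \<rho>_def)
      then have "q i \<in> ball (p i) (e i)"
        using q True by (auto simp: polydisc_def dist_norm norm_minus_commute)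
      then show ?thesis using e by blast
    qed (simp add: S_def)
    then show ?thesis using X(4) T(3) by auto
  qed
  ultimately show "\<exists>S \<rho>. finite S \<and> 0 < \<rho> \<and> (\<forall>q\<in>polydisc p S \<rho>. Q q)" using fin by blast
next
  assume "\<exists>S \<rho>. finite S \<and> 0 < \<rho> \<and> (\<forall>q\<in>polydisc p S \<rho>. Q q)"
  then obtain S \<rho> where "finite S" "0 < \<rho>" "\<forall>q\<in>polydisc p S \<rho>. Q q" by blast
  then show "eventually Q (nhds p)"
    unfolding eventually_nhds using open_polydisc[of S p \<rho>]
    by (intro exI[of _ "polydisc p S \<rho>"]) (auto simp: polydisc_def)
qed

lemma bounded_series_cong:
  assumes "bounded_series p S \<rho> M h" "\<And>q. q \<in> polydisc p S \<rho> \<Longrightarrow> h q = h' q"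
  shows "bounded_series p S \<rho> M h'"
proof -
  from assms(1) obtain c N where "((\<lambda>\<alpha>. norm (c \<alpha>) * \<rho> ^ multi_degree S \<alpha>) has_sum N) (multi_indices S)" "N \<le> M"
     "\<forall>q\<in>polydisc p S \<rho>. ((\<lambda>\<alpha>. c \<alpha> * monomial p S \<alpha> q) has_sum h q) (multi_indices S)"
    unfolding bounded_series_def by blast
  with assms(2) show ?thesis
    unfolding bounded_series_def by (intro exI[of _ c] exI[of _ N]) auto
qed

lemma polydisc_antimono: "S \<subseteq> S' \<Longrightarrow> \<rho>' \<le> \<rho> \<Longrightarrow> polydisc p S' \<rho>' \<subseteq> polydisc p S \<rho>"
  by (fastforce simp: polydisc_def)

lemma analytic_germ_cong:
  assumes "analytic_germ p h" "\<forall>\<^sub>F q in nhds p. h q = h' q"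
  shows "analytic_germ p h'"
proof -
  from assms(1) obtain S \<rho> M where 1: "finite S" "0 < \<rho>" "bounded_series p S \<rho> M h"
    unfolding analytic_germ_iff_bounded_series by blast
  from assms(2) obtain S' \<rho>' where 2: "finite S'" "0 < \<rho>'" "\<And>q. q \<in> polydisc p S' \<rho>' \<Longrightarrow> h q = h' q"
    unfolding eventually_nhds_point by blast
  have "bounded_series p (S \<union> S') (min \<rho> \<rho>') M h"
    using bounded_series_restrict[OF 1(3), of "S \<union> S'" "min \<rho> \<rho>'"] 1 2 by auto
  then have "bounded_series p (S \<union> S') (min \<rho> \<rho>') M h'"
    by (rule bounded_series_cong) (use 2(3) polydisc_antimono[of S' "S \<union> S'" "min \<rho> \<rho>'" \<rho>' p] in auto)
  then show ?thesis
    by (rule bounded_series_imp_analytic_germ) (use 1 2 in auto)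
qed

section \<open>Ring operations on analytic germs\<close>

lemma bounded_series_norm_le:
  assumes "bounded_series p S \<rho> M h" "q \<in> polydisc p S \<rho>"
  shows "norm (h q) \<le> M"
proof -
  from assms obtain c N where "((\<lambda>\<alpha>. norm (c \<alpha>) * \<rho> ^ multi_degree S \<alpha>) has_sum N) (multi_indices S)" "N \<le> M"
     "((\<lambda>\<alpha>. c \<alpha> * monomial p S \<alpha> q) has_sum h q) (multi_indices S)"
    unfolding bounded_series_def by blast
  with norm_infsum_le[OF this(3,1)] norm_coeff_monomial_le[OF assms(2)] show ?thesis
    by (meson order_trans)
qed

lemma bounded_series_const: "bounded_series p S \<rho> (norm a) (\<lambda>_. a)"
proof -
  have 1: "((\<lambda>\<alpha>. if \<alpha> = (\<lambda>_. 0) then x else 0) has_sum x) (multi_indices S)" for x :: "'b::{comm_monoid_add,t2_space}"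
    by (rule has_sum_finite_neutralI[where B = "{\<lambda>_. 0}"]) (auto simp: multi_indices_def)
  show ?thesis
    unfolding bounded_series_def
  proof (intro exI conjI ballI)
    show "((\<lambda>\<alpha>. norm (if \<alpha> = (\<lambda>_. 0) then a else 0) * \<rho> ^ multi_degree S \<alpha>) has_sum norm a) (multi_indices S)"
      using 1[of "norm a"] by (rule has_sum_cong[THEN iffD1, rotated]) (simp add: multi_degree_def)
    show "((\<lambda>\<alpha>. (if \<alpha> = (\<lambda>_. 0) then a else 0) * monomial p S \<alpha> q) has_sum a) (multi_indices S)" for q
      using 1[of a] by (rule has_sum_cong[THEN iffD1, rotated]) (simp add: monomial_def)
  qed simp
qed

lemma analytic_germ_const [intro, simp]: "analytic_germ p (\<lambda>_. a)"
  by (rule bounded_series_imp_analytic_germ[OF bounded_series_const[of p "{}" 1 a]]) auto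

lemma analytic_germ_bounded_series2:
  assumes "analytic_germ p h1" "analytic_germ p h2"
  obtains S \<rho> M1 M2 where "finite S" "0 < \<rho>" "bounded_series p S \<rho> M1 h1" "bounded_series p S \<rho> M2 h2"
proof -
  from assms obtain S1 \<rho>1 M1 S2 \<rho>2 M2
    where "finite S1" "0 < \<rho>1" "bounded_series p S1 \<rho>1 M1 h1" "finite S2" "0 < \<rho>2" "bounded_series p S2 \<rho>2 M2 h2"
    unfolding analytic_germ_iff_bounded_series by blast
  then show ?thesis
    by (intro that[of "S1 \<union> S2" "min \<rho>1 \<rho>2" M1 M2]) (auto intro: bounded_series_restrict)
qed

lemma bounded_series_add:
  assumes "bounded_series p S \<rho> M1 h1" "bounded_series p S \<rho> M2 h2" "0 < \<rho>"
  shows "bounded_series p S \<rho> (M1 + M2) (\<lambda>q. h1 q + h2 q)"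
  by (rule bounded_series_has_sum[where J = UNIV and M = "\<lambda>b. if b then M1 else M2" and h = "\<lambda>b. if b then h1 else h2"])
     (use assms in \<open>auto intro!: has_sum_finiteI simp: UNIV_bool\<close>)

lemma analytic_germ_add [intro]:
  assumes "analytic_germ p h1" "analytic_germ p h2"
  shows "analytic_germ p (\<lambda>q. h1 q + h2 q)"
  using analytic_germ_bounded_series2[OF assms] bounded_series_add unfolding analytic_germ_iff_bounded_series by metis

lemma analytic_germ_mult [intro]:
  assumes "analytic_germ p h1" "analytic_germ p h2"
  shows "analytic_germ p (\<lambda>q. h1 q * h2 q)"
  using analytic_germ_bounded_series2[OF assms] bounded_series_mult unfolding analytic_germ_iff_bounded_series by metis

lemma analytic_germ_minus [intro]:
  assumes "analytic_germ p h"
  shows "analytic_germ p (\<lambda>q. - h q)"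
  using analytic_germ_mult[OF analytic_germ_const[of p "-1"] assms] by simp

lemma analytic_germ_diff [intro]:
  assumes "analytic_germ p h1" "analytic_germ p h2"
  shows "analytic_germ p (\<lambda>q. h1 q - h2 q)"
  using analytic_germ_add[OF assms(1) analytic_germ_minus[OF assms(2)]] by simp

lemma analytic_germ_sum [intro]:
  assumes "\<And>i. i \<in> I \<Longrightarrow> analytic_germ p (h i)"
  shows "analytic_germ p (\<lambda>q. \<Sum>i\<in>I. h i q)"
  using assms by (induction I rule: infinite_finite_induct) auto

lemma analytic_germ_coord [intro, simp]: "analytic_germ p (\<lambda>q. q v)"
proof -
  have "bounded_series p {v} 1 (norm (p v) + 1) (\<lambda>q. q v)"
  proof (rule bounded_seriesI[where J = UNIV and c = "\<lambda>b. if b then 1 else p v" and e = "\<lambda>b u. if b \<and> u = v then 1 else 0"])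
    show "((\<lambda>i. (if i then 1 else p v) * monomial p {v} (\<lambda>u. if i \<and> u = v then 1 else 0) q) has_sum q v) UNIV" for q
      by (rule has_sum_finiteI) (auto simp: UNIV_bool monomial_def)
    show "((\<lambda>i. norm (if i then 1 else p v) * 1 ^ multi_degree {v} (\<lambda>u. if i \<and> u = v then 1 else 0)) has_sum norm (p v) + 1) UNIV"
      by (rule has_sum_finiteI) (auto simp: UNIV_bool)
  qed (auto simp: multi_indices_def)
  then show ?thesis by (rule bounded_series_imp_analytic_germ) auto
qed

section \<open>Substitution and inversion\<close>

lemma bounded_series_small:
  assumes "bounded_series p S \<rho> M h" "finite S" "0 < \<rho>" "h p = 0" "0 < \<epsilon>"
  obtains \<rho>' where "0 < \<rho>'" "bounded_series p S \<rho>' \<epsilon> h"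
proof -
  from assms(1) obtain c N where N: "((\<lambda>\<alpha>. norm (c \<alpha>) * \<rho> ^ multi_degree S \<alpha>) has_sum N) (multi_indices S)" "N \<le> M"
     and c: "\<And>q. q \<in> polydisc p S \<rho> \<Longrightarrow> ((\<lambda>\<alpha>. c \<alpha> * monomial p S \<alpha> q) has_sum h q) (multi_indices S)"
    unfolding bounded_series_def by blast
  have N0: "0 \<le> N" using has_sum_nonneg[OF N(1)] assms(3) by auto
  have pos: "0 < multi_degree S \<alpha>" if "\<alpha> \<in> multi_indices S" "\<alpha> \<noteq> (\<lambda>_. 0)" for \<alpha>
  proof -
    from that(2) obtain v where "\<alpha> v \<noteq> 0" by auto
    then show ?thesis
      using that(1) assms(2) by (auto simp: multi_degree_def multi_indices_def intro!: sum_pos2[where i = v])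
  qed
  have "monomial p S \<alpha> p = 0" if "\<alpha> \<in> multi_indices S" "\<alpha> \<noteq> (\<lambda>_. 0)" for \<alpha>
  proof -
    have "multi_degree S \<alpha> \<noteq> 0" using pos[OF that] by simp
    then obtain v where "v \<in> S" "\<alpha> v \<noteq> 0"
      unfolding multi_degree_def by (rule sum.not_neutral_contains_not_neutral)
    then show ?thesis unfolding monomial_def using assms(2) by (intro prod_zero bexI[of _ v]) auto
  qed
  then have "((\<lambda>\<alpha>. c \<alpha> * monomial p S \<alpha> p) has_sum c (\<lambda>_. 0)) (multi_indices S)"
    by (intro has_sum_finite_neutralI[where B = "{\<lambda>_. 0}"]) (auto simp: multi_indices_def monomial_def)
  moreover have "((\<lambda>\<alpha>. c \<alpha> * monomial p S \<alpha> p) has_sum h p) (multi_indices S)"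
    using assms(3) by (intro c) (simp add: polydisc_def)
  ultimately have c0: "c (\<lambda>_. 0) = 0" using assms(4) has_sum_unique by metis
  \<comment> \<open>The constant coefficient is zero, so scaling the radius by t \<le> 1 gains at
    least one factor t in every term. The denominator N + 1 is positive even if N = 0.\<close>
  define t where "t = min 1 (\<epsilon> / (N + 1))"
  have t: "0 < t" "t \<le> 1" "t * N \<le> \<epsilon>"
  proof -
    have "t * N \<le> (\<epsilon> / (N + 1)) * N" using N0 by (intro mult_right_mono) (auto simp: t_def)
    also have "\<dots> \<le> \<epsilon>" using N0 assms(5) by (simp add: field_simps)
    finally show "t * N \<le> \<epsilon>" .
  qed (use assms(5) N0 in \<open>auto simp: t_def\<close>)
  have le: "norm (c \<alpha>) * (t * \<rho>) ^ multi_degree S \<alpha> \<le> t * (norm (c \<alpha>) * \<rho> ^ multi_degree S \<alpha>)" if "\<alpha> \<in> multi_indices S" for \<alpha>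
  proof (cases "\<alpha> = (\<lambda>_. 0)")
    case False
    have "t ^ multi_degree S \<alpha> \<le> t ^ 1"
      using t pos[OF that False] by (intro power_decreasing) auto
    then have "t ^ multi_degree S \<alpha> * (norm (c \<alpha>) * \<rho> ^ multi_degree S \<alpha>) \<le> t * (norm (c \<alpha>) * \<rho> ^ multi_degree S \<alpha>)"
      using assms(3) by (intro mult_right_mono) auto
    then show ?thesis by (simp add: power_mult_distrib mult_ac)
  qed (simp add: c0)
  have tN: "((\<lambda>\<alpha>. t * (norm (c \<alpha>) * \<rho> ^ multi_degree S \<alpha>)) has_sum t * N) (multi_indices S)"
    by (rule has_sum_cmult_right[OF N(1)])
  have sm: "(\<lambda>\<alpha>. norm (c \<alpha>) * (t * \<rho>) ^ multi_degree S \<alpha>) summable_on multi_indices S"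
    by (rule summable_on_comparison_test[OF has_sum_imp_summable[OF tN]]) (use le t assms in auto)
  have "bounded_series p S (t * \<rho>) \<epsilon> h"
    unfolding bounded_series_def
  proof (intro exI conjI ballI)
    show "((\<lambda>\<alpha>. norm (c \<alpha>) * (t * \<rho>) ^ multi_degree S \<alpha>) has_sum infsum (\<lambda>\<alpha>. norm (c \<alpha>) * (t * \<rho>) ^ multi_degree S \<alpha>) (multi_indices S)) (multi_indices S)"
      using sm by simp
    show "infsum (\<lambda>\<alpha>. norm (c \<alpha>) * (t * \<rho>) ^ multi_degree S \<alpha>) (multi_indices S) \<le> \<epsilon>"
      using has_sum_mono[OF has_sum_infsum[OF sm] tN le] t(3) by linarith
    show "((\<lambda>\<alpha>. c \<alpha> * monomial p S \<alpha> q) has_sum h q) (multi_indices S)" if "q \<in> polydisc p S (t * \<rho>)" for q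
    proof (rule c)
      have "t * \<rho> \<le> 1 * \<rho>" using t assms by (intro mult_right_mono) auto
      then show "q \<in> polydisc p S \<rho>" using that polydisc_antimono[of S S "t * \<rho>" \<rho> p] by auto
    qed
  qed
  then show ?thesis using that[of "t * \<rho>"] t assms by auto
qed

lemma bounded_series_power:
  assumes "bounded_series p S \<rho> M h" "0 < \<rho>"
  shows "bounded_series p S \<rho> (M ^ n) (\<lambda>q. h q ^ n)"
proof (induction n)
  case 0
  then show ?case using bounded_series_const[of p S \<rho> 1] by simp
next
  case (Suc n)
  then show ?case using bounded_series_mult[OF assms(1) Suc assms(2)] by simp
qed

lemma bounded_series_prod:
  assumes "\<And>i. i \<in> I \<Longrightarrow> bounded_series p S \<rho> (M i) (h i)" "0 < \<rho>" "finite I"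
  shows "bounded_series p S \<rho> (\<Prod>i\<in>I. M i) (\<lambda>q. \<Prod>i\<in>I. h i q)"
  using assms(3,1)
proof (induction I rule: finite_induct)
  case empty
  then show ?case using bounded_series_const[of p S \<rho> 1] by simp
next
  case (insert i I)
  then have "bounded_series p S \<rho> (\<Prod>i\<in>I. M i) (\<lambda>q. \<Prod>i\<in>I. h i q)" by auto
  from bounded_series_mult[OF insert.prems[of i] this assms(2)] show ?case using insert.hyps by simp
qed

text \<open>Only the components of \<Phi> in the finite set S matter. Near p their increments have
  bound r / 2, so the monomials of the outer series obey bounds that are summable against its
  coefficients. That r / 2 is strictly below r keeps \<open>\<Phi> q\<close> inside the polydisc
  where h is given by its series.\<close>

lemma analytic_germ_compose:
  assumes h: "analytic_germ (\<Phi> p) h" and \<Phi>: "\<And>v. analytic_germ p (\<lambda>q. \<Phi> q v)"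
  shows "analytic_germ p (\<lambda>q. h (\<Phi> q))"
proof -
  from h obtain S r M where S: "finite S" "0 < r" "bounded_series (\<Phi> p) S r M h"
    unfolding analytic_germ_iff_bounded_series by blast
  then obtain c N where N: "((\<lambda>\<alpha>. norm (c \<alpha>) * r ^ multi_degree S \<alpha>) has_sum N) (multi_indices S)"
     and c: "\<And>q. q \<in> polydisc (\<Phi> p) S r \<Longrightarrow> ((\<lambda>\<alpha>. c \<alpha> * monomial (\<Phi> p) S \<alpha> q) has_sum h q) (multi_indices S)"
    unfolding bounded_series_def by blast
  define \<phi> where "\<phi> v q = \<Phi> q v - \<Phi> p v" for v q
  have "\<exists>S' \<rho>. finite S' \<and> 0 < \<rho> \<and> bounded_series p S' \<rho> (r / 2) (\<phi> v)" for v
  proof -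
    have "analytic_germ p (\<phi> v)" unfolding \<phi>_def using \<Phi> by auto
    then obtain S' \<rho> M where "finite S'" "0 < \<rho>" "bounded_series p S' \<rho> M (\<phi> v)"
      unfolding analytic_germ_iff_bounded_series by blast
    moreover have "\<phi> v p = 0" by (simp add: \<phi>_def)
    ultimately show ?thesis using bounded_series_small[of p S' \<rho> M "\<phi> v" "r / 2"] S(2) by (metis half_gt_zero)
  qed
  then obtain S' \<rho>' where S': "\<And>v. finite (S' v)" "\<And>v. 0 < \<rho>' v" "\<And>v. bounded_series p (S' v) (\<rho>' v) (r / 2) (\<phi> v)"
    by metis
  define T where "T = (\<Union>v\<in>S. S' v)"
  define \<rho> where "\<rho> = Min (insert 1 (\<rho>' ` S))"
  have T: "finite T" "0 < \<rho>" using S S' by (auto simp: T_def \<rho>_def)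
  have \<phi>: "bounded_series p T \<rho> (r / 2) (\<phi> v)" if "v \<in> S" for v
    by (rule bounded_series_restrict[OF S'(3)]) (use that S T in \<open>auto simp: T_def \<rho>_def\<close>)
  have le: "norm (c \<alpha>) * (r / 2) ^ multi_degree S \<alpha> \<le> norm (c \<alpha>) * r ^ multi_degree S \<alpha>" for \<alpha>
    using S(2) by (intro mult_left_mono power_mono) auto
  have sm: "(\<lambda>\<alpha>. norm (c \<alpha>) * (r / 2) ^ multi_degree S \<alpha>) summable_on multi_indices S"
    by (rule summable_on_comparison_test[OF has_sum_imp_summable[OF N]]) (use le S(2) in auto)
  have "bounded_series p T \<rho> (infsum (\<lambda>\<alpha>. norm (c \<alpha>) * (r / 2) ^ multi_degree S \<alpha>) (multi_indices S)) (\<lambda>q. h (\<Phi> q))"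
  proof (rule bounded_series_has_sum[OF T(2) _ has_sum_infsum[OF sm]])
    fix \<alpha>
    have "bounded_series p T \<rho> (\<Prod>v\<in>S. (r / 2) ^ \<alpha> v) (\<lambda>q. \<Prod>v\<in>S. \<phi> v q ^ \<alpha> v)"
      by (intro bounded_series_prod bounded_series_power \<phi> T S)
    from bounded_series_mult[OF bounded_series_const[of p T \<rho> "c \<alpha>"] this T(2)]
    show "bounded_series p T \<rho> (norm (c \<alpha>) * (r / 2) ^ multi_degree S \<alpha>) (\<lambda>q. c \<alpha> * monomial (\<Phi> p) S \<alpha> (\<Phi> q))"
      by (simp add: monomial_def multi_degree_def power_sum \<phi>_def)
  next
    fix q assume q: "q \<in> polydisc p T \<rho>"
    have "norm (\<phi> v q) < r" if "v \<in> S" for v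
      using bounded_series_norm_le[OF \<phi>[OF that] q] S(2) by linarith
    then show "((\<lambda>\<alpha>. c \<alpha> * monomial (\<Phi> p) S \<alpha> (\<Phi> q)) has_sum h (\<Phi> q)) (multi_indices S)"
      by (intro c) (simp add: polydisc_def \<phi>_def)
  qed
  then show ?thesis unfolding analytic_germ_iff_bounded_series using T by blast
qed

text \<open>The geometric series in \<open>- (q v - p v) / p v\<close>; on a polydisc of half the
  radius \<open>norm (p v)\<close> its ratio stays below 1 / 2, which makes the weighted bound
  finite.\<close>

lemma analytic_germ_inverse_coord:
  assumes "p v \<noteq> 0"
  shows "analytic_germ p (\<lambda>q. inverse (q v))"
proof -
  define \<rho> where "\<rho> = norm (p v) / 2"
  have \<rho>: "0 < \<rho>" using assms by (simp add: \<rho>_def)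
  define c where "c n = inverse (p v) * (- inverse (p v)) ^ n" for n
  have geo: "((\<lambda>n. a * x ^ n) has_sum a * (1 / (1 - x))) UNIV" if "norm x < 1" for a x :: "'b::{real_normed_field,banach}"
  proof -
    have "summable (\<lambda>n. norm (x ^ n))"
      using that by (simp add: norm_power summable_geometric)
    then have "((\<lambda>n. x ^ n) has_sum (1 / (1 - x))) UNIV"
      by (intro norm_summable_imp_has_sum geometric_sums that)
    then show ?thesis by (rule has_sum_cmult_right)
  qed
  have "bounded_series p {v} \<rho> (norm (inverse (p v)) * (1 / (1 - norm (inverse (p v)) * \<rho>))) (\<lambda>q. inverse (q v))"
  proof (rule bounded_seriesI[where J = UNIV and c = c and e = "\<lambda>n u. if u = v then n else 0"])
    have "norm (norm (inverse (p v)) * \<rho>) < 1" using assms by (simp add: \<rho>_def norm_inverse)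
    from geo[OF this, of "norm (inverse (p v))"]
    show "((\<lambda>i. norm (c i) * \<rho> ^ multi_degree {v} (\<lambda>u. if u = v then i else 0)) has_sum
       norm (inverse (p v)) * (1 / (1 - norm (inverse (p v)) * \<rho>))) UNIV"
      by (simp add: c_def multi_degree_def norm_mult norm_power power_mult_distrib mult_ac)
    show "((\<lambda>i. c i * monomial p {v} (\<lambda>u. if u = v then i else 0) q) has_sum inverse (q v)) UNIV"
      if "q \<in> polydisc p {v} \<rho>" for q
    proof -
      let ?x = "- inverse (p v) * (q v - p v)"
      have "norm (q v - p v) < norm (p v)" using that assms by (simp add: polydisc_def \<rho>_def) (smt (verit) norm_ge_zero)
      moreover have "norm ?x = norm (q v - p v) / norm (p v)"
        by (simp add: norm_mult norm_inverse divide_inverse mult.commute)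
      ultimately have x: "norm ?x < 1" using assms by simp
      have "q v \<noteq> 0" using \<open>norm (q v - p v) < norm (p v)\<close> by auto
      have "1 - ?x = q v / p v" using assms by (simp add: field_simps)
      then have "inverse (p v) * (1 / (1 - ?x)) = inverse (q v)" using assms \<open>q v \<noteq> 0\<close> by (simp add: field_simps)
      with geo[OF x, of "inverse (p v)"] show ?thesis
        unfolding c_def monomial_def power_mult_distrib by (simp add: mult.assoc)
    qed
  qed (use \<rho> in \<open>auto simp: multi_indices_def\<close>)
  then show ?thesis by (rule bounded_series_imp_analytic_germ) (use \<rho> in auto)
qed

text \<open>Substituting the point all of whose coordinates are \<open>h q\<close> reduces the claim
  to the inverse of one coordinate.\<close>

lemma analytic_germ_inverse [intro]:
  assumes "analytic_germ p h" "h p \<noteq> 0"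
  shows "analytic_germ p (\<lambda>q. inverse (h q))"
  using analytic_germ_compose[of "\<lambda>q _. h q" p "\<lambda>q. inverse (q Vx)"]
    analytic_germ_inverse_coord[of "\<lambda>_. h p" Vx] assms by simp

lemma analytic_germ_divide [intro]:
  assumes "analytic_germ p h1" "analytic_germ p h2" "h2 p \<noteq> 0"
  shows "analytic_germ p (\<lambda>q. h1 q / h2 q)"
  using analytic_germ_mult[OF assms(1) analytic_germ_inverse[OF assms(2,3)]]
  by (simp add: divide_inverse)

subsection \<open>Differentiation of germs\<close>

lemma bounded_series_fun_upd:
  assumes "bounded_series p S \<rho> M h" "v \<notin> S" "q \<in> polydisc p S \<rho>"
  shows "h (q(v := s)) = h q"
proof -
  from assms(1) obtain c where
    c: "\<And>q. q \<in> polydisc p S \<rho> \<Longrightarrow> ((\<lambda>\<alpha>. c \<alpha> * monomial p S \<alpha> q) has_sum h q) (multi_indices S)"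
    unfolding bounded_series_def by blast
  have monomial: "monomial p S \<alpha> (q(v := s)) = monomial p S \<alpha> q" for \<alpha>
    unfolding monomial_def using assms(2) by (intro prod.cong) auto
  have "q(v := s) \<in> polydisc p S \<rho>"
    using assms(2,3) by (auto simp: polydisc_def)
  from c[OF this] c[OF assms(3)] show ?thesis
    unfolding monomial by (rule has_sum_unique)
qed

text \<open>Termwise differentiation. Halving the radius absorbs the factors n and n (n - 1) that
  differentiation produces, and the second-order remainder of each power gives the difference
  quotient an error of order \<open>norm k\<close> that is uniform over the series.\<close>

lemma bounded_series_pd:
  assumes "finite S" "0 < \<rho>" "bounded_series p S \<rho> M h"
  shows "\<exists>M'. bounded_series p S (\<rho> / 2) M' (pd v h)"
    and "q \<in> polydisc p S (\<rho> / 2) \<Longrightarrow> ((\<lambda>s. h (q(v := s))) has_field_derivative pd v h q) (at (q v))"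
proof -
  from assms(3) obtain c N where N: "((\<lambda>\<alpha>. norm (c \<alpha>) * \<rho> ^ multi_degree S \<alpha>) has_sum N) (multi_indices S)"
     and c: "\<And>q. q \<in> polydisc p S \<rho> \<Longrightarrow> ((\<lambda>\<alpha>. c \<alpha> * monomial p S \<alpha> q) has_sum h q) (multi_indices S)"
    unfolding bounded_series_def by blast
  define r where "r = \<rho> / 2"
  have r: "0 < r" "r \<le> \<rho>" using assms by (auto simp: r_def)
  have rdisc: "polydisc p S r \<subseteq> polydisc p S \<rho>" using r by (intro polydisc_antimono) auto
  obtain D M' where D: "bounded_series p S r M' D"
    "\<And>q. q \<in> polydisc p S r \<Longrightarrow> ((\<lambda>s. h (q(v := s))) has_field_derivative D q) (at (q v))"
  proof (cases "v \<in> S")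
    case False
    have "((\<lambda>s. h (q(v := s))) has_field_derivative 0) (at (q v))" if q: "q \<in> polydisc p S r" for q
    proof -
      have "h (q(v := s)) = h q" for s
        using bounded_series_fun_upd[OF assms(3) False] q rdisc by auto
      then show ?thesis by simp
    qed
    then show ?thesis using that[of 0 "\<lambda>_. 0"] bounded_series_const[of p S r 0] by simp
  next
    case True
    \<comment> \<open>The monomial without its factor in v, which stays fixed while v varies; d is
      its degree.\<close>
    define R where "R \<alpha> q = (\<Prod>u\<in>S - {v}. (q u - p u) ^ \<alpha> u)" for \<alpha> q
    define d where "d \<alpha> = multi_degree (S - {v}) \<alpha>" for \<alpha>
    have multi_degree: "multi_degree S \<alpha> = \<alpha> v + d \<alpha>" for \<alpha>
      using True assms(1) by (simp add: multi_degree_def d_def sum.remove)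
    have monomial: "monomial p S \<alpha> q = (q v - p v) ^ \<alpha> v * R \<alpha> q" for \<alpha> q
      using True assms(1) by (simp add: monomial_def R_def prod.remove)
    have R: "norm (R \<alpha> q) \<le> r ^ d \<alpha>" if "q \<in> polydisc p S r" for \<alpha> q
      using norm_monomial_le[of q p "S - {v}" r \<alpha>] that by (simp add: polydisc_def R_def monomial_def d_def)
    have rd: "r ^ d \<alpha> \<le> \<rho> ^ d \<alpha>" for \<alpha> using r by (intro power_mono) auto
    define D where "D q = infsum (\<lambda>\<alpha>. of_nat (\<alpha> v) * c \<alpha> * ((q v - p v) ^ (\<alpha> v - 1) * R \<alpha> q)) (multi_indices S)" for q
    have b1: "real n * r ^ (n - 1) \<le> (2 / \<rho>) * \<rho> ^ n" for n
    proof (cases n)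
      case (Suc k)
      have "real n \<le> 2 ^ n" by (simp add: of_nat_less_two_power less_imp_le)
      then have "real n * (\<rho> / 2) ^ k \<le> 2 ^ n * (\<rho> / 2) ^ k"
        using assms(2) by (intro mult_right_mono) auto
      also have "\<dots> = (2 / \<rho>) * \<rho> ^ n" using Suc assms(2) by (simp add: power_divide)
      finally show ?thesis using Suc by (simp add: r_def)
    qed (use assms in auto)
    \<comment> \<open>The constant stems from n (n - 1) \<le> 2 * 2 ^ n: halving the radius cancels
      n - 2 of the factors 2, and 2 * 4 = 8 is left.\<close>
    have b2: "real n * real (n - 1) * r ^ (n - 2) \<le> (8 / \<rho>\<^sup>2) * \<rho> ^ n" for n
    proof (cases "n < 2")
      case True
      then have "real n * real (n - 1) * r ^ (n - 2) = 0" by (cases n) auto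
      moreover have "0 \<le> (8 / \<rho>\<^sup>2) * \<rho> ^ n" using assms(2) by simp
      ultimately show ?thesis by linarith
    next
      case False
      then obtain k where k: "n = k + 2" by (metis add.commute le_add_diff_inverse not_less)
      have "(k + 2) * (k + 1) \<le> 2 * 2 ^ (k + 2)"
      proof (induction k)
        case (Suc k)
        have "Suc k \<le> 2 ^ Suc k" by (rule less_imp_le[OF less_exp])
        with Suc show ?case by (simp add: algebra_simps)
      qed simp
      then have "real ((k + 2) * (k + 1)) \<le> real (2 * 2 ^ (k + 2))" by (rule of_nat_mono)
      then have "real n * real (n - 1) \<le> 2 * 2 ^ n" by (simp add: k algebra_simps)
      then have "real n * real (n - 1) * (\<rho> / 2) ^ k \<le> 2 * 2 ^ n * (\<rho> / 2) ^ k"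
        using assms(2) by (intro mult_right_mono) auto
      also have "\<dots> = (8 / \<rho>\<^sup>2) * \<rho> ^ n" using k assms(2) by (simp add: power_divide power2_eq_square)
      finally show ?thesis using k by (simp add: r_def)
    qed
    define J where "J = {\<alpha> \<in> multi_indices S. 0 < \<alpha> v}"
    have dd: "multi_degree S (\<alpha>(v := \<alpha> v - 1)) = \<alpha> v - 1 + d \<alpha>" for \<alpha>
    proof -
      have "d (\<alpha>(v := \<alpha> v - 1)) = d \<alpha>" unfolding d_def multi_degree_def by (intro sum.cong) auto
      then show ?thesis by (simp add: multi_degree)
    qed
    have mm: "monomial p S (\<alpha>(v := \<alpha> v - 1)) q = (q v - p v) ^ (\<alpha> v - 1) * R \<alpha> q" for \<alpha> q
    proof -
      have "R (\<alpha>(v := \<alpha> v - 1)) q = R \<alpha> q" unfolding R_def by (intro prod.cong) auto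
      then show ?thesis by (simp add: monomial)
    qed
    have bd: "norm (of_nat (\<alpha> v) * c \<alpha>) * r ^ (\<alpha> v - 1 + d \<alpha>) \<le> (2 / \<rho>) * (norm (c \<alpha>) * \<rho> ^ multi_degree S \<alpha>)" for \<alpha>
    proof -
      have "norm (of_nat (\<alpha> v) * c \<alpha>) * r ^ (\<alpha> v - 1 + d \<alpha>)
          = norm (c \<alpha>) * ((real (\<alpha> v) * r ^ (\<alpha> v - 1)) * r ^ d \<alpha>)"
        by (simp add: norm_mult power_add)
      also have "\<dots> \<le> norm (c \<alpha>) * (((2 / \<rho>) * \<rho> ^ \<alpha> v) * \<rho> ^ d \<alpha>)"
        by (rule mult_left_mono[OF mult_mono[OF b1 rd]]) (use assms(2) r in auto)
      finally show ?thesis by (simp add: multi_degree power_add mult_ac)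
    qed
    have smN: "(\<lambda>\<alpha>. K * (norm (c \<alpha>) * \<rho> ^ multi_degree S \<alpha>)) summable_on multi_indices S" for K
      by (intro summable_on_cmult_right has_sum_imp_summable[OF N])
    have sm: "(\<lambda>\<alpha>. norm (of_nat (\<alpha> v) * c \<alpha>) * r ^ (\<alpha> v - 1 + d \<alpha>)) summable_on multi_indices S"
      by (rule summable_on_comparison_test[OF smN[of "2 / \<rho>"]]) (use bd r in auto)
    have hasD: "((\<lambda>\<alpha>. of_nat (\<alpha> v) * c \<alpha> * ((q v - p v) ^ (\<alpha> v - 1) * R \<alpha> q)) has_sum D q) (multi_indices S)"
      if q: "q \<in> polydisc p S r" for q
      unfolding D_def
    proof (rule has_sum_infsum, rule abs_summable_summable,
        rule Infinite_Sum.abs_summable_on_comparison_test'[OF sm])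
      fix \<alpha>
      show "norm (of_nat (\<alpha> v) * c \<alpha> * ((q v - p v) ^ (\<alpha> v - 1) * R \<alpha> q))
          \<le> norm (of_nat (\<alpha> v) * c \<alpha>) * r ^ (\<alpha> v - 1 + d \<alpha>)"
        using norm_coeff_monomial_le[OF q, of "of_nat (\<alpha> v) * c \<alpha>" "\<alpha>(v := \<alpha> v - 1)"]
        unfolding mm dd .
    qed
    have JS: "J \<subseteq> multi_indices S" by (auto simp: J_def)
    have "bounded_series p S r (infsum (\<lambda>\<alpha>. norm (of_nat (\<alpha> v) * c \<alpha>) * r ^ (\<alpha> v - 1 + d \<alpha>)) J) D"
    proof (rule bounded_seriesI[where e = "\<lambda>\<alpha>. \<alpha>(v := \<alpha> v - 1)" and c = "\<lambda>\<alpha>. of_nat (\<alpha> v) * c \<alpha>" and J = J])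
      show "(\<lambda>\<alpha>. \<alpha>(v := \<alpha> v - 1)) ` J \<subseteq> multi_indices S" using True by (auto simp: J_def multi_indices_def)
      show "((\<lambda>\<alpha>. norm (of_nat (\<alpha> v) * c \<alpha>) * r ^ multi_degree S (\<alpha>(v := \<alpha> v - 1))) has_sum
          infsum (\<lambda>\<alpha>. norm (of_nat (\<alpha> v) * c \<alpha>) * r ^ (\<alpha> v - 1 + d \<alpha>)) J) J"
        unfolding dd by (intro has_sum_infsum summable_on_subset_banach[OF sm JS])
      show "((\<lambda>\<alpha>. of_nat (\<alpha> v) * c \<alpha> * monomial p S (\<alpha>(v := \<alpha> v - 1)) q) has_sum D q) J"
        if "q \<in> polydisc p S r" for q
        unfolding mm
        by (rule has_sum_cong_neutral[THEN iffD1, OF _ _ _ hasD[OF that]]) (auto simp: J_def)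
    qed (rule r)
    moreover have "((\<lambda>s. h (q(v := s))) has_field_derivative D q) (at (q v))" if q: "q \<in> polydisc p S r" for q
      unfolding DERIV_def
    proof (rule LIM_zero_cancel, rule Lim_null_comparison)
      have qv: "norm (q v - p v) < r" using q True by (auto simp: polydisc_def)
      have "\<forall>\<^sub>F k in at 0. k \<noteq> 0 \<and> norm (k :: 'a) < r - norm (q v - p v)"
        using qv by (auto simp: eventually_at intro!: exI[of _ "r - norm (q v - p v)"])
      then show "\<forall>\<^sub>F k in at 0. norm ((h (q(v := q v + k)) - h (q(v := q v))) / k - D q) \<le> (8 / \<rho>\<^sup>2 * N) * norm k"
      proof eventually_elim
        case (elim k)
        define z where "z = q v - p v"
        have zk: "norm (z + k) \<le> r" "norm z \<le> r" "k \<noteq> 0"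
          using elim norm_triangle_ineq[of z k] qv by (auto simp: z_def)
        have "norm (z + k) < r" using elim norm_triangle_ineq[of z k] by (simp add: z_def)
        then have qk: "q(v := q v + k) \<in> polydisc p S r"
          using q by (auto simp: polydisc_def z_def algebra_simps)
        have Rk: "R \<alpha> (q(v := q v + k)) = R \<alpha> q" for \<alpha>
          unfolding R_def by (intro prod.cong) auto
        have monk: "monomial p S \<alpha> (q(v := q v + k)) = (z + k) ^ \<alpha> v * R \<alpha> q" for \<alpha>
          unfolding monomial Rk by (simp add: z_def algebra_simps)
        have "((\<lambda>\<alpha>. (c \<alpha> * ((z + k) ^ \<alpha> v * R \<alpha> q) + - (c \<alpha> * (z ^ \<alpha> v * R \<alpha> q))) * inverse k
            + - (of_nat (\<alpha> v) * c \<alpha> * (z ^ (\<alpha> v - 1) * R \<alpha> q)))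
          has_sum (h (q(v := q v + k)) + - h q) * inverse k + - D q) (multi_indices S)"
          using c[of "q(v := q v + k)", unfolded monk] c[of q, unfolded monomial, folded z_def]
            hasD[OF q, folded z_def] qk q rdisc
          by (intro has_sum_add has_sum_cmult_left has_sum_uminusI) auto
        also have "(\<lambda>\<alpha>. (c \<alpha> * ((z + k) ^ \<alpha> v * R \<alpha> q) + - (c \<alpha> * (z ^ \<alpha> v * R \<alpha> q))) * inverse k
            + - (of_nat (\<alpha> v) * c \<alpha> * (z ^ (\<alpha> v - 1) * R \<alpha> q)))
          = (\<lambda>\<alpha>. c \<alpha> * R \<alpha> q * (((z + k) ^ \<alpha> v - z ^ \<alpha> v) / k - of_nat (\<alpha> v) * z ^ (\<alpha> v - Suc 0)))"
          using zk(3) by (auto simp: fun_eq_iff field_simps)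
        finally have hs: "((\<lambda>\<alpha>. c \<alpha> * R \<alpha> q * (((z + k) ^ \<alpha> v - z ^ \<alpha> v) / k - of_nat (\<alpha> v) * z ^ (\<alpha> v - Suc 0)))
          has_sum (h (q(v := q v + k)) + - h q) * inverse k + - D q) (multi_indices S)" .
        have "norm ((h (q(v := q v + k)) + - h q) * inverse k + - D q) \<le> (8 / \<rho>\<^sup>2 * norm k) * N"
        proof (rule norm_infsum_le[OF hs has_sum_cmult_right[OF N]])
          fix \<alpha>
          have "norm (((z + k) ^ \<alpha> v - z ^ \<alpha> v) / k - of_nat (\<alpha> v) * z ^ (\<alpha> v - Suc 0))
            \<le> real (\<alpha> v) * real (\<alpha> v - 1) * r ^ (\<alpha> v - 2) * norm k"
            using lemma_termdiff3[OF zk(3,2,1), of "\<alpha> v"] by simp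
          also have "\<dots> \<le> (8 / \<rho>\<^sup>2) * \<rho> ^ \<alpha> v * norm k"
            by (intro mult_right_mono b2) auto
          finally have "norm (c \<alpha>) * norm (R \<alpha> q) * norm (((z + k) ^ \<alpha> v - z ^ \<alpha> v) / k - of_nat (\<alpha> v) * z ^ (\<alpha> v - Suc 0))
            \<le> norm (c \<alpha>) * \<rho> ^ d \<alpha> * ((8 / \<rho>\<^sup>2) * \<rho> ^ \<alpha> v * norm k)"
            using R[OF q, of \<alpha>] rd[of \<alpha>] assms(2) by (intro mult_mono mult_left_mono) auto
          then show "norm (c \<alpha> * R \<alpha> q * (((z + k) ^ \<alpha> v - z ^ \<alpha> v) / k - of_nat (\<alpha> v) * z ^ (\<alpha> v - Suc 0)))
            \<le> 8 / \<rho>\<^sup>2 * norm k * (norm (c \<alpha>) * \<rho> ^ multi_degree S \<alpha>)"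
            by (simp add: norm_mult multi_degree power_add mult_ac)
        qed
        then show ?case by (simp add: divide_inverse mult_ac)
      qed
      show "((\<lambda>k. (8 / \<rho>\<^sup>2 * N) * norm k) \<longlongrightarrow> 0) (at 0)"
        by (intro tendsto_mult_right_zero tendsto_norm_zero) (rule tendsto_ident_at)
    qed
    ultimately show ?thesis using that by blast
  qed
  have pd: "pd v h q = D q" if "q \<in> polydisc p S r" for q
    unfolding pd_def by (rule DERIV_imp_deriv[OF D(2)[OF that]])
  show "\<exists>M'. bounded_series p S (\<rho> / 2) M' (pd v h)"
    using bounded_series_cong[OF D(1)] pd unfolding r_def by metis
  show "((\<lambda>s. h (q(v := s))) has_field_derivative pd v h q) (at (q v))" if "q \<in> polydisc p S (\<rho> / 2)"
    using D(2) pd that unfolding r_def by metis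
qed

lemma analytic_germ_pd [intro]: "analytic_germ p h \<Longrightarrow> analytic_germ p (pd v h)"
  unfolding analytic_germ_iff_bounded_series using bounded_series_pd(1) half_gt_zero by metis

lemma analytic_germ_has_pd:
  assumes "analytic_germ p h"
  shows "\<forall>\<^sub>F q in nhds p. \<forall>v. ((\<lambda>s. h (q(v := s))) has_field_derivative pd v h q) (at (q v))"
proof -
  from assms obtain S \<rho> M where "finite S" "0 < \<rho>" "bounded_series p S \<rho> M h"
    unfolding analytic_germ_iff_bounded_series by blast
  then show ?thesis unfolding eventually_nhds_point
    by (intro exI[of _ S] exI[of _ "\<rho> / 2"]) (auto intro: bounded_series_pd)
qed

text \<open>Coordinatewise convergence suffices because a neighbourhood constrains only finitely
  many coordinates.\<close>

lemma tendsto_pointI: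
  fixes p :: "'k::real_normed_field point"
  assumes "\<And>v. ((\<lambda>x. \<Phi> x v) \<longlongrightarrow> p v) G"
  shows "(\<Phi> \<longlongrightarrow> p) G"
  unfolding filterlim_iff
proof (intro allI impI)
  fix Q assume "eventually Q (nhds p)"
  then obtain S \<rho> where S: "finite S" "0 < \<rho>" "\<And>q. q \<in> polydisc p S \<rho> \<Longrightarrow> Q q"
    unfolding eventually_nhds_point by blast
  have "\<forall>\<^sub>F x in G. \<forall>v\<in>S. dist (\<Phi> x v) (p v) < \<rho>"
    using S by (intro eventually_ball_finite ballI tendstoD[OF assms]) auto
  then show "\<forall>\<^sub>F x in G. Q (\<Phi> x)"
    by eventually_elim (auto intro!: S(3) simp: polydisc_def dist_norm)
qed

text \<open>A germ property also holds along the coordinate lines through all nearby points. This is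
  what makes \<open>pd\<close> well defined on germs.\<close>

lemma eventually_fun_upd:
  fixes p :: "'k::real_normed_field point"
  assumes "\<forall>\<^sub>F q in nhds p. Q q"
  shows "\<forall>\<^sub>F q in nhds p. \<forall>v. \<forall>\<^sub>F s in nhds (q v). Q (q(v := s))"
proof -
  from assms obtain S \<rho> where S: "finite S" "0 < \<rho>" "\<And>q. q \<in> polydisc p S \<rho> \<Longrightarrow> Q q"
    unfolding eventually_nhds_point by blast
  have "\<forall>\<^sub>F s in nhds (q v). Q (q(v := s))" if q: "q \<in> polydisc p S \<rho>" for q v
  proof (cases "v \<in> S")
    case True
    then have "q v \<in> ball (p v) \<rho>"
      using q by (auto simp: polydisc_def dist_norm norm_minus_commute)
    then have "\<forall>\<^sub>F s in nhds (q v). s \<in> ball (p v) \<rho>"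
      by (intro eventually_nhds_in_open) auto
    then show ?thesis
      by eventually_elim (use q in \<open>auto intro!: S(3) simp: polydisc_def dist_norm norm_minus_commute\<close>)
  next
    case False
    then have "q(v := s) \<in> polydisc p S \<rho>" for s using q by (auto simp: polydisc_def)
    then show ?thesis by (intro always_eventually allI S(3))
  qed
  then show ?thesis unfolding eventually_nhds_point using S by blast
qed

lemma pd_cong:
  assumes "\<forall>\<^sub>F q in nhds p. h q = h' q"
  shows "\<forall>\<^sub>F q in nhds p. \<forall>v. pd v h q = pd v h' q"
  using eventually_fun_upd[OF assms]
  by eventually_elim (auto simp: pd_def intro!: deriv_cong_ev)

lemma pd_eq_0: "(\<And>s. h (q(v := s)) = h q) \<Longrightarrow> pd v h q = 0"
  by (simp add: pd_def)

lemma analytic_germ_pd_support: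
  assumes "analytic_germ p h"
  obtains S where "finite S" "\<forall>\<^sub>F q in nhds p. \<forall>v. v \<notin> S \<longrightarrow> pd v h q = 0"
proof -
  from assms obtain S \<rho> M where S: "finite S" "0 < \<rho>" "bounded_series p S \<rho> M h"
    unfolding analytic_germ_iff_bounded_series by blast
  have "pd v h q = 0" if "q \<in> polydisc p S \<rho>" "v \<notin> S" for q v
    by (intro pd_eq_0 bounded_series_fun_upd[OF S(3) that(2,1)])
  then show ?thesis using S by (intro that[of S]) (auto simp: eventually_nhds_point)
qed

lemma analytic_germ_tendsto:
  assumes "analytic_germ p h"
  shows "(h \<longlongrightarrow> h p) (nhds p)"
proof (rule tendstoI)
  fix \<epsilon> :: real assume "0 < \<epsilon>"
  have "analytic_germ p (\<lambda>q. h q - h p)" using assms by auto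
  then obtain S \<rho> M where S: "finite S" "0 < \<rho>" "bounded_series p S \<rho> M (\<lambda>q. h q - h p)"
    unfolding analytic_germ_iff_bounded_series by blast
  from bounded_series_small[OF S(3,1,2), of "\<epsilon> / 2"] \<open>0 < \<epsilon>\<close> obtain \<rho>' where
    \<rho>': "0 < \<rho>'" "bounded_series p S \<rho>' (\<epsilon> / 2) (\<lambda>q. h q - h p)" by auto
  have "dist (h q) (h p) < \<epsilon>" if "q \<in> polydisc p S \<rho>'" for q
    using bounded_series_norm_le[OF \<rho>'(2) that] \<open>0 < \<epsilon>\<close> by (simp add: dist_norm)
  then show "\<forall>\<^sub>F q in nhds p. dist (h q) (h p) < \<epsilon>"
    unfolding eventually_nhds_point using S(1) \<rho>'(1) by blast
qed

lemma analytic_germ_nonzero: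
  assumes "analytic_germ p h" "h p \<noteq> 0"
  shows "\<forall>\<^sub>F q in nhds p. h q \<noteq> 0"
  using tendsto_imp_eventually_ne[OF analytic_germ_tendsto[OF assms(1)] assms(2)] .

subsection \<open>The germs form an integral domain\<close>

text \<open>The degree n part of a power series, as a function of the displacement u from the base
  point.\<close>

definition homogeneous_part ::
  "dyn_var set \<Rightarrow> ((dyn_var \<Rightarrow> nat) \<Rightarrow> 'k::comm_ring_1) \<Rightarrow> nat \<Rightarrow> 'k point \<Rightarrow> 'k" where
  "homogeneous_part S c n u = (\<Sum>\<alpha> | \<alpha> \<in> multi_indices S \<and> multi_degree S \<alpha> = n. c \<alpha> * (\<Prod>v\<in>S. u v ^ \<alpha> v))"

lemma finite_multi_indices_multi_degree:
  assumes "finite S"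
  shows "finite {\<alpha> \<in> multi_indices S. multi_degree S \<alpha> = n}"
proof (rule finite_subset)
  show "{\<alpha> \<in> multi_indices S. multi_degree S \<alpha> = n} \<subseteq> {\<alpha>. \<forall>v. (v \<in> S \<longrightarrow> \<alpha> v \<in> {..n}) \<and> (v \<notin> S \<longrightarrow> \<alpha> v = 0)}"
    using assms by (auto simp: multi_indices_def multi_degree_def intro: member_le_sum)
  show "finite {\<alpha>. \<forall>v. (v \<in> S \<longrightarrow> \<alpha> v \<in> {..n}) \<and> (v \<notin> S \<longrightarrow> \<alpha> v = (0::nat))}"
    by (rule finite_set_of_finite_funs) (use assms in auto)
qed

lemma homogeneous_part_scale: "homogeneous_part S c n (\<lambda>v. s * u v) = s ^ n * homogeneous_part S c n u"
  unfolding homogeneous_part_def sum_distrib_left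
  by (intro sum.cong) (auto simp: power_mult_distrib prod.distrib multi_degree_def power_sum mult_ac)

lemma homogeneous_part_line_poly:
  fixes u d :: "'k::{real_normed_field} point"
  obtains P where "\<And>\<tau>. homogeneous_part S c n (\<lambda>v. u v + \<tau> * d v) = poly P \<tau>"
proof -
  define P where "P = (\<Sum>\<alpha> | \<alpha> \<in> multi_indices S \<and> multi_degree S \<alpha> = n. [:c \<alpha>:] * (\<Prod>v\<in>S. [:u v, d v:] ^ \<alpha> v))"
  have "homogeneous_part S c n (\<lambda>v. u v + \<tau> * d v) = poly P \<tau>" for \<tau>
    by (simp add: P_def homogeneous_part_def poly_sum poly_prod poly_power mult.commute)
  then show ?thesis by (rule that)
qed

text \<open>On a ray from p, grouping the multi-indices by total degree leaves a power series in the
  single variable s.\<close>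

lemma homogeneous_part_sums:
  fixes p :: "'k::{real_normed_field,banach} point"
  assumes "finite S"
    and c: "\<And>q. q \<in> polydisc p S \<rho> \<Longrightarrow> ((\<lambda>\<alpha>. c \<alpha> * monomial p S \<alpha> q) has_sum h q) (multi_indices S)"
    and u: "\<And>v. v \<in> S \<Longrightarrow> norm (u v) < \<rho>" and s: "norm s \<le> 1"
  shows "(\<lambda>n. homogeneous_part S c n u * s ^ n) sums h (\<lambda>v. p v + s * u v)"
proof (rule has_sum_imp_sums, rule has_sum_fibers[where e = "multi_degree S"])
  have "norm (s * u v) < \<rho>" if "v \<in> S" for v
    using u[OF that] s mult_right_mono[OF s, of "norm (u v)"] by (simp add: norm_mult)
  then have "(\<lambda>v. p v + s * u v) \<in> polydisc p S \<rho>" by (simp add: polydisc_def)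
  from c[OF this] show "((\<lambda>\<alpha>. c \<alpha> * monomial p S \<alpha> (\<lambda>v. p v + s * u v)) has_sum h (\<lambda>v. p v + s * u v)) (multi_indices S)" .
  show "((\<lambda>\<alpha>. c \<alpha> * monomial p S \<alpha> (\<lambda>v. p v + s * u v)) has_sum homogeneous_part S c n u * s ^ n) {\<alpha> \<in> multi_indices S. multi_degree S \<alpha> = n}" for n
  proof (rule has_sum_finiteI[OF finite_multi_indices_multi_degree[OF assms(1)]])
    have "homogeneous_part S c n u * s ^ n = homogeneous_part S c n (\<lambda>v. s * u v)" by (simp add: homogeneous_part_scale)
    then show "homogeneous_part S c n u * s ^ n = (\<Sum>\<alpha> | \<alpha> \<in> multi_indices S \<and> multi_degree S \<alpha> = n. c \<alpha> * monomial p S \<alpha> (\<lambda>v. p v + s * u v))"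
      by (simp add: homogeneous_part_def monomial_def)
  qed
qed auto

lemma powser_eventually_nonzero:
  fixes a :: "nat \<Rightarrow> 'k::{real_normed_field,banach}"
  assumes "\<And>s. norm s \<le> 1 \<Longrightarrow> (\<lambda>n. a n * s ^ n) sums f s" and "a m \<noteq> 0"
  shows "\<forall>\<^sub>F s in at 0. f s \<noteq> 0"
proof -
  \<comment> \<open>\<open>powser_0_nonzero\<close> concerns series that vanish at the centre, hence
    the factor s and the index moved by one.\<close>
  define b where "b n = (case n of 0 \<Rightarrow> 0 | Suc k \<Rightarrow> a k)" for n
  have "(\<lambda>n. b n * (s - 0) ^ n) sums (s * f s)" if "norm (s - 0) < 1" for s
  proof -
    have "(\<lambda>n. s * (a n * s ^ n)) sums (s * f s)"
      using that by (intro sums_mult assms(1)) auto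
    then have "(\<lambda>n. b (Suc n) * s ^ Suc n) sums (s * f s)"
      by (simp add: b_def mult_ac)
    then show ?thesis by (subst (asm) sums_Suc_iff) (simp add: b_def)
  qed
  from powser_0_nonzero[of 1 0 b "\<lambda>s. s * f s" "Suc m", OF _ this] assms(2)
  obtain r where r: "0 < r" "\<And>z. z \<in> cball 0 r - {0} \<Longrightarrow> z * f z \<noteq> 0"
    by (auto simp: b_def)
  then show ?thesis
    unfolding eventually_at by (intro exI[of _ r]) auto
qed

text \<open>On a ray along which some homogeneous part of each factor is nonzero, both factors
  become nonzero power series in one variable. Their zeros are isolated, so the product cannot
  vanish near the base point.\<close>

lemma analytic_germ_mult_eq_0D:
  fixes p :: "'k::{real_normed_field,banach} point"
  assumes "analytic_germ p h1" "analytic_germ p h2"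
    and zero: "\<forall>\<^sub>F q in nhds p. h1 q * h2 q = 0"
  shows "(\<forall>\<^sub>F q in nhds p. h1 q = 0) \<or> (\<forall>\<^sub>F q in nhds p. h2 q = 0)"
proof (rule ccontr)
  assume neg: "\<not> ?thesis"
  obtain S \<rho> M1 M2 where S: "finite S" "0 < \<rho>" "bounded_series p S \<rho> M1 h1" "bounded_series p S \<rho> M2 h2"
    using analytic_germ_bounded_series2[OF assms(1,2)] by blast
  from S(3) obtain c1 where
    c1: "\<And>q. q \<in> polydisc p S \<rho> \<Longrightarrow> ((\<lambda>\<alpha>. c1 \<alpha> * monomial p S \<alpha> q) has_sum h1 q) (multi_indices S)"
    unfolding bounded_series_def by blast
  from S(4) obtain c2 where
    c2: "\<And>q. q \<in> polydisc p S \<rho> \<Longrightarrow> ((\<lambda>\<alpha>. c2 \<alpha> * monomial p S \<alpha> q) has_sum h2 q) (multi_indices S)"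
    unfolding bounded_series_def by blast
  have ex: "\<exists>n u. homogeneous_part S c n u \<noteq> 0"
    if c: "\<And>q. q \<in> polydisc p S \<rho> \<Longrightarrow> ((\<lambda>\<alpha>. c \<alpha> * monomial p S \<alpha> q) has_sum h q) (multi_indices S)"
      and nz: "\<not> (\<forall>\<^sub>F q in nhds p. h q = 0)" for c h
  proof (rule ccontr)
    assume "\<not> ?thesis"
    then have 0: "homogeneous_part S c n u = 0" for n u by auto
    have "h q = 0" if q: "q \<in> polydisc p S \<rho>" for q
    proof -
      have "(\<lambda>n. 0) sums h q"
        using homogeneous_part_sums[OF S(1) c, where u = "\<lambda>v. q v - p v" and s = 1] q by (simp add: 0 polydisc_def)
      then show ?thesis using sums_unique2 sums_zero by blast
    qed
    then show False using nz S(1,2) unfolding eventually_nhds_point by blast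
  qed
  from ex[OF c1] neg obtain n u1 where 1: "homogeneous_part S c1 n u1 \<noteq> 0" by blast
  from ex[OF c2] neg obtain m u2 where 2: "homogeneous_part S c2 m u2 \<noteq> 0" by blast
  \<comment> \<open>The line through the two directions: the first homogeneous part is nonzero at
    \<tau> = 0, the second at \<tau> = 1. Both are polynomials in \<tau> with finitely many roots,
    so some \<tau> suits both.\<close>
  let ?l = "\<lambda>\<tau> v. u1 v + \<tau> * (u2 v - u1 v)"
  obtain P1 where P1: "\<And>\<tau>. homogeneous_part S c1 n (?l \<tau>) = poly P1 \<tau>"
    using homogeneous_part_line_poly[of S c1 n u1 "\<lambda>v. u2 v - u1 v"] by blast
  obtain P2 where P2: "\<And>\<tau>. homogeneous_part S c2 m (?l \<tau>) = poly P2 \<tau>"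
    using homogeneous_part_line_poly[of S c2 m u1 "\<lambda>v. u2 v - u1 v"] by blast
  have "poly P1 0 \<noteq> 0" "poly P2 1 \<noteq> 0" using 1 2 P1[of 0] P2[of 1] by auto
  then have "P1 * P2 \<noteq> 0" by auto
  then have "finite {\<tau>. poly (P1 * P2) \<tau> = 0}" by (rule poly_roots_finite)
  then obtain \<tau> where "poly (P1 * P2) \<tau> \<noteq> 0"
    using ex_new_if_finite[OF infinite_UNIV_char_0] by blast
  then have w0: "homogeneous_part S c1 n (?l \<tau>) \<noteq> 0" "homogeneous_part S c2 m (?l \<tau>) \<noteq> 0" by (auto simp: P1 P2)
  \<comment> \<open>Used to scale the direction into the polydisc; homogeneity preserves
    nonvanishing. The summand 1 makes B positive and the estimate strict.\<close>
  define B where "B = 1 + (\<Sum>v\<in>S. norm (?l \<tau> v))"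
  have B: "0 < B" unfolding B_def by (simp add: add_pos_nonneg sum_nonneg)
  define w where "w v = of_real (\<rho> / B) * ?l \<tau> v" for v
  have w: "norm (w v) < \<rho>" if "v \<in> S" for v
  proof -
    have "norm (?l \<tau> v) \<le> (\<Sum>v\<in>S. norm (?l \<tau> v))"
      using S(1) that by (intro member_le_sum) auto
    then have "norm (?l \<tau> v) < B" by (simp add: B_def)
    then show ?thesis using S(2) B by (simp add: w_def norm_mult norm_divide divide_simps mult.commute)
  qed
  have hw: "homogeneous_part S c1 n w \<noteq> 0" "homogeneous_part S c2 m w \<noteq> 0"
    using w0 S(2) B unfolding w_def homogeneous_part_scale by auto
  have sums1: "(\<lambda>n. homogeneous_part S c1 n w * s ^ n) sums h1 (\<lambda>v. p v + s * w v)" if "norm s \<le> 1" for s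
    by (rule homogeneous_part_sums[OF S(1) c1 w that])
  have sums2: "(\<lambda>n. homogeneous_part S c2 n w * s ^ n) sums h2 (\<lambda>v. p v + s * w v)" if "norm s \<le> 1" for s
    by (rule homogeneous_part_sums[OF S(1) c2 w that])
  have "\<forall>\<^sub>F s in at 0. h1 (\<lambda>v. p v + s * w v) \<noteq> 0"
    by (rule powser_eventually_nonzero[where a = "\<lambda>n. homogeneous_part S c1 n w", OF sums1 hw(1)])
  moreover have "\<forall>\<^sub>F s in at 0. h2 (\<lambda>v. p v + s * w v) \<noteq> 0"
    by (rule powser_eventually_nonzero[where a = "\<lambda>n. homogeneous_part S c2 n w", OF sums2 hw(2)])
  moreover have "((\<lambda>s v. p v + s * w v) \<longlongrightarrow> p) (at 0)"
    by (rule tendsto_pointI) (auto intro!: tendsto_eq_intros)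
  from filterlim_iff[THEN iffD1, rule_format, OF this zero]
  have "\<forall>\<^sub>F s in at 0. h1 (\<lambda>v. p v + s * w v) * h2 (\<lambda>v. p v + s * w v) = 0" .
  ultimately have "\<forall>\<^sub>F s in at (0::'k). False"
    by eventually_elim simp
  then show False by (simp add: eventually_False)
qed

text \<open>More unknowns than equations force a nontrivial solution over an integral domain; the
  induction is Gaussian elimination without division.\<close>

lemma germ_system_solvable:
  fixes c :: "'j \<Rightarrow> nat \<Rightarrow> 'k::{real_normed_field,banach} dyn_fun"
  assumes "finite J" "n < card J" "\<And>i j. j \<in> J \<Longrightarrow> i < n \<Longrightarrow> analytic_germ p (c j i)"
  shows "\<exists>\<alpha>. (\<forall>j\<in>J. analytic_germ p (\<alpha> j)) \<and> (\<exists>j\<in>J. \<not> (\<forall>\<^sub>F q in nhds p. \<alpha> j q = 0)) \<and>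
    (\<forall>i<n. \<forall>\<^sub>F q in nhds p. (\<Sum>j\<in>J. \<alpha> j q * c j i q) = 0)"
  using assms
proof (induction n arbitrary: J c)
  case 0
  then obtain j where "j \<in> J" by fastforce
  then show ?case by (intro exI[of _ "\<lambda>_ _. 1"]) (auto simp: eventually_False)
next
  case (Suc n)
  show ?case
  proof (cases "\<forall>j\<in>J. \<forall>\<^sub>F q in nhds p. c j n q = 0")
    case True
    from Suc.IH[of J c] Suc.prems obtain \<alpha> where
      \<alpha>: "\<forall>j\<in>J. analytic_germ p (\<alpha> j)" "\<exists>j\<in>J. \<not> (\<forall>\<^sub>F q in nhds p. \<alpha> j q = 0)"
        "\<forall>i<n. \<forall>\<^sub>F q in nhds p. (\<Sum>j\<in>J. \<alpha> j q * c j i q) = 0"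
      by auto
    have "\<forall>\<^sub>F q in nhds p. \<forall>j\<in>J. c j n q = 0"
      using True Suc.prems by (intro eventually_ball_finite) auto
    then have "\<forall>\<^sub>F q in nhds p. (\<Sum>j\<in>J. \<alpha> j q * c j n q) = 0"
      by eventually_elim simp
    with \<alpha> show ?thesis by (auto simp: less_Suc_eq)
  next
    case False
    then obtain j0 where j0: "j0 \<in> J" "\<not> (\<forall>\<^sub>F q in nhds p. c j0 n q = 0)" by blast
    define J' where "J' = J - {j0}"
    have J': "finite J'" "n < card J'" "J = insert j0 J'" "j0 \<notin> J'"
      using Suc.prems j0 by (auto simp: J'_def)
    have an: "analytic_germ p (c j i)" if "j \<in> J" "i \<le> n" for i j
      using Suc.prems that by auto
    have an': "analytic_germ p (\<lambda>q. c j0 n q * c j i q - c j n q * c j0 i q)" if "j \<in> J'" "i < n" for i j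
      by (intro analytic_germ_diff analytic_germ_mult an) (use that J' j0 in auto)
    obtain \<alpha> where
      \<alpha>: "\<forall>j\<in>J'. analytic_germ p (\<alpha> j)" "\<exists>j\<in>J'. \<not> (\<forall>\<^sub>F q in nhds p. \<alpha> j q = 0)"
        "\<forall>i<n. \<forall>\<^sub>F q in nhds p. (\<Sum>j\<in>J'. \<alpha> j q * (c j0 n q * c j i q - c j n q * c j0 i q)) = 0"
      using Suc.IH[OF J'(1,2), of "\<lambda>j i q. c j0 n q * c j i q - c j n q * c j0 i q"] an' by blast
    \<comment> \<open>The pivot \<open>c j0 n\<close> may vanish at p, so the solution of the
      reduced system is multiplied by it instead of the equation being divided. The entry at j0 is
      chosen to satisfy equation n identically, and a nonzero entry stays nonzero because there are
      no zero divisors.\<close>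
    define \<beta> where "\<beta> j q = (if j = j0 then - (\<Sum>j\<in>J'. \<alpha> j q * c j n q) else \<alpha> j q * c j0 n q)" for j q
    have sum\<beta>: "(\<Sum>j\<in>J. \<beta> j q * c j i q) = (\<Sum>j\<in>J'. \<alpha> j q * (c j0 n q * c j i q - c j n q * c j0 i q))" for i q
    proof -
      have "(\<Sum>j\<in>J. \<beta> j q * c j i q) = (\<Sum>j\<in>J'. \<alpha> j q * c j0 n q * c j i q) - (\<Sum>j\<in>J'. \<alpha> j q * c j n q) * c j0 i q"
        unfolding J'(3) using J'(1,4) by (auto simp: \<beta>_def intro!: sum.cong)
      also have "\<dots> = (\<Sum>j\<in>J'. \<alpha> j q * (c j0 n q * c j i q - c j n q * c j0 i q))"
        by (simp add: sum_distrib_right sum_subtractf right_diff_distrib mult.assoc)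
      finally show ?thesis .
    qed
    show ?thesis
    proof (intro exI[of _ \<beta>] conjI ballI allI impI)
      fix j assume "j \<in> J"
      then show "analytic_germ p (\<beta> j)"
        using \<alpha>(1) an J' j0(1) unfolding \<beta>_def
        by (cases "j = j0") (auto intro!: analytic_germ_minus analytic_germ_sum analytic_germ_mult)
    next
      from \<alpha>(2) obtain j where j: "j \<in> J'" "\<not> (\<forall>\<^sub>F q in nhds p. \<alpha> j q = 0)" by blast
      have "\<beta> j = (\<lambda>q. \<alpha> j q * c j0 n q)" using j J' by (auto simp: \<beta>_def fun_eq_iff)
      then have "\<not> (\<forall>\<^sub>F q in nhds p. \<beta> j q = 0)"
        using analytic_germ_mult_eq_0D[of p "\<alpha> j" "c j0 n"] j j0 \<alpha>(1) an[of j0 n] by auto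
      then show "\<exists>j\<in>J. \<not> (\<forall>\<^sub>F q in nhds p. \<beta> j q = 0)" using j J' by blast
    next
      fix i assume "i < Suc n"
      then show "\<forall>\<^sub>F q in nhds p. (\<Sum>j\<in>J. \<beta> j q * c j i q) = 0"
        unfolding sum\<beta> using \<alpha>(3) by (cases "i = n") (auto simp: mult.commute)
    qed
  qed
qed

subsection \<open>Vector fields acting on germs\<close>

text \<open>The index set in \<open>vf_apply\<close> varies with q; a fixed finite S allows the sums
  at all points near p to be treated alike.\<close>

lemma vf_apply_eq_sum:
  assumes "finite S" "\<And>v. v \<notin> S \<Longrightarrow> pd v h q = 0"
  shows "vf_apply V h q = (\<Sum>v\<in>S. V v q * pd v h q)"
  unfolding vf_apply_def using assms by (intro sum.mono_neutral_left) auto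

lemma vf_apply_cong:
  assumes "\<forall>\<^sub>F q in nhds p. h q = h' q"
  shows "\<forall>\<^sub>F q in nhds p. vf_apply V h q = vf_apply V h' q"
  using pd_cong[OF assms] by eventually_elim (simp add: vf_apply_def)

text \<open>Infinitely many coefficient equations hold, each on its own neighbourhood; the finite
  support of h leaves only finitely many neighbourhoods to intersect.\<close>

lemma vf_apply_cong_vf:
  assumes h: "analytic_germ p h" and "\<And>v. \<forall>\<^sub>F q in nhds p. V v q = W v q"
  shows "\<forall>\<^sub>F q in nhds p. vf_apply V h q = vf_apply W h q"
proof -
  obtain S where S: "finite S" "\<forall>\<^sub>F q in nhds p. \<forall>v. v \<notin> S \<longrightarrow> pd v h q = 0"
    using analytic_germ_pd_support[OF h] by blast
  have "\<forall>\<^sub>F q in nhds p. \<forall>v\<in>S. V v q = W v q"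
    using S(1) assms(2) by (intro eventually_ball_finite) auto
  with S(2) show ?thesis
    by eventually_elim (simp add: vf_apply_eq_sum[OF S(1)])
qed

lemma analytic_germ_pd_support2:
  assumes "analytic_germ p h1" "analytic_germ p h2"
  obtains S where "finite S"
    "\<forall>\<^sub>F q in nhds p. \<forall>v. v \<notin> S \<longrightarrow> pd v h1 q = 0 \<and> pd v h2 q = 0"
proof -
  obtain S1 where S1: "finite S1" "\<forall>\<^sub>F q in nhds p. \<forall>v. v \<notin> S1 \<longrightarrow> pd v h1 q = 0"
    using analytic_germ_pd_support[OF assms(1)] .
  obtain S2 where S2: "finite S2" "\<forall>\<^sub>F q in nhds p. \<forall>v. v \<notin> S2 \<longrightarrow> pd v h2 q = 0"
    using analytic_germ_pd_support[OF assms(2)] .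
  from S1(2) S2(2) have "\<forall>\<^sub>F q in nhds p. \<forall>v. v \<notin> S1 \<union> S2 \<longrightarrow> pd v h1 q = 0 \<and> pd v h2 q = 0"
    by eventually_elim auto
  then show ?thesis using that[of "S1 \<union> S2"] S1 S2 by auto
qed

lemma pd_const [simp]: "pd v (\<lambda>_. a) q = 0"
  by (simp add: pd_def)

lemma pd_add:
  assumes "analytic_germ p h1" "analytic_germ p h2"
  shows "\<forall>\<^sub>F q in nhds p. \<forall>v. pd v (\<lambda>q. h1 q + h2 q) q = pd v h1 q + pd v h2 q"
  using analytic_germ_has_pd[OF assms(1)] analytic_germ_has_pd[OF assms(2)]
proof eventually_elim
  case (elim q)
  then show ?case
    unfolding pd_def[of _ "\<lambda>q. h1 q + h2 q"]
    by (auto intro!: DERIV_imp_deriv derivative_eq_intros)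
qed

lemma pd_mult:
  assumes "analytic_germ p h1" "analytic_germ p h2"
  shows "\<forall>\<^sub>F q in nhds p. \<forall>v. pd v (\<lambda>q. h1 q * h2 q) q = pd v h1 q * h2 q + h1 q * pd v h2 q"
  using analytic_germ_has_pd[OF assms(1)] analytic_germ_has_pd[OF assms(2)]
proof eventually_elim
  case (elim q)
  show ?case
  proof
    fix v
    have "((\<lambda>s. h1 (q(v := s)) * h2 (q(v := s))) has_field_derivative
        pd v h1 q * h2 (q(v := q v)) + pd v h2 q * h1 (q(v := q v))) (at (q v))"
      using elim by (intro DERIV_mult) auto
    then show "pd v (\<lambda>q. h1 q * h2 q) q = pd v h1 q * h2 q + h1 q * pd v h2 q"
      unfolding pd_def[of _ "\<lambda>q. h1 q * h2 q"] by (auto dest!: DERIV_imp_deriv simp: mult.commute)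
  qed
qed

lemma pd_coord: "pd v (\<lambda>q. q u) q = (if v = u then 1 else 0)"
  by (auto simp: pd_def)

lemma vf_apply_const [simp]: "vf_apply V (\<lambda>_. a) q = 0"
  by (simp add: vf_apply_def)

lemma vf_apply_coord [simp]: "vf_apply V (\<lambda>q. q u) q = V u q"
  by (subst vf_apply_eq_sum[of "{u}"]) (auto simp: pd_coord)

lemma vf_apply_add:
  assumes "analytic_germ p h1" "analytic_germ p h2"
  shows "\<forall>\<^sub>F q in nhds p. vf_apply V (\<lambda>q. h1 q + h2 q) q = vf_apply V h1 q + vf_apply V h2 q"
proof -
  obtain S where S: "finite S"
    "\<forall>\<^sub>F q in nhds p. \<forall>v. v \<notin> S \<longrightarrow> pd v h1 q = 0 \<and> pd v h2 q = 0"
    using analytic_germ_pd_support2[OF assms] by blast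
  from S(2) pd_add[OF assms] show ?thesis
    by eventually_elim (simp add: vf_apply_eq_sum[OF S(1)] distrib_left sum.distrib)
qed

lemma vf_apply_mult:
  assumes "analytic_germ p h1" "analytic_germ p h2"
  shows "\<forall>\<^sub>F q in nhds p. vf_apply V (\<lambda>q. h1 q * h2 q) q = vf_apply V h1 q * h2 q + h1 q * vf_apply V h2 q"
proof -
  obtain S where S: "finite S"
    "\<forall>\<^sub>F q in nhds p. \<forall>v. v \<notin> S \<longrightarrow> pd v h1 q = 0 \<and> pd v h2 q = 0"
    using analytic_germ_pd_support2[OF assms] by blast
  from S(2) pd_mult[OF assms] show ?thesis
    by eventually_elim
      (simp add: vf_apply_eq_sum[OF S(1)] distrib_left sum.distrib sum_distrib_left sum_distrib_right mult_ac)
qed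

lemma vf_apply_cmult:
  assumes "analytic_germ p h"
  shows "\<forall>\<^sub>F q in nhds p. vf_apply V (\<lambda>q. a * h q) q = a * vf_apply V h q"
  using vf_apply_mult[OF analytic_germ_const[of p a] assms] by simp

lemma vf_apply_minus:
  assumes "analytic_germ p h"
  shows "\<forall>\<^sub>F q in nhds p. vf_apply V (\<lambda>q. - h q) q = - vf_apply V h q"
  using vf_apply_cmult[OF assms, of V "- 1"] by simp

lemma vf_apply_diff:
  assumes "analytic_germ p h1" "analytic_germ p h2"
  shows "\<forall>\<^sub>F q in nhds p. vf_apply V (\<lambda>q. h1 q - h2 q) q = vf_apply V h1 q - vf_apply V h2 q"
  using vf_apply_add[OF assms(1) analytic_germ_minus[OF assms(2)], of V] vf_apply_minus[OF assms(2), of V]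
  by eventually_elim simp

lemma vf_apply_plus_vf:
  assumes "analytic_germ p h"
  shows "\<forall>\<^sub>F q in nhds p. vf_apply (\<lambda>v q. V v q + W v q) h q = vf_apply V h q + vf_apply W h q"
proof -
  obtain S where S: "finite S" "\<forall>\<^sub>F q in nhds p. \<forall>v. v \<notin> S \<longrightarrow> pd v h q = 0"
    using analytic_germ_pd_support[OF assms] by blast
  from S(2) show ?thesis
    by eventually_elim (simp add: vf_apply_eq_sum[OF S(1)] distrib_right sum.distrib)
qed

lemma vf_apply_scale_vf: "vf_apply (\<lambda>v q. a q * V v q) h q = a q * vf_apply V h q"
  by (simp add: vf_apply_def sum_distrib_left mult.assoc)

lemma vf_apply_zero_vf [simp]: "vf_apply (\<lambda>v q. 0) h q = 0"
  by (simp add: vf_apply_def)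

lemma vf_apply_X:
  assumes "analytic_germ p h"
  shows "\<forall>\<^sub>F q in nhds p. vf_apply vf_X h q = pd Vtx h q"
proof -
  obtain S where S: "finite S" "\<forall>\<^sub>F q in nhds p. \<forall>v. v \<notin> S \<longrightarrow> pd v h q = 0"
    using analytic_germ_pd_support[OF assms] by blast
  from S(2) show ?thesis
  proof eventually_elim
    case (elim q)
    have "vf_apply vf_X h q = (\<Sum>v\<in>insert Vtx S. vf_X v q * pd v h q)"
      using elim S(1) by (intro vf_apply_eq_sum) auto
    also have "\<dots> = (\<Sum>v\<in>{Vtx}. vf_X v q * pd v h q)"
      using S(1) by (intro sum.mono_neutral_right) (auto simp: vf_X_def)
    finally show ?case by (simp add: vf_X_def)
  qed
qed

section \<open>Vector fields with analytic coefficients and their brackets\<close>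

definition vf_analytic :: "'k::{real_normed_field,banach} point \<Rightarrow> 'k vfield \<Rightarrow> bool" where
  "vf_analytic p V \<longleftrightarrow> (\<forall>v. analytic_germ p (V v))"

lemma vf_analyticD: "vf_analytic p V \<Longrightarrow> analytic_germ p (V v)"
  by (simp add: vf_analytic_def)

lemma vf_apply_analytic [intro]:
  assumes "analytic_germ p h" "vf_analytic p V"
  shows "analytic_germ p (vf_apply V h)"
proof -
  obtain S where S: "finite S" "\<forall>\<^sub>F q in nhds p. \<forall>v. v \<notin> S \<longrightarrow> pd v h q = 0"
    using analytic_germ_pd_support[OF assms(1)] by blast
  from S(2) have "\<forall>\<^sub>F q in nhds p. (\<Sum>v\<in>S. V v q * pd v h q) = vf_apply V h q"
    by eventually_elim (simp add: vf_apply_eq_sum[OF S(1)])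
  then show ?thesis
    by (rule analytic_germ_cong[rotated])
       (intro analytic_germ_sum analytic_germ_mult vf_analyticD[OF assms(2)] analytic_germ_pd assms(1))
qed

lemma vf_analytic_X: "vf_analytic p vf_X"
proof -
  have "vf_X v = (\<lambda>_. if v = Vtx then 1 else 0 :: 'a)" for v by (simp add: vf_X_def fun_eq_iff)
  then show ?thesis by (simp add: vf_analytic_def)
qed

lemma vf_analytic_bracket:
  assumes "vf_analytic p V" "vf_analytic p W"
  shows "vf_analytic p (vf_bracket V W)"
proof -
  have "analytic_germ p (\<lambda>q. vf_apply V (W v) q - vf_apply W (V v) q)" for v
    by (intro analytic_germ_diff vf_apply_analytic vf_analyticD assms)
  then show ?thesis by (simp add: vf_analytic_def vf_bracket_def)
qed

lemma vf_analytic_add: "vf_analytic p V \<Longrightarrow> vf_analytic p W \<Longrightarrow> vf_analytic p (\<lambda>v q. V v q + W v q)"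
  by (auto simp: vf_analytic_def)

lemma vf_analytic_scale: "analytic_germ p a \<Longrightarrow> vf_analytic p V \<Longrightarrow> vf_analytic p (\<lambda>v q. a q * V v q)"
  by (auto simp: vf_analytic_def)

lemma vf_analytic_cong: "vf_analytic p V \<Longrightarrow> vf_eq_at p V W \<Longrightarrow> vf_analytic p W"
  unfolding vf_analytic_def vf_eq_at_def using analytic_germ_cong by blast

lemma vf_analytic_zero: "vf_analytic p (\<lambda>v q. 0)"
  by (simp add: vf_analytic_def)

lemma vf_eq_at_refl [simp]: "vf_eq_at p V V"
  by (simp add: vf_eq_at_def)

lemma vf_eq_at_sym: "vf_eq_at p V W \<Longrightarrow> vf_eq_at p W V"
  by (simp add: vf_eq_at_def eq_commute)

lemma vf_eq_at_trans: "vf_eq_at p U V \<Longrightarrow> vf_eq_at p V W \<Longrightarrow> vf_eq_at p U W"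
  unfolding vf_eq_at_def by (blast intro: eventually_elim2 trans)

lemma vf_bracket_swap: "vf_bracket V W = (\<lambda>v q. - 1 * vf_bracket W V v q)"
  by (simp add: vf_bracket_def fun_eq_iff)

lemma vf_bracket_cong_left:
  assumes "vf_analytic p W" "vf_eq_at p V V'"
  shows "vf_eq_at p (vf_bracket V W) (vf_bracket V' W)"
  unfolding vf_eq_at_def
proof
  fix v
  have "\<forall>\<^sub>F q in nhds p. vf_apply V (W v) q = vf_apply V' (W v) q"
    using assms by (intro vf_apply_cong_vf) (auto simp: vf_analytic_def vf_eq_at_def)
  moreover have "\<forall>\<^sub>F q in nhds p. vf_apply W (V v) q = vf_apply W (V' v) q"
    using assms by (intro vf_apply_cong) (auto simp: vf_eq_at_def)
  ultimately show "\<forall>\<^sub>F q in nhds p. vf_bracket V W v q = vf_bracket V' W v q"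
    by eventually_elim (simp add: vf_bracket_def)
qed

lemma vf_bracket_add_left:
  assumes "vf_analytic p V" "vf_analytic p V'" "vf_analytic p W"
  shows "vf_eq_at p (\<lambda>v q. vf_bracket V W v q + vf_bracket V' W v q) (vf_bracket (\<lambda>v q. V v q + V' v q) W)"
  unfolding vf_eq_at_def
proof
  fix v
  show "\<forall>\<^sub>F q in nhds p. vf_bracket V W v q + vf_bracket V' W v q = vf_bracket (\<lambda>v q. V v q + V' v q) W v q"
    using vf_apply_plus_vf[OF vf_analyticD[OF assms(3)], of V V' v]
      vf_apply_add[OF vf_analyticD[OF assms(1)] vf_analyticD[OF assms(2)], of W v v]
    by eventually_elim (simp add: vf_bracket_def)
qed

lemma vf_bracket_scale_left:
  assumes "analytic_germ p a" "vf_analytic p V"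
  shows "vf_eq_at p (\<lambda>v q. a q * vf_bracket V W v q + - vf_apply W a q * V v q) (vf_bracket (\<lambda>v q. a q * V v q) W)"
  unfolding vf_eq_at_def
proof
  fix v
  show "\<forall>\<^sub>F q in nhds p. a q * vf_bracket V W v q + - vf_apply W a q * V v q = vf_bracket (\<lambda>v q. a q * V v q) W v q"
    using vf_apply_mult[OF assms(1) vf_analyticD[OF assms(2)], of W v]
    by eventually_elim (simp add: vf_bracket_def vf_apply_scale_vf algebra_simps)
qed

subsection \<open>Spans over the ring of germs\<close>

text \<open>The rule \<open>cong\<close> passes between representatives of the same germs, since the
  bracket rules for sums and multiples hold only near p.\<close>

inductive_set germ_span ::
  "'k::{real_normed_field,banach} point \<Rightarrow> 'k vfield set \<Rightarrow> 'k vfield set" for p B where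
  zero: "(\<lambda>v q. 0) \<in> germ_span p B"
| base: "V \<in> B \<Longrightarrow> V \<in> germ_span p B"
| add: "V \<in> germ_span p B \<Longrightarrow> W \<in> germ_span p B \<Longrightarrow> (\<lambda>v q. V v q + W v q) \<in> germ_span p B"
| scale: "analytic_germ p a \<Longrightarrow> V \<in> germ_span p B \<Longrightarrow> (\<lambda>v q. a q * V v q) \<in> germ_span p B"
| cong: "V \<in> germ_span p B \<Longrightarrow> vf_eq_at p V W \<Longrightarrow> W \<in> germ_span p B"

lemma germ_span_analytic:
  assumes "V \<in> germ_span p B" "\<And>V. V \<in> B \<Longrightarrow> vf_analytic p V"
  shows "vf_analytic p V"
  using assms(1)
  by (induction rule: germ_span.induct)
     (auto intro: assms(2) vf_analytic_zero vf_analytic_add vf_analytic_scale vf_analytic_cong)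

text \<open>The scaling case is the Leibniz rule \<open>[a V, W] = a [V, W] - W(a) V\<close>, whose
  last term again lies in the span.\<close>

lemma germ_span_bracket_left:
  assumes "V \<in> germ_span p B" and B: "\<And>V. V \<in> B \<Longrightarrow> vf_analytic p V"
    and W: "vf_analytic p W" and br: "\<And>V. V \<in> B \<Longrightarrow> vf_bracket V W \<in> germ_span p B"
  shows "vf_bracket V W \<in> germ_span p B"
  using assms(1)
proof (induction rule: germ_span.induct)
  case zero
  have "vf_bracket (\<lambda>v q. 0) W = (\<lambda>v q. 0)" by (simp add: vf_bracket_def)
  then show ?case by (simp add: germ_span.zero)
next
  case (base V)
  then show ?case by (rule br)
next
  case (add V V')
  show ?case
    by (rule germ_span.cong[OF germ_span.add[OF add.IH] vf_bracket_add_left])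
       (rule germ_span_analytic[OF add.hyps(1) B] germ_span_analytic[OF add.hyps(2) B] W; assumption?)+
next
  case (scale a V)
  have "(\<lambda>v q. a q * vf_bracket V W v q + - vf_apply W a q * V v q) \<in> germ_span p B"
    using germ_span.add[OF germ_span.scale[OF scale.hyps(1) scale.IH]
        germ_span.scale[OF analytic_germ_minus[OF vf_apply_analytic[OF scale.hyps(1) W]] scale.hyps(2)]] .
  then show ?case
    by (rule germ_span.cong[OF _ vf_bracket_scale_left[OF scale.hyps(1) germ_span_analytic[OF scale.hyps(2) B]]])
next
  case (cong V V')
  show ?case by (rule germ_span.cong[OF cong.IH vf_bracket_cong_left[OF W cong.hyps(2)]])
qed

lemma germ_span_uminus: "V \<in> germ_span p B \<Longrightarrow> (\<lambda>v q. - 1 * V v q) \<in> germ_span p B"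
  by (rule germ_span.scale[OF analytic_germ_const])

lemma germ_span_bracket:
  assumes "V \<in> germ_span p B" "W \<in> germ_span p B" and B: "\<And>V. V \<in> B \<Longrightarrow> vf_analytic p V"
    and br: "\<And>V W. V \<in> B \<Longrightarrow> W \<in> B \<Longrightarrow> vf_bracket V W \<in> germ_span p B"
  shows "vf_bracket V W \<in> germ_span p B"
proof (rule germ_span_bracket_left[OF assms(1) B])
  show "vf_analytic p W" by (rule germ_span_analytic[OF assms(2) B])
  fix V assume V: "V \<in> B"
  have "vf_bracket W V \<in> germ_span p B"
    by (rule germ_span_bracket_left[OF assms(2) B B[OF V] br[OF _ V]])
  from germ_span_uminus[OF this] show "vf_bracket V W \<in> germ_span p B"
    by (subst vf_bracket_swap)
qed

lemma x_ring_subset_germ_span: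
  assumes B: "\<And>V. V \<in> B \<Longrightarrow> vf_analytic p V"
    and br: "\<And>V W. V \<in> B \<Longrightarrow> W \<in> B \<Longrightarrow> vf_bracket V W \<in> germ_span p B"
    and "vf_X \<in> B" "vf_K f g \<in> B"
  shows "x_ring f g p \<subseteq> germ_span p B"
proof
  fix V assume "V \<in> x_ring f g p"
  then show "V \<in> germ_span p B"
  proof (induction rule: x_ring.induct)
    case X
    show ?case by (rule germ_span.base[OF assms(3)])
  next
    case K
    show ?case by (rule germ_span.base[OF assms(4)])
  next
    case (add V W)
    show ?case by (rule germ_span.add[OF add.IH])
  next
    case (scale a V)
    show ?case by (rule germ_span.scale[OF scale.hyps(1) scale.IH])
  next
    case (bracket V W)
    show ?case by (rule germ_span_bracket[OF bracket.IH B br])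
  qed
qed

lemma germ_span_lin_comb:
  assumes "V \<in> germ_span p (set Vs)"
  shows "\<exists>a. (\<forall>i<length Vs. analytic_germ p (a i)) \<and> vf_eq_at p V (lin_comb a Vs)"
  using assms
proof (induction rule: germ_span.induct)
  case zero
  show ?case by (intro exI[of _ "\<lambda>_ _. 0"]) (auto simp: lin_comb_def)
next
  case (base V)
  then obtain j where j: "j < length Vs" "V = Vs ! j" by (auto simp: in_set_conv_nth)
  have "lin_comb (\<lambda>i _. if i = j then 1 else 0) Vs = V"
    using j by (simp add: lin_comb_def fun_eq_iff if_distrib[of "\<lambda>x. x * _"] cong: if_cong)
  then show ?case by (intro exI[of _ "\<lambda>i _. if i = j then 1 else 0"]) auto
next
  case (add V W)
  then obtain a b where "\<forall>i<length Vs. analytic_germ p (a i)" "vf_eq_at p V (lin_comb a Vs)"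
    "\<forall>i<length Vs. analytic_germ p (b i)" "vf_eq_at p W (lin_comb b Vs)" by blast
  moreover from this have "vf_eq_at p (\<lambda>v q. V v q + W v q) (\<lambda>v q. lin_comb a Vs v q + lin_comb b Vs v q)"
    unfolding vf_eq_at_def by (blast intro: eventually_elim2 arg_cong2[where f = "(+)"])
  ultimately show ?case
    by (intro exI[of _ "\<lambda>i q. a i q + b i q"])
       (auto simp: lin_comb_def distrib_right sum.distrib)
next
  case (scale c V)
  then obtain a where a: "\<forall>i<length Vs. analytic_germ p (a i)" "vf_eq_at p V (lin_comb a Vs)" by blast
  have "vf_eq_at p (\<lambda>v q. c q * V v q) (lin_comb (\<lambda>i q. c q * a i q) Vs)"
    unfolding vf_eq_at_def
  proof
    fix v
    have "\<forall>\<^sub>F q in nhds p. V v q = lin_comb a Vs v q" using a(2) by (simp add: vf_eq_at_def)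
    then show "\<forall>\<^sub>F q in nhds p. c q * V v q = lin_comb (\<lambda>i q. c q * a i q) Vs v q"
      by eventually_elim (simp add: lin_comb_def sum_distrib_left mult.assoc)
  qed
  then show ?case using a(1) scale.hyps(1)
    by (intro exI[of _ "\<lambda>i q. c q * a i q"]) auto
next
  case (cong V W)
  then show ?case using vf_eq_at_sym vf_eq_at_trans by blast
qed

text \<open>With more vectors than generators, the coordinates form a system with fewer equations
  than unknowns; a nontrivial germ solution is a linear relation among the vectors.\<close>

lemma germ_span_lin_indep_length:
  assumes "set Us \<subseteq> germ_span p (set Vs)" "lin_indep_at p Us"
  shows "length Us \<le> length Vs"
proof (rule ccontr)
  assume "\<not> ?thesis"
  then have less: "length Vs < card {..<length Us}" by simp
  have "\<forall>j\<in>{..<length Us}. \<exists>a. (\<forall>i<length Vs. analytic_germ p (a i)) \<and> vf_eq_at p (Us ! j) (lin_comb a Vs)"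
    using assms(1) nth_mem by (intro ballI germ_span_lin_comb) auto
  from bchoice[OF this] obtain c where
    c: "\<And>j i. j < length Us \<Longrightarrow> i < length Vs \<Longrightarrow> analytic_germ p (c j i)"
      "\<And>j. j < length Us \<Longrightarrow> vf_eq_at p (Us ! j) (lin_comb (c j) Vs)" by auto
  obtain \<alpha> where \<alpha>: "\<forall>j<length Us. analytic_germ p (\<alpha> j)"
    "\<exists>j<length Us. \<not> (\<forall>\<^sub>F q in nhds p. \<alpha> j q = 0)"
    "\<forall>i<length Vs. \<forall>\<^sub>F q in nhds p. (\<Sum>j<length Us. \<alpha> j q * c j i q) = 0"
    using germ_system_solvable[OF finite_lessThan less, of p c] c(1) by auto
  have "vf_eq_at p (lin_comb \<alpha> Us) (\<lambda>v q. 0)"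
    unfolding vf_eq_at_def
  proof
    fix v
    have "\<forall>\<^sub>F q in nhds p. \<forall>j\<in>{..<length Us}. (Us ! j) v q = lin_comb (c j) Vs v q"
      using c(2) by (intro eventually_ball_finite) (auto simp: vf_eq_at_def)
    moreover have "\<forall>\<^sub>F q in nhds p. \<forall>i\<in>{..<length Vs}. (\<Sum>j<length Us. \<alpha> j q * c j i q) = 0"
      using \<alpha>(3) by (intro eventually_ball_finite) auto
    ultimately show "\<forall>\<^sub>F q in nhds p. lin_comb \<alpha> Us v q = 0"
    proof eventually_elim
      case (elim q)
      have "lin_comb \<alpha> Us v q = (\<Sum>j<length Us. \<Sum>i<length Vs. \<alpha> j q * c j i q * (Vs ! i) v q)"
        using elim(1) by (simp add: lin_comb_def sum_distrib_left mult.assoc)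
      also have "\<dots> = (\<Sum>i<length Vs. (\<Sum>j<length Us. \<alpha> j q * c j i q) * (Vs ! i) v q)"
        by (subst sum.swap) (simp add: sum_distrib_right)
      also have "\<dots> = 0" using elim(2) by simp
      finally show ?case .
    qed
  qed
  then show False using assms(2) \<alpha> unfolding lin_indep_at_def by blast
qed

subsection \<open>Germs that are affine in one variable\<close>

lemma analytic_germ_freeze:
  assumes "analytic_germ p h"
  shows "analytic_germ p (\<lambda>q. h (q(v := p v)))"
proof (rule analytic_germ_compose[where \<Phi> = "\<lambda>q. q(v := p v)"])
  show "analytic_germ p (\<lambda>q. (q(v := p v)) u)" for u by (cases "u = v") auto
qed (use assms in simp)

text \<open>Along v the first derivative has derivative zero on a ball, which is convex, so it is
  constant there; subtracting the linear part leaves another constant.\<close>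

lemma affine_in_variable:
  assumes h: "analytic_germ p h" and 0: "\<forall>\<^sub>F q in nhds p. pd v (pd v h) q = 0"
  shows "\<forall>\<^sub>F q in nhds p. h q = pd v h (q(v := p v)) * (q v - p v) + h (q(v := p v))"
proof -
  have "\<forall>\<^sub>F q in nhds p. ((\<lambda>s. h (q(v := s))) has_field_derivative pd v h q) (at (q v)) \<and>
      ((\<lambda>s. pd v h (q(v := s))) has_field_derivative 0) (at (q v))"
    using analytic_germ_has_pd[OF h] analytic_germ_has_pd[OF analytic_germ_pd[OF h, of v]] 0
    by eventually_elim metis
  then obtain S \<rho> where S: "finite S" "0 < \<rho>" and
    d: "\<And>q. q \<in> polydisc p S \<rho> \<Longrightarrow> ((\<lambda>s. h (q(v := s))) has_field_derivative pd v h q) (at (q v)) \<and>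
      ((\<lambda>s. pd v h (q(v := s))) has_field_derivative 0) (at (q v))"
    unfolding eventually_nhds_point by blast
  \<comment> \<open>S may omit v, whereas \<open>q v\<close> has to lie in the ball around
    \<open>p v\<close>.\<close>
  have "h q = pd v h (q(v := p v)) * (q v - p v) + h (q(v := p v))" if q: "q \<in> polydisc p (insert v S) \<rho>" for q
  proof -
    have in_disc: "q(v := s) \<in> polydisc p S \<rho>" if "s \<in> ball (p v) \<rho>" for s
      using that q by (auto simp: polydisc_def dist_norm norm_minus_commute)
    have d1: "((\<lambda>s. h (q(v := s))) has_field_derivative pd v h (q(v := s))) (at s)"
      and d2: "((\<lambda>s. pd v h (q(v := s))) has_field_derivative 0) (at s)"
      if "s \<in> ball (p v) \<rho>" for s
      using d[OF in_disc[OF that]] by auto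
    have mem: "q v \<in> ball (p v) \<rho>" "p v \<in> ball (p v) \<rho>"
      using q S by (auto simp: polydisc_def dist_norm norm_minus_commute)
    obtain a where a: "\<And>s. s \<in> ball (p v) \<rho> \<Longrightarrow> pd v h (q(v := s)) = a"
      using has_field_derivative_zero_constant[OF convex_ball, of "p v" \<rho> "\<lambda>s. pd v h (q(v := s))"]
        has_field_derivative_at_within[OF d2] by blast
    have "((\<lambda>s. h (q(v := s)) - a * s) has_field_derivative 0) (at s within ball (p v) \<rho>)"
      if "s \<in> ball (p v) \<rho>" for s
      using has_field_derivative_at_within[OF d1[OF that]] a[OF that]
      by (auto intro!: derivative_eq_intros)
    then obtain c where "\<And>s. s \<in> ball (p v) \<rho> \<Longrightarrow> h (q(v := s)) - a * s = c"
      using has_field_derivative_zero_constant[OF convex_ball, of "p v" \<rho> "\<lambda>s. h (q(v := s)) - a * s"] by blast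
    from this[OF mem(1)] this[OF mem(2)] a[OF mem(2)] show ?thesis
      by (simp add: algebra_simps)
  qed
  then show ?thesis
    unfolding eventually_nhds_point using S by (intro exI[of _ "insert v S"] exI[of _ \<rho>]) auto
qed

text \<open>Near p the function is \<open>c q * q u + d q\<close> with c and d free of u, and both
  mixed derivatives equal \<open>pd v c\<close>.\<close>

lemma pd_swap_affine:
  assumes h: "analytic_germ p h" and 0: "\<forall>\<^sub>F q in nhds p. pd u (pd u h) q = 0"
  shows "\<forall>\<^sub>F q in nhds p. pd u (pd v h) q = pd v (pd u h) q"
proof (cases "u = v")
  case False
  define c where "c q = pd u h (q(u := p u))" for q
  define d where "d q = h (q(u := p u)) - c q * p u" for q
  have an: "analytic_germ p c" "analytic_germ p d"
    unfolding c_def d_def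
    by (intro analytic_germ_diff analytic_germ_mult analytic_germ_freeze[where h = h]
        analytic_germ_freeze[where h = "pd u h"] analytic_germ_pd h analytic_germ_const)+
  have c0: "pd u c q = 0" "pd u d q = 0" "pd u (pd v c) q = 0" "pd u (pd v d) q = 0" for q
    using False by (auto intro!: pd_eq_0 simp: c_def d_def pd_def fun_upd_twist)
  have "\<forall>\<^sub>F q in nhds p. h q = c q * q u + d q"
    using affine_in_variable[OF h 0] by eventually_elim (simp add: c_def d_def algebra_simps)
  from pd_cong[OF this] pd_add[OF analytic_germ_mult[OF an(1) analytic_germ_coord[of p u]] an(2)]
    pd_mult[OF an(1) analytic_germ_coord[of p u]]
  have pdh: "\<forall>\<^sub>F q in nhds p. \<forall>v. pd v h q = pd v c q * q u + c q * (if v = u then 1 else 0) + pd v d q"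
    by eventually_elim (simp add: pd_coord)
  have "\<forall>\<^sub>F q in nhds p. pd v h q = pd v c q * q u + pd v d q"
    using pdh by eventually_elim (use False in auto)
  from pd_cong[OF this]
    pd_add[OF analytic_germ_mult[OF analytic_germ_pd[OF an(1), of v] analytic_germ_coord[of p u]] analytic_germ_pd[OF an(2), of v]]
    pd_mult[OF analytic_germ_pd[OF an(1), of v] analytic_germ_coord[of p u]]
  have 1: "\<forall>\<^sub>F q in nhds p. pd u (pd v h) q = pd v c q"
    by eventually_elim (simp add: pd_coord c0)
  have "\<forall>\<^sub>F q in nhds p. pd u h q = c q"
    using pdh by eventually_elim (simp add: c0)
  from pd_cong[OF this] 1 show ?thesis
    by eventually_elim simp
qed simp

text \<open>The product rule \<open>X(V(h)) = [X, V](h) + V(X(h))\<close>. The fields V' and the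
  function h' are required to agree with the derivatives only as germs, so that \<open>C1\<close>
  and zero can be inserted later.\<close>

lemma vf_apply_X_commute:
  assumes h: "analytic_germ p h" and 0: "\<forall>\<^sub>F q in nhds p. pd Vtx (pd Vtx h) q = 0"
    and V: "vf_analytic p V" and V': "\<And>v. \<forall>\<^sub>F q in nhds p. V' v q = pd Vtx (V v) q"
    and h': "\<forall>\<^sub>F q in nhds p. h' q = pd Vtx h q"
  shows "\<forall>\<^sub>F q in nhds p. pd Vtx (vf_apply V h) q = vf_apply V' h q + vf_apply V h' q"
proof -
  obtain S0 where S0: "finite S0" "\<forall>\<^sub>F q in nhds p. \<forall>v. v \<notin> S0 \<longrightarrow> pd v h q = 0 \<and> pd v (pd Vtx h) q = 0"
    using analytic_germ_pd_support2[OF h analytic_germ_pd[OF h, of Vtx]] .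
  have an: "analytic_germ p (\<lambda>q. V v q * pd v h q)" for v
    by (intro analytic_germ_mult vf_analyticD V analytic_germ_pd h)
  have sum: "\<forall>\<^sub>F q in nhds p. pd Vtx (\<lambda>q. \<Sum>v\<in>S. V v q * pd v h q) q = (\<Sum>v\<in>S. pd Vtx (\<lambda>q. V v q * pd v h q) q)"
    if "finite S" for S
    using that
  proof (induction S rule: finite_induct)
    case (insert u S)
    have "analytic_germ p (\<lambda>q. \<Sum>v\<in>S. V v q * pd v h q)" by (intro analytic_germ_sum an)
    from pd_add[OF an[of u] this] insert.IH show ?case
      by eventually_elim (use insert.hyps in simp)
  qed simp
  have "\<forall>\<^sub>F q in nhds p. vf_apply V h q = (\<Sum>v\<in>S0. V v q * pd v h q)"
    using S0(2) by eventually_elim (auto intro!: vf_apply_eq_sum S0(1))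
  from pd_cong[OF this] sum[OF S0(1)]
  have 1: "\<forall>\<^sub>F q in nhds p. pd Vtx (vf_apply V h) q = (\<Sum>v\<in>S0. pd Vtx (\<lambda>q. V v q * pd v h q) q)"
    by eventually_elim simp
  have "\<forall>\<^sub>F q in nhds p. pd Vtx (\<lambda>q. V v q * pd v h q) q = V' v q * pd v h q + V v q * pd v (pd Vtx h) q" for v
    using pd_mult[OF vf_analyticD[OF V, of v] analytic_germ_pd[OF h, of v]] V'[of v] pd_swap_affine[OF h 0, of v]
    by eventually_elim simp
  then have "\<forall>\<^sub>F q in nhds p. \<forall>v\<in>S0. pd Vtx (\<lambda>q. V v q * pd v h q) q = V' v q * pd v h q + V v q * pd v (pd Vtx h) q"
    using S0(1) by (intro eventually_ball_finite) auto
  with 1 S0(2) vf_apply_cong[OF h', of V] show ?thesis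
  proof eventually_elim
    case (elim q)
    have "vf_apply V' h q = (\<Sum>v\<in>S0. V' v q * pd v h q)" "vf_apply V (pd Vtx h) q = (\<Sum>v\<in>S0. V v q * pd v (pd Vtx h) q)"
      using elim(2) by (auto intro!: vf_apply_eq_sum S0(1))
    then show ?case using elim by (simp add: sum.distrib)
  qed
qed

subsection \<open>Functions of three consecutive variables\<close>

text \<open>The form of the k-th shifts of a, b and m: without \<open>t\<^sub>x\<close> among the
  arguments, the shift merely replaces \<open>t\<close>, \<open>t\<^sub>1\<close> by
  \<open>t\<^sub>k\<close> and its successor.\<close>

definition lift3 :: "int \<Rightarrow> ('k \<Rightarrow> 'k \<Rightarrow> 'k \<Rightarrow> 'k) \<Rightarrow> 'k dyn_fun" where
  "lift3 k c q = c (q Vx) (q (Vt k)) (q (Vt (k + 1)))"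

definition d1 :: "('k::real_normed_field \<Rightarrow> 'k \<Rightarrow> 'k \<Rightarrow> 'k) \<Rightarrow> 'k \<Rightarrow> 'k \<Rightarrow> 'k \<Rightarrow> 'k" where
  "d1 c x y z = deriv (\<lambda>s. c s y z) x"

definition d2 :: "('k::real_normed_field \<Rightarrow> 'k \<Rightarrow> 'k \<Rightarrow> 'k) \<Rightarrow> 'k \<Rightarrow> 'k \<Rightarrow> 'k \<Rightarrow> 'k" where
  "d2 c x y z = deriv (\<lambda>s. c x s z) y"

definition d3 :: "('k::real_normed_field \<Rightarrow> 'k \<Rightarrow> 'k \<Rightarrow> 'k) \<Rightarrow> 'k \<Rightarrow> 'k \<Rightarrow> 'k \<Rightarrow> 'k" where
  "d3 c x y z = deriv (\<lambda>s. c x y s) z"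

lemma pd_lift3:
  "pd Vx (lift3 k c) = lift3 k (d1 c)"
  "pd (Vt k) (lift3 k c) = lift3 k (d2 c)"
  "pd (Vt (k + 1)) (lift3 k c) = lift3 k (d3 c)"
  by (simp_all add: fun_eq_iff pd_def lift3_def d1_def d2_def d3_def)

lemma pd_lift3_other:
  "v \<notin> {Vx, Vt k, Vt (k + 1)} \<Longrightarrow> pd v (lift3 k c) q = 0"
  by (rule pd_eq_0) (auto simp: lift3_def)

lemma vf_apply_lift3:
  "vf_apply V (lift3 k c) q =
    V Vx q * lift3 k (d1 c) q + V (Vt k) q * lift3 k (d2 c) q + V (Vt (k + 1)) q * lift3 k (d3 c) q"
  by (subst vf_apply_eq_sum[of "{Vx, Vt k, Vt (k + 1)}"]) (auto simp: pd_lift3_other pd_lift3)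

subsection \<open>Shifting along the trajectory\<close>

text \<open>The point map behind \<open>D^k\<close>. For negative k it iterates the map of
  \<open>g\<close>, so maps of opposite sign cancel only where f and g invert each other.\<close>

definition sh ::
  "('k \<times> 'k \<times> 'k \<times> 'k \<Rightarrow> 'k) \<Rightarrow> ('k \<times> 'k \<times> 'k \<times> 'k \<Rightarrow> 'k) \<Rightarrow> int \<Rightarrow> 'k point \<Rightarrow> 'k point" where
  "sh f g k q = (if 0 \<le> k then (shift_point f ^^ nat k) q else (unshift_point g ^^ nat (- k)) q)"

lemma sh_0 [simp]: "sh f g 0 q = q"
  by (simp add: sh_def)

lemma sh_succ: "0 \<le> k \<Longrightarrow> sh f g (k + 1) q = shift_point f (sh f g k q)"
  by (simp add: sh_def nat_add_distrib)

lemma sh_pred: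
  assumes "k \<le> 0"
  shows "sh f g (k - 1) q = unshift_point g (sh f g k q)"
proof -
  have "nat (- (k - 1)) = Suc (nat (- k))" using assms by auto
  then show ?thesis using assms by (cases "k = 0") (auto simp: sh_def)
qed

lemma sh_Vx [simp]: "sh f g k q Vx = q Vx"
  by (induction k rule: int_induct[where k = 0])
     (auto simp: sh_succ sh_pred shift_point_def unshift_point_def)

lemma sh_Vt [simp]: "sh f g k q (Vt j) = q (Vt (j + k))"
  by (induction k arbitrary: j rule: int_induct[where k = 0])
     (auto simp: sh_succ sh_pred shift_point_def unshift_point_def algebra_simps)

lemma Dop_funpow: "(Dop f ^^ n) h q = h ((shift_point f ^^ n) q)"
  by (induction n arbitrary: h) (simp_all add: Dop_def funpow_swap1)

lemma Dinv_funpow: "(Dinv g ^^ n) h q = h ((unshift_point g ^^ n) q)"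
  by (induction n arbitrary: h) (simp_all add: Dinv_def funpow_swap1)

text \<open>\<open>D^(k-1) f\<close> is \<open>D^k\<close> applied to the variable
  \<open>t\<^sub>x\<close>, and correspondingly for \<open>g\<close>; so one formula covers the
  three cases of the definition.\<close>

lemma vf_K_Vt: "vf_K f g (Vt k) q = sh f g k q Vtx"
proof -
  consider "k = 0" | n where "k = int (Suc n)" | n where "k = - int (Suc n)"
    by (metis int_cases3 gr0_implies_Suc)
  then show ?thesis
  proof cases
    case 2
    then have "nat k = Suc n" "nat (k - 1) = n" "0 < k" by auto
    then show ?thesis by (simp add: vf_K_def sh_def Dop_funpow shift_point_def[of f "(shift_point f ^^ n) q"])
  next
    case 3
    then have "nat (- k) = Suc n" "nat (- k - 1) = n" "k < 0" by auto
    then show ?thesis by (simp add: vf_K_def sh_def Dinv_funpow unshift_point_def[of g "(unshift_point g ^^ n) q"])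
  qed (simp add: vf_K_def)
qed

lemma vf_K_Vx: "vf_K f g Vx = (\<lambda>_. 1)" and vf_K_Vtx: "vf_K f g Vtx = (\<lambda>_. 0)"
  and vf_K_Vt0: "vf_K f g (Vt 0) = (\<lambda>q. q Vtx)"
  by (simp_all add: vf_K_def fun_eq_iff)

lemma vf_X_simps: "vf_X Vx = (\<lambda>_. 0)" "vf_X Vtx = (\<lambda>_. 1)" "vf_X (Vt k) = (\<lambda>_. 0)"
  by (simp_all add: vf_X_def fun_eq_iff)

section \<open>The affine chain near its trajectory\<close>

locale affine_chain =
  fixes U :: "('k::{real_normed_field,banach} \<times> 'k \<times> 'k \<times> 'k) set"
    and f g :: "'k \<times> 'k \<times> 'k \<times> 'k \<Rightarrow> 'k"
    and P :: "int \<Rightarrow> 'k point"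
    and F :: "'k dyn_fun"
  assumes F_def: "F = (\<lambda>q. f (fargs q))"
    and open_U: "open U"
    and F_analytic: "\<And>q. fargs q \<in> U \<Longrightarrow> analytic_germ q F"
    and F_tx: "\<And>q. fargs q \<in> U \<Longrightarrow> pd Vtx F q \<noteq> 0"
    and g_solves: "\<And>x a b u. (x, a, b, u) \<in> U \<Longrightarrow> g (x, a, b, f (x, a, b, u)) = u"
    and F_tx_tx: "\<And>q. fargs q \<in> U \<Longrightarrow> pd Vtx (pd Vtx F) q = 0"
    and m_nz: "\<And>q. fargs q \<in> U \<Longrightarrow> m_fun f q \<noteq> 0"
    and traj: "trajectory U f P"
begin

lemma P_U: "fargs (P k) \<in> U" and P_succ: "P (k + 1) = shift_point f (P k)"
  using traj by (auto simp: trajectory_def)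

lemma P_Vx: "P k Vx = P 0 Vx"
proof (induction k rule: int_induct[where k = 0])
  case (step2 i)
  then show ?case using P_succ[of "i - 1"] by (simp add: shift_point_def fun_eq_iff)
qed (simp_all add: P_succ shift_point_def)

lemma P_Vt: "P k (Vt j) = P 0 (Vt (j + k))"
proof (induction k arbitrary: j rule: int_induct[where k = 0])
  case (step2 i)
  have "P i (Vt (j - 1)) = P (i - 1) (Vt j)" using P_succ[of "i - 1"] by (simp add: shift_point_def)
  with step2(2)[of "j - 1"] show ?case by (simp add: algebra_simps)
qed (simp_all add: P_succ shift_point_def algebra_simps)

lemma eventually_U: "\<forall>\<^sub>F q in nhds (P k). fargs q \<in> U"
proof -
  have coord: "((\<lambda>q. q v) \<longlongrightarrow> P k v) (nhds (P k))" for v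
    using analytic_germ_tendsto[OF analytic_germ_coord[of "P k" v]] .
  have "(fargs \<longlongrightarrow> fargs (P k)) (nhds (P k))"
    unfolding fargs_def by (intro tendsto_Pair coord)
  then show ?thesis by (rule topological_tendstoD[OF _ open_U P_U])
qed

text \<open>The index selects the base point \<open>P k\<close> at which the slope is taken. It is
  not itself a shift; that is the separate index of \<open>lift3\<close>.\<close>

definition acoef :: "int \<Rightarrow> 'k \<Rightarrow> 'k \<Rightarrow> 'k \<Rightarrow> 'k" where
  "acoef k x y z = deriv (\<lambda>s. f (x, y, z, s)) (P k Vtx)"

definition bcoef :: "int \<Rightarrow> 'k \<Rightarrow> 'k \<Rightarrow> 'k \<Rightarrow> 'k" where
  "bcoef k x y z = f (x, y, z, P k Vtx) - acoef k x y z * P k Vtx"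

text \<open>The function m for \<open>f = a t\<^sub>x + b\<close>: all terms containing
  \<open>t\<^sub>x\<close> cancel in the numerator.\<close>

definition mcoef :: "int \<Rightarrow> 'k \<Rightarrow> 'k \<Rightarrow> 'k \<Rightarrow> 'k" where
  "mcoef k x y z = (- d1 (acoef k) x y z - bcoef k x y z * d3 (acoef k) x y z + d2 (bcoef k) x y z
     + acoef k x y z * d3 (bcoef k) x y z) / acoef k x y z"

lemma lift3_acoef: "lift3 0 (acoef k) q = pd Vtx F (q(Vtx := P k Vtx))"
  by (simp add: lift3_def acoef_def pd_def F_def fargs_def)

lemma lift3_bcoef: "lift3 0 (bcoef k) q = F (q(Vtx := P k Vtx)) - lift3 0 (acoef k) q * P k Vtx"
  by (simp add: lift3_def bcoef_def F_def fargs_def)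

lemma lift3_mcoef: "lift3 j (mcoef k) q = (- lift3 j (d1 (acoef k)) q - lift3 j (bcoef k) q * lift3 j (d3 (acoef k)) q
    + lift3 j (d2 (bcoef k)) q + lift3 j (acoef k) q * lift3 j (d3 (bcoef k)) q) / lift3 j (acoef k) q"
  by (simp add: lift3_def mcoef_def)

lemma acoef_analytic: "analytic_germ (P k) (lift3 0 (acoef k))"
  unfolding lift3_acoef[abs_def]
  by (rule analytic_germ_freeze[OF analytic_germ_pd[OF F_analytic[OF P_U]]])

lemma bcoef_analytic: "analytic_germ (P k) (lift3 0 (bcoef k))"
  unfolding lift3_bcoef[abs_def]
  by (intro analytic_germ_diff analytic_germ_mult analytic_germ_const acoef_analytic
      analytic_germ_freeze[OF F_analytic[OF P_U]])

lemma acoef_nz: "lift3 0 (acoef k) (P k) \<noteq> 0"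
  by (simp add: lift3_acoef F_tx P_U)

lemma lift3_pd_analytic:
  assumes "analytic_germ p (lift3 k c)"
  shows "analytic_germ p (lift3 k (d1 c))" "analytic_germ p (lift3 k (d2 c))" "analytic_germ p (lift3 k (d3 c))"
  using analytic_germ_pd[OF assms] pd_lift3 by metis+

lemma mcoef_analytic: "analytic_germ (P k) (lift3 0 (mcoef k))"
  unfolding lift3_mcoef[abs_def]
  by (intro analytic_germ_divide analytic_germ_add analytic_germ_diff analytic_germ_mult analytic_germ_minus
      lift3_pd_analytic acoef_analytic bcoef_analytic acoef_nz)

lemma F_affine: "\<forall>\<^sub>F q in nhds (P k). F q = lift3 0 (acoef k) q * q Vtx + lift3 0 (bcoef k) q"
proof -
  have "\<forall>\<^sub>F q in nhds (P k). pd Vtx (pd Vtx F) q = 0"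
    using eventually_U by eventually_elim (rule F_tx_tx)
  from affine_in_variable[OF F_analytic[OF P_U] this] show ?thesis
    by eventually_elim (simp add: lift3_acoef lift3_bcoef algebra_simps)
qed

lemma F_P: "F (P k) = lift3 0 (acoef k) (P k) * P k Vtx + lift3 0 (bcoef k) (P k)"
  by (simp add: lift3_acoef lift3_bcoef)

lemma pd_F: "\<forall>\<^sub>F q in nhds (P k). \<forall>v. pd v F q =
    pd v (lift3 0 (acoef k)) q * q Vtx + lift3 0 (acoef k) q * (if v = Vtx then 1 else 0) + pd v (lift3 0 (bcoef k)) q"
  using pd_cong[OF F_affine[of k]]
    pd_add[OF analytic_germ_mult[OF acoef_analytic analytic_germ_coord[of _ Vtx]] bcoef_analytic, of k]
    pd_mult[OF acoef_analytic analytic_germ_coord[of _ Vtx], of k]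
  by eventually_elim (simp add: pd_coord)

lemma pd_lift3_0: "pd (Vt 1) (lift3 0 c) = lift3 0 (d3 c)" "pd (Vt 0) (lift3 0 c) = lift3 0 (d2 c)"
   "pd Vtx (lift3 k c) q = 0"
  using pd_lift3(3)[of 0 c] pd_lift3(2)[of 0 c] pd_lift3_other[of Vtx] by auto

lemma pd_F_tx: "\<forall>\<^sub>F q in nhds (P k). pd Vtx F q = lift3 0 (acoef k) q"
  using pd_F[of k] by eventually_elim (simp add: pd_lift3_0)

lemma m_eq: "\<forall>\<^sub>F q in nhds (P k). m_fun f q = lift3 0 (mcoef k) q"
proof -
  have "\<forall>\<^sub>F q in nhds (P k). pd Vx F q = lift3 0 (d1 (acoef k)) q * q Vtx + lift3 0 (d1 (bcoef k)) q"
    using pd_F[of k] by eventually_elim (simp add: pd_lift3)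
  from pd_cong[OF this]
    pd_add[OF analytic_germ_mult[OF lift3_pd_analytic(1)[OF acoef_analytic] analytic_germ_coord[of _ Vtx]]
      lift3_pd_analytic(1)[OF bcoef_analytic], of k]
    pd_mult[OF lift3_pd_analytic(1)[OF acoef_analytic] analytic_germ_coord[of _ Vtx], of k]
  have "\<forall>\<^sub>F q in nhds (P k). pd Vtx (pd Vx F) q = lift3 0 (d1 (acoef k)) q"
    by eventually_elim (simp add: pd_coord pd_lift3_0)
  with pd_cong[OF pd_F_tx[of k]] pd_F[of k] F_affine[of k] pd_F_tx[of k] show ?thesis
    by eventually_elim (simp add: m_fun_def Let_def F_def[symmetric] lift3_mcoef pd_lift3_0 algebra_simps)
qed

lemma lift3_analytic_shift:
  assumes "analytic_germ (P k) (lift3 0 c)"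
  shows "analytic_germ (P j) (lift3 (k - j) c)"
proof -
  \<comment> \<open>freezing \<open>t\<^sub>x\<close> at its value in \<open>P k\<close> makes the renaming map \<open>P j\<close> to \<open>P k\<close>\<close>
  define \<Phi> where "\<Phi> q v = (case v of Vx \<Rightarrow> q Vx | Vtx \<Rightarrow> P k Vtx | Vt i \<Rightarrow> q (Vt (i + (k - j))))"
    for q :: "'k point" and v
  have "\<Phi> (P j) = P k"
    by (auto simp: \<Phi>_def fun_eq_iff P_Vx[of j] P_Vx[of k] P_Vt[of j] P_Vt[of k] algebra_simps split: dyn_var.split)
  moreover have "analytic_germ (P j) (\<lambda>q. \<Phi> q v)" for v by (cases v) (auto simp: \<Phi>_def)
  ultimately have "analytic_germ (P j) (\<lambda>q. lift3 0 c (\<Phi> q))"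
    using analytic_germ_compose[of \<Phi> "P j" "lift3 0 c"] assms by simp
  also have "(\<lambda>q. lift3 0 c (\<Phi> q)) = lift3 (k - j) c"
    by (simp add: fun_eq_iff \<Phi>_def lift3_def add.commute)
  finally show ?thesis .
qed

section \<open>The shift as a local homeomorphism along the trajectory\<close>

lemma unshift_shift: "fargs q \<in> U \<Longrightarrow> unshift_point g (shift_point f q) = q"
  using g_solves by (auto simp: fun_eq_iff unshift_point_def shift_point_def gargs_def fargs_def split: dyn_var.split)

lemma shift_tendsto: "(shift_point f \<longlongrightarrow> P (k + 1)) (nhds (P k))"
proof (rule tendsto_pointI)
  fix v
  have "analytic_germ (P k) (\<lambda>q. shift_point f q v)"
    using F_analytic[OF P_U, of k] by (cases v) (auto simp: shift_point_def F_def)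
  from analytic_germ_tendsto[OF this] show "((\<lambda>q. shift_point f q v) \<longlongrightarrow> P (k + 1) v) (nhds (P k))"
    by (simp add: P_succ)
qed

text \<open>The hypothesis on \<open>g\<close> is a left inverse property on U. Solving the affine
  equation explicitly gives a continuous right inverse w of the shift near \<open>P (k + 1)\<close>;
  near that point w lands where \<open>fargs\<close> is in U, so the map of \<open>g\<close> must
  coincide with it.\<close>

lemma unshift_near:
  "(unshift_point g \<longlongrightarrow> P k) (nhds (P (k + 1)))"
  "\<forall>\<^sub>F q in nhds (P (k + 1)). shift_point f (unshift_point g q) = q"
proof -
  \<comment> \<open>The index - 1 appears because the variables t and \<open>t\<^sub>1\<close> at
    \<open>P k\<close> are \<open>t\<^sub>-\<^sub>1\<close> and t when seen from
    \<open>P (k + 1)\<close>.\<close>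
  define u where "u q = (q Vtx - lift3 (- 1) (bcoef k) q) / lift3 (- 1) (acoef k) q" for q
  define w where "w q v = (case v of Vx \<Rightarrow> q Vx | Vtx \<Rightarrow> u q | Vt j \<Rightarrow> q (Vt (j - 1)))" for q v
  have P1: "lift3 (- 1) c (P (k + 1)) = lift3 0 c (P k)" for c
    unfolding lift3_def P_Vx[of k] P_Vx[of "k + 1"] P_Vt[of k] P_Vt[of "k + 1"] by (simp add: add.commute)
  have "analytic_germ (P (k + 1)) (lift3 (- 1) (acoef k))" "analytic_germ (P (k + 1)) (lift3 (- 1) (bcoef k))"
    using lift3_analytic_shift[OF acoef_analytic[of k], of "k + 1"]
      lift3_analytic_shift[OF bcoef_analytic[of k], of "k + 1"] by simp_all
  then have "analytic_germ (P (k + 1)) u"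
    unfolding u_def using acoef_nz[of k] by (intro analytic_germ_divide analytic_germ_diff analytic_germ_coord) (auto simp: P1)
  moreover have "u (P (k + 1)) = P k Vtx"
  proof -
    have "P (k + 1) Vtx = F (P k)" by (simp add: P_succ shift_point_def F_def)
    then show ?thesis using acoef_nz[of k] by (simp add: u_def P1 F_P)
  qed
  ultimately have u: "(u \<longlongrightarrow> P k Vtx) (nhds (P (k + 1)))"
    using analytic_germ_tendsto by metis
  have coord: "((\<lambda>q. q v) \<longlongrightarrow> P (k + 1) v) (nhds (P (k + 1)))" for v
    using analytic_germ_tendsto[OF analytic_germ_coord[of "P (k + 1)" v]] .
  have w: "(w \<longlongrightarrow> P k) (nhds (P (k + 1)))"
  proof (rule tendsto_pointI)
    fix v
    show "((\<lambda>q. w q v) \<longlongrightarrow> P k v) (nhds (P (k + 1)))"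
    proof (cases v)
      case Vx
      then show ?thesis using coord[of Vx] by (simp add: w_def P_Vx[of k] P_Vx[of "k + 1"])
    next
      case Vtx
      then show ?thesis using u by (simp add: w_def)
    next
      case (Vt j)
      then show ?thesis using coord[of "Vt (j - 1)"]
        by (simp add: w_def P_Vt[of k] P_Vt[of "k + 1"])
    qed
  qed
  have lw: "lift3 0 c (w q) = lift3 (- 1) c q" for c q
    by (simp add: lift3_def w_def)
  have anz: "\<forall>\<^sub>F q in nhds (P (k + 1)). lift3 (- 1) (acoef k) q \<noteq> 0"
    by (rule analytic_germ_nonzero) (use \<open>analytic_germ (P (k + 1)) (lift3 (- 1) (acoef k))\<close> acoef_nz in \<open>auto simp: P1\<close>)
  have *: "\<forall>\<^sub>F q in nhds (P (k + 1)). unshift_point g q = w q \<and> shift_point f (w q) = q"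
    using filterlim_iff[THEN iffD1, rule_format, OF w F_affine]
      filterlim_iff[THEN iffD1, rule_format, OF w eventually_U] anz
  proof eventually_elim
    case (elim q)
    have wV: "w q Vtx = u q" by (simp add: w_def)
    have Fw: "F (w q) = q Vtx" using elim(1,3) unfolding lw wV by (simp add: u_def)
    have "shift_point f (w q) = q"
    proof
      fix v show "shift_point f (w q) v = q v"
        using Fw by (cases v) (auto simp: shift_point_def w_def F_def)
    qed
    with unshift_shift[OF elim(2)] show ?case by simp
  qed
  then show "\<forall>\<^sub>F q in nhds (P (k + 1)). shift_point f (unshift_point g q) = q"
    by eventually_elim simp
  from * have "\<forall>\<^sub>F q in nhds (P (k + 1)). w q = unshift_point g q"
    by eventually_elim simp
  with w show "(unshift_point g \<longlongrightarrow> P k) (nhds (P (k + 1)))"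
    using filterlim_cong by fast
qed

lemma eventually_shift_iff:
  "(\<forall>\<^sub>F q in nhds (P k). Q (shift_point f q)) \<longleftrightarrow> (\<forall>\<^sub>F q in nhds (P (k + 1)). Q q)"
proof
  assume "\<forall>\<^sub>F q in nhds (P k). Q (shift_point f q)"
  from filterlim_iff[THEN iffD1, rule_format, OF unshift_near(1) this] unshift_near(2)[of k]
  show "\<forall>\<^sub>F q in nhds (P (k + 1)). Q q" by eventually_elim simp
qed (rule filterlim_iff[THEN iffD1, rule_format, OF shift_tendsto])

lemma eventually_unshift_iff:
  "(\<forall>\<^sub>F q in nhds (P (k + 1)). Q (unshift_point g q)) \<longleftrightarrow> (\<forall>\<^sub>F q in nhds (P k). Q q)"
proof
  assume "\<forall>\<^sub>F q in nhds (P (k + 1)). Q (unshift_point g q)"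
  from filterlim_iff[THEN iffD1, rule_format, OF shift_tendsto this] eventually_U[of k]
  show "\<forall>\<^sub>F q in nhds (P k). Q q" by eventually_elim (simp add: unshift_shift)
qed (rule filterlim_iff[THEN iffD1, rule_format, OF unshift_near(1)])

abbreviation "T \<equiv> sh f g"

text \<open>Germ statements at \<open>P k\<close> and at \<open>P 0\<close> are interchangeable: the
  local homeomorphisms are composed step by step in either direction.\<close>

lemma eventually_sh_iff: "(\<forall>\<^sub>F q in nhds (P 0). Q (T k q)) \<longleftrightarrow> (\<forall>\<^sub>F q in nhds (P k). Q q)"
proof (induction k arbitrary: Q rule: int_induct[where k = 0])
  case (step1 i)
  have "(\<forall>\<^sub>F q in nhds (P 0). Q (T (i + 1) q)) \<longleftrightarrow> (\<forall>\<^sub>F q in nhds (P 0). Q (shift_point f (T i q)))"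
    using step1 by (simp add: sh_succ)
  also have "\<dots> \<longleftrightarrow> (\<forall>\<^sub>F q in nhds (P i). Q (shift_point f q))" by (rule step1(2))
  finally show ?case by (simp add: eventually_shift_iff)
next
  case (step2 i)
  have "(\<forall>\<^sub>F q in nhds (P 0). Q (T (i - 1) q)) \<longleftrightarrow> (\<forall>\<^sub>F q in nhds (P 0). Q (unshift_point g (T i q)))"
    using step2 by (simp add: sh_pred)
  also have "\<dots> \<longleftrightarrow> (\<forall>\<^sub>F q in nhds (P i). Q (unshift_point g q))" by (rule step2(2))
  finally show ?case using eventually_unshift_iff[where k = "i - 1"] by simp
qed simp

lemma shift_sh: "\<forall>\<^sub>F q in nhds (P 0). shift_point f (T k q) = T (k + 1) q"
proof (cases "0 \<le> k")
  case False
  then have "T k q = unshift_point g (T (k + 1) q)" for q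
    using sh_pred[of "k + 1"] by simp
  then show ?thesis
    using eventually_sh_iff[THEN iffD2, OF unshift_near(2)[of k]] by simp
qed (simp add: sh_succ)

end

lemma pd_diff:
  assumes "analytic_germ p h1" "analytic_germ p h2"
  shows "\<forall>\<^sub>F q in nhds p. \<forall>v. pd v (\<lambda>q. h1 q - h2 q) q = pd v h1 q - pd v h2 q"
  using pd_add[OF assms(1) analytic_germ_mult[OF analytic_germ_const[of p "- 1"] assms(2)]]
    pd_mult[OF analytic_germ_const[of p "- 1"] assms(2)]
  by eventually_elim simp

context affine_chain
begin

subsection \<open>The generators of the ring\<close>

abbreviation "K \<equiv> vf_K f g"

definition "C1 = vf_bracket vf_X K"

definition "Z1 = vf_bracket K C1"

abbreviation "a k \<equiv> lift3 k (acoef k)"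
abbreviation "b k \<equiv> lift3 k (bcoef k)"
abbreviation "m k \<equiv> lift3 k (mcoef k)"

lemma a_analytic: "analytic_germ (P 0) (a k)"
  using lift3_analytic_shift[OF acoef_analytic[of k], of 0] by simp

lemma b_analytic: "analytic_germ (P 0) (b k)"
  using lift3_analytic_shift[OF bcoef_analytic[of k], of 0] by simp

lemma m_analytic: "analytic_germ (P 0) (m k)"
  using lift3_analytic_shift[OF mcoef_analytic[of k], of 0] by simp

lemma lift3_sh: "lift3 0 c (T k q) = lift3 k c q"
  by (simp add: lift3_def add.commute)

lemma lift3_P: "lift3 k c (P 0) = lift3 0 c (P k)"
  by (simp add: lift3_def P_Vx[of k] P_Vt[of k] add.commute)

lemma a_nz: "a k (P 0) \<noteq> 0"
  by (simp add: lift3_P acoef_nz)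

lemma m_nz0: "m k (P 0) \<noteq> 0"
  using eventually_nhds_x_imp_x[OF m_eq[of k]] m_nz[OF P_U[of k]] by (simp add: lift3_P)

lemma a_ne: "\<forall>\<^sub>F q in nhds (P 0). a k q \<noteq> 0" and m_ne: "\<forall>\<^sub>F q in nhds (P 0). m k q \<noteq> 0"
  by (rule analytic_germ_nonzero; fact a_analytic m_analytic a_nz m_nz0)+

lemma F_sh: "\<forall>\<^sub>F q in nhds (P 0). F (T k q) = K (Vt (k + 1)) q"
  using shift_sh[of k]
proof eventually_elim
  case (elim q)
  have "F (T k q) = shift_point f (T k q) Vtx" by (simp add: shift_point_def F_def)
  then show ?case using elim by (simp add: vf_K_Vt)
qed

lemma K_succ: "\<forall>\<^sub>F q in nhds (P 0). K (Vt (k + 1)) q = a k q * K (Vt k) q + b k q"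
  using F_sh[of k] eventually_sh_iff[THEN iffD2, OF F_affine[of k]]
  by eventually_elim (simp add: lift3_sh vf_K_Vt)

text \<open>For negative k the recursion is solved for the earlier coefficient, \<open>a\<close>
  being a unit. This gives analyticity of the iterates of \<open>g\<close> from that of
  \<open>f\<close>.\<close>

lemma K_Vt_analytic: "analytic_germ (P 0) (K (Vt k))"
proof (induction k rule: int_induct[where k = 0])
  case base
  show ?case by (simp add: vf_K_Vt0)
next
  case (step1 i)
  have "analytic_germ (P 0) (\<lambda>q. a i q * K (Vt i) q + b i q)"
    by (intro analytic_germ_add analytic_germ_mult a_analytic b_analytic step1)
  then show ?case
    by (rule analytic_germ_cong) (use K_succ[of i] in \<open>simp add: eq_commute\<close>)
next
  case (step2 i)
  have "analytic_germ (P 0) (\<lambda>q. (K (Vt i) q - b (i - 1) q) / a (i - 1) q)"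
    by (intro analytic_germ_divide analytic_germ_diff a_analytic b_analytic step2 a_nz)
  moreover have "\<forall>\<^sub>F q in nhds (P 0). (K (Vt i) q - b (i - 1) q) / a (i - 1) q = K (Vt (i - 1)) q"
    using K_succ[of "i - 1"] a_ne[of "i - 1"] by eventually_elim simp
  ultimately show ?case by (rule analytic_germ_cong)
qed

lemma K_analytic: "vf_analytic (P 0) K"
  unfolding vf_analytic_def
proof
  show "analytic_germ (P 0) (K v)" for v
    by (cases v) (simp_all add: K_Vt_analytic vf_K_Vx vf_K_Vtx)
qed

lemma C1_analytic: "vf_analytic (P 0) C1" and Z1_analytic: "vf_analytic (P 0) Z1"
  unfolding Z1_def C1_def by (intro vf_analytic_bracket vf_analytic_X K_analytic)+

lemmas K_an = vf_analyticD[OF K_analytic]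
lemmas C1_an = vf_analyticD[OF C1_analytic]
lemmas Z1_an = vf_analyticD[OF Z1_analytic]

lemma C1_simps: "C1 Vx = (\<lambda>_. 0)" "C1 Vtx = (\<lambda>_. 0)" "C1 (Vt 0) = (\<lambda>_. 1)"
  by (simp_all add: fun_eq_iff C1_def vf_bracket_def vf_K_Vx vf_K_Vtx vf_K_Vt0 vf_X_simps)

lemma Z1_eq: "Z1 v = (\<lambda>q. vf_apply K (C1 v) q - vf_apply C1 (K v) q)"
  by (simp add: fun_eq_iff Z1_def vf_bracket_def)

lemma Z1_simps: "Z1 Vx = (\<lambda>_. 0)" "Z1 Vtx = (\<lambda>_. 0)" "Z1 (Vt 0) = (\<lambda>_. 0)"
  by (simp_all add: fun_eq_iff Z1_eq vf_K_Vx vf_K_Vtx vf_K_Vt0 C1_simps)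

text \<open>X has constant coefficients, so bracketing with it differentiates each coefficient in
  \<open>t\<^sub>x\<close>.\<close>

lemma C1_pd: "\<forall>\<^sub>F q in nhds (P 0). C1 v q = pd Vtx (K v) q"
  using vf_apply_X[OF K_an[of v]]
  by eventually_elim (cases v; simp add: C1_def vf_bracket_def vf_X_simps)

lemma C1_succ: "\<forall>\<^sub>F q in nhds (P 0). C1 (Vt (k + 1)) q = a k q * C1 (Vt k) q"
  using C1_pd[of "Vt (k + 1)"] C1_pd[of "Vt k"] pd_cong[OF K_succ[of k]]
    pd_add[OF analytic_germ_mult[OF a_analytic K_an] b_analytic, of k "Vt k" k]
    pd_mult[OF a_analytic K_an, of k "Vt k"]
  by eventually_elim (simp add: pd_lift3_0)

lemma C1_nz: "C1 (Vt k) (P 0) \<noteq> 0"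
proof (induction k rule: int_induct[where k = 0])
  case (step1 i)
  then show ?case using eventually_nhds_x_imp_x[OF C1_succ[of i]] a_nz[of i] by simp
next
  case (step2 i)
  then show ?case using eventually_nhds_x_imp_x[OF C1_succ[of "i - 1"]] by auto
qed (simp add: C1_simps)

lemma C1_ne: "\<forall>\<^sub>F q in nhds (P 0). C1 (Vt k) q \<noteq> 0"
  by (rule analytic_germ_nonzero[OF C1_an C1_nz])

text \<open>The coefficient at t is 1, and the factors \<open>a k\<close> that lead from it to all
  others do not contain \<open>t\<^sub>x\<close>.\<close>

lemma pd_C1: "\<forall>\<^sub>F q in nhds (P 0). pd Vtx (C1 v) q = 0"
proof (cases v)
  case (Vt k)
  have "\<forall>\<^sub>F q in nhds (P 0). pd Vtx (C1 (Vt k)) q = 0"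
  proof (induction k rule: int_induct[where k = 0])
    case (step1 i)
    from pd_cong[OF C1_succ[of i]] pd_mult[OF a_analytic C1_an, of i "Vt i"] step1(2)
    show ?case by eventually_elim (simp add: pd_lift3_0)
  next
    case (step2 i)
    from pd_cong[OF C1_succ[of "i - 1"]] pd_mult[OF a_analytic C1_an, of "i - 1" "Vt (i - 1)"] step2(2) a_ne[of "i - 1"]
    show ?case by eventually_elim (simp add: pd_lift3_0)
  qed (simp add: C1_simps)
  then show ?thesis using Vt by simp
qed (simp_all add: C1_simps)

lemma pd_pd_K: "\<forall>\<^sub>F q in nhds (P 0). pd Vtx (pd Vtx (K v)) q = 0"
  using pd_cong[OF C1_pd[of v]] pd_C1[of v] by eventually_elim simp

text \<open>\<open>[X, [K, W]] = [C\<^sub>1, W]\<close> for every \<open>W\<close> commuting with \<open>X\<close>, an instance of the Jacobi identity.\<close>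

lemma pd_bracket_K:
  assumes W: "vf_analytic (P 0) W" and 0: "\<And>v. \<forall>\<^sub>F q in nhds (P 0). pd Vtx (W v) q = 0"
  shows "\<forall>\<^sub>F q in nhds (P 0). pd Vtx (vf_bracket K W v) q = vf_bracket C1 W v q"
proof -
  have pp: "\<forall>\<^sub>F q in nhds (P 0). pd Vtx (pd Vtx (W v)) q = 0"
    using pd_cong[OF 0[of v]] by eventually_elim simp
  have z: "\<forall>\<^sub>F q in nhds (P 0). 0 = pd Vtx (W v) q" for v
    using 0[of v] by eventually_elim simp
  have eq: "vf_bracket K W v = (\<lambda>q. vf_apply K (W v) q - vf_apply W (K v) q)"
    by (simp add: vf_bracket_def fun_eq_iff)
  from vf_apply_X_commute[OF vf_analyticD[OF W] pp K_analytic C1_pd z]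
    vf_apply_X_commute[OF K_an pd_pd_K W z C1_pd, of v]
    pd_diff[OF vf_apply_analytic[OF vf_analyticD[OF W] K_analytic] vf_apply_analytic[OF K_an W], of v v]
  show ?thesis unfolding eq
    by eventually_elim (simp add: vf_bracket_def)
qed

lemma pd_Z1: "\<forall>\<^sub>F q in nhds (P 0). pd Vtx (Z1 v) q = 0"
  using pd_bracket_K[OF C1_analytic pd_C1, of v]
  by eventually_elim (simp add: Z1_def vf_bracket_def)

lemma vf_apply_K_succ: "\<forall>\<^sub>F q in nhds (P 0). vf_apply V (K (Vt (k + 1))) q =
    vf_apply V (a k) q * K (Vt k) q + a k q * vf_apply V (K (Vt k)) q + vf_apply V (b k) q"
  using vf_apply_cong[OF K_succ[of k], of V]
    vf_apply_add[OF analytic_germ_mult[OF a_analytic K_an] b_analytic, of V k "Vt k" k]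
    vf_apply_mult[OF a_analytic K_an, of V k "Vt k"]
  by eventually_elim simp

lemma vf_apply_C1_succ: "\<forall>\<^sub>F q in nhds (P 0). vf_apply V (C1 (Vt (k + 1))) q =
    vf_apply V (a k) q * C1 (Vt k) q + a k q * vf_apply V (C1 (Vt k)) q"
  using vf_apply_cong[OF C1_succ[of k], of V] vf_apply_mult[OF a_analytic C1_an, of V k "Vt k"]
  by eventually_elim simp

lemma a_times_m: "\<forall>\<^sub>F q in nhds (P 0). a k q * m k q = - lift3 k (d1 (acoef k)) q - b k q * lift3 k (d3 (acoef k)) q
    + lift3 k (d2 (bcoef k)) q + a k q * lift3 k (d3 (bcoef k)) q"
  using a_ne[of k] by eventually_elim (simp add: lift3_mcoef)

text \<open>Here m originates. When K is applied to the recursion of \<open>C1\<close> and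
  \<open>C1\<close> to that of K, the terms multiplied by \<open>K (Vt k)\<close> cancel, and the
  remainder is \<open>- C1 (Vt k) q * a k q * m k q\<close>.\<close>

lemma Z1_succ: "\<forall>\<^sub>F q in nhds (P 0). Z1 (Vt (k + 1)) q = a k q * Z1 (Vt k) q - C1 (Vt (k + 1)) q * m k q"
  using vf_apply_C1_succ[of K k] vf_apply_K_succ[of C1 k] K_succ[of k] C1_succ[of k] a_times_m[of k]
proof eventually_elim
  case (elim q)
  note e = elim(1,2)[unfolded vf_apply_lift3 vf_K_Vx C1_simps]
  show ?case
    unfolding Z1_eq using e elim(3-5) by algebra
qed

lemma Z1_1_nz: "Z1 (Vt 1) (P 0) \<noteq> 0"
  using eventually_nhds_x_imp_x[OF Z1_succ[of 0]] C1_nz[of 1] m_nz0[of 0] by (simp add: Z1_simps)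

lemma Z1_1_ne: "\<forall>\<^sub>F q in nhds (P 0). Z1 (Vt 1) q \<noteq> 0"
  by (rule analytic_germ_nonzero[OF Z1_an Z1_1_nz])

section \<open>The field \<open>[K, Z1]\<close> and the functions \<open>\<Lambda> k\<close>\<close>

lemma vf_apply_Z1_succ: "\<forall>\<^sub>F q in nhds (P 0). vf_apply V (Z1 (Vt (k + 1))) q =
    vf_apply V (a k) q * Z1 (Vt k) q + a k q * vf_apply V (Z1 (Vt k)) q
    - (vf_apply V (C1 (Vt (k + 1))) q * m k q + C1 (Vt (k + 1)) q * vf_apply V (m k) q)"
  using vf_apply_cong[OF Z1_succ[of k], of V]
    vf_apply_diff[OF analytic_germ_mult[OF a_analytic Z1_an] analytic_germ_mult[OF C1_an m_analytic], of V k "Vt k" "Vt (k + 1)" k]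
    vf_apply_mult[OF a_analytic Z1_an, of V k "Vt k"] vf_apply_mult[OF C1_an m_analytic, of V "Vt (k + 1)" k]
  by eventually_elim simp

text \<open>\<open>ft0\<close> and \<open>ft1\<close> are the k-th shifts of the derivatives of f in
  t and \<open>t\<^sub>1\<close>, with \<open>K (Vt k)\<close> in the place of the shifted
  \<open>t\<^sub>x\<close>.\<close>

definition "ft0 k q = lift3 k (d2 (acoef k)) q * K (Vt k) q + lift3 k (d2 (bcoef k)) q"
definition "ft1 k q = lift3 k (d3 (acoef k)) q * K (Vt k) q + lift3 k (d3 (bcoef k)) q"

abbreviation "W \<equiv> vf_bracket K Z1"

lemma W_eq: "W v q = vf_apply K (Z1 v) q - vf_apply Z1 (K v) q"
  by (simp add: vf_bracket_def)

lemma W_simps: "W Vx q = 0" "W Vtx q = 0" "W (Vt 0) q = 0"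
  by (simp_all add: W_eq Z1_simps vf_K_Vx vf_K_Vtx vf_K_Vt0)

text \<open>As for \<open>Z1_succ\<close>, with \<open>Z1\<close> in place of \<open>C1\<close>; the
  inhomogeneous term of its recursion additionally meets the \<open>t\<^sub>1\<close>-derivative of
  f, which produces the summand with \<open>ft1\<close>.\<close>

lemma W_succ: "\<forall>\<^sub>F q in nhds (P 0). W (Vt (k + 1)) q = a k q * W (Vt k) q - a k q * Z1 (Vt k) q * m k q
    + C1 (Vt (k + 1)) q * m k q * ft1 k q - vf_apply K (C1 (Vt (k + 1))) q * m k q - C1 (Vt (k + 1)) q * vf_apply K (m k) q"
  using vf_apply_Z1_succ[of K k] vf_apply_K_succ[of Z1 k] K_succ[of k] Z1_succ[of k] a_times_m[of k]
proof eventually_elim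
  case (elim q)
  note e = elim(1)[unfolded vf_apply_lift3[of K k "acoef k"] vf_K_Vx] elim(2)[unfolded vf_apply_lift3 Z1_simps]
  show ?case
    unfolding W_eq ft1_def using e elim(3-5) by algebra
qed

text \<open>The factor l for which proportionality of W and \<open>Z1\<close> passes from k to k +
  1: the inhomogeneous part of the recursion of \<open>W - l Z1\<close> divided by
  \<open>C1 (Vt (k + 1)) q * m k q\<close>. The first summand is simplified by the recursion of
  \<open>C1\<close>.\<close>

definition "\<Lambda> k q = Z1 (Vt k) q / C1 (Vt k) q - ft1 k q
    + vf_apply K (C1 (Vt (k + 1))) q / C1 (Vt (k + 1)) q + vf_apply K (m k) q / m k q"

lemma \<Lambda>_mult: "\<forall>\<^sub>F q in nhds (P 0). \<Lambda> k q * (C1 (Vt (k + 1)) q * m k q) =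
    a k q * Z1 (Vt k) q * m k q - C1 (Vt (k + 1)) q * m k q * ft1 k q
    + vf_apply K (C1 (Vt (k + 1))) q * m k q + C1 (Vt (k + 1)) q * vf_apply K (m k) q"
  using C1_ne[of k] C1_ne[of "k + 1"] m_ne[of k] C1_succ[of k]
proof eventually_elim
  case (elim q)
  define A A' where "A = C1 (Vt k) q" and "A' = C1 (Vt (k + 1)) q"
  have nz: "A \<noteq> 0" "A' \<noteq> 0" "m k q \<noteq> 0" and A': "A' = a k q * A"
    using elim by (simp_all add: A_def A'_def)
  have "Z1 (Vt k) q / A * A' = a k q * Z1 (Vt k) q" using nz(1) by (simp add: A')
  moreover have "vf_apply K (C1 (Vt (k + 1))) q / A' * A' = vf_apply K (C1 (Vt (k + 1))) q"
    "vf_apply K (m k) q / m k q * m k q = vf_apply K (m k) q" using nz by auto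
  ultimately show ?case unfolding \<Lambda>_def A_def[symmetric] A'_def[symmetric] by algebra
qed

lemma W_defect: "\<forall>\<^sub>F q in nhds (P 0). W (Vt (k + 1)) q - l q * Z1 (Vt (k + 1)) q =
    a k q * (W (Vt k) q - l q * Z1 (Vt k) q) + (l q - \<Lambda> k q) * (C1 (Vt (k + 1)) q * m k q)"
  using W_succ[of k] \<Lambda>_mult[of k] Z1_succ[of k]
  by eventually_elim algebra

lemma proportional_imp_\<Lambda>:
  assumes "\<And>k. \<forall>\<^sub>F q in nhds (P 0). W (Vt k) q = l q * Z1 (Vt k) q"
  shows "\<forall>\<^sub>F q in nhds (P 0). l q = \<Lambda> k q"
  using W_defect[of k l] assms[of k] assms[of "k + 1"] C1_ne[of "k + 1"] m_ne[of k]
  by eventually_elim simp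

text \<open>Both fields vanish at t, which starts the induction; the downward direction cancels the
  factor \<open>a\<close>.\<close>

lemma \<Lambda>_imp_proportional:
  assumes "\<And>k. \<forall>\<^sub>F q in nhds (P 0). l q = \<Lambda> k q"
  shows "\<forall>\<^sub>F q in nhds (P 0). W (Vt k) q = l q * Z1 (Vt k) q"
proof (induction k rule: int_induct[where k = 0])
  case (step1 i)
  from W_defect[of i l] step1(2) assms[of i] show ?case by eventually_elim simp
next
  case (step2 i)
  from W_defect[of "i - 1" l] step2(2) assms[of "i - 1"] a_ne[of "i - 1"]
  show ?case by eventually_elim simp
qed (simp add: W_simps Z1_simps)

text \<open>The ratio of \<open>Z1\<close> to \<open>C1\<close> drops by \<open>m k\<close>, and the
  logarithmic derivative of \<open>C1\<close> along K grows by that of \<open>a (k + 1)\<close>. So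
  the coefficients of \<open>C1\<close> and \<open>Z1\<close> cancel from the difference.\<close>

lemma \<Lambda>_succ: "\<forall>\<^sub>F q in nhds (P 0). \<Lambda> (k + 1) q - \<Lambda> k q =
    (vf_apply K (m (k + 1)) q / m (k + 1) q - m (k + 1) q + ft0 (k + 1) q / a (k + 1) q)
    - (vf_apply K (m k) q / m k q + m k q - ft1 k q)"
proof -
  have Z: "\<forall>\<^sub>F q in nhds (P 0). Z1 (Vt (k + 1)) q / C1 (Vt (k + 1)) q = Z1 (Vt k) q / C1 (Vt k) q - m k q"
    using Z1_succ[of k] C1_succ[of k] C1_ne[of k] a_ne[of k]
    by eventually_elim (simp add: field_simps)
  have KA: "\<forall>\<^sub>F q in nhds (P 0). vf_apply K (C1 (Vt (k + 1 + 1))) q / C1 (Vt (k + 1 + 1)) q =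
      vf_apply K (C1 (Vt (k + 1))) q / C1 (Vt (k + 1)) q + vf_apply K (a (k + 1)) q / a (k + 1) q"
    using vf_apply_C1_succ[of K "k + 1"] C1_succ[of "k + 1"] C1_ne[of "k + 1"] a_ne[of "k + 1"]
    by eventually_elim (simp add: field_simps)
  \<comment> \<open>The definition of m rearranged as \<open>K(a) = a * ft1 + ft0 - a * m\<close>,
    which trades the logarithmic derivative of \<open>a\<close> for derivatives of f.\<close>
  have Ka: "\<forall>\<^sub>F q in nhds (P 0). vf_apply K (a j) q / a j q - ft1 j q = ft0 j q / a j q - m j q" for j
    using K_succ[of j] a_ne[of j] a_times_m[of j]
  proof eventually_elim
    case (elim q)
    have "vf_apply K (a j) q - ft1 j q * a j q = ft0 j q - m j q * a j q"
      unfolding vf_apply_lift3 vf_K_Vx ft0_def ft1_def using elim(1,3) by algebra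
    then show ?case using elim(2) by (simp add: field_simps)
  qed
  from Z KA Ka[of "k + 1"] show ?thesis
  proof eventually_elim
    case (elim q)
    show ?case unfolding \<Lambda>_def elim(1,2) using elim(3) by algebra
  qed
qed

lemma \<Lambda>_const_iff: "(\<forall>k. \<forall>\<^sub>F q in nhds (P 0). \<Lambda> k q = \<Lambda> 0 q) \<longleftrightarrow>
   (\<forall>k. \<forall>\<^sub>F q in nhds (P 0). vf_apply K (m (k + 1)) q / m (k + 1) q - m (k + 1) q + ft0 (k + 1) q / a (k + 1) q
      = vf_apply K (m k) q / m k q + m k q - ft1 k q)" (is "?L \<longleftrightarrow> ?R")
proof
  assume L: ?L
  show ?R
  proof
    fix k
    from L[rule_format, of k] L[rule_format, of "k + 1"] \<Lambda>_succ[of k]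
    show "\<forall>\<^sub>F q in nhds (P 0). vf_apply K (m (k + 1)) q / m (k + 1) q - m (k + 1) q + ft0 (k + 1) q / a (k + 1) q
      = vf_apply K (m k) q / m k q + m k q - ft1 k q"
      by eventually_elim simp
  qed
next
  assume R: ?R
  have step: "\<forall>\<^sub>F q in nhds (P 0). \<Lambda> (k + 1) q = \<Lambda> k q" for k
    using R[rule_format, of k] \<Lambda>_succ[of k] by eventually_elim simp
  show ?L
  proof
    fix k
    show "\<forall>\<^sub>F q in nhds (P 0). \<Lambda> k q = \<Lambda> 0 q"
    proof (induction k rule: int_induct[where k = 0])
      case (step1 i)
      from step1(2) step[of i] show ?case by eventually_elim simp
    next
      case (step2 i)
      from step2(2) step[of "i - 1"] show ?case by eventually_elim simp
    qed simp
  qed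
qed

lemma \<Lambda>_analytic: "analytic_germ (P 0) (\<Lambda> 0)"
  unfolding \<Lambda>_def ft1_def
  by (intro analytic_germ_add analytic_germ_diff analytic_germ_divide analytic_germ_mult vf_apply_analytic
      Z1_an C1_an K_an m_analytic K_analytic C1_nz m_nz0 lift3_pd_analytic a_analytic b_analytic)

text \<open>The identity at \<open>P k\<close> is pulled back to \<open>P 0\<close> along
  \<open>T k\<close>. There K acts on m as it does on \<open>m k\<close>, since
  \<open>K (Vt k)\<close> and \<open>K (Vt (k + 1))\<close> are the values of
  \<open>t\<^sub>x\<close> and f at the shifted point; the operator D on the left raises k by
  one.\<close>

lemma identity_iff: "(\<forall>\<^sub>F q in nhds (P k).
      Dop f (\<lambda>z. vf_apply K (m_fun f) z / m_fun f z - m_fun f z + pd (Vt 0) F z / pd Vtx F z) q =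
      vf_apply K (m_fun f) q / m_fun f q + m_fun f q - pd (Vt 1) F q) \<longleftrightarrow>
   (\<forall>\<^sub>F q in nhds (P 0). vf_apply K (m (k + 1)) q / m (k + 1) q - m (k + 1) q + ft0 (k + 1) q / a (k + 1) q
      = vf_apply K (m k) q / m k q + m k q - ft1 k q)"
proof -
  have data: "\<forall>\<^sub>F q in nhds (P 0). m_fun f (T k q) = m k q \<and> vf_apply K (m_fun f) (T k q) = vf_apply K (m k) q \<and>
      pd (Vt 0) F (T k q) = ft0 k q \<and> pd Vtx F (T k q) = a k q \<and> pd (Vt 1) F (T k q) = ft1 k q" for k
  proof -
    have K1: "K (Vt 1) q = F q" for q by (simp add: vf_K_def F_def)
    have K0: "K (Vt 0) q = q Vtx" for q by (simp add: vf_K_Vt0)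
    have "\<forall>\<^sub>F q in nhds (P k). m_fun f q = lift3 0 (mcoef k) q \<and>
        vf_apply K (m_fun f) q = lift3 0 (d1 (mcoef k)) q + q Vtx * lift3 0 (d2 (mcoef k)) q + F q * lift3 0 (d3 (mcoef k)) q \<and>
        pd (Vt 0) F q = lift3 0 (d2 (acoef k)) q * q Vtx + lift3 0 (d2 (bcoef k)) q \<and>
        pd Vtx F q = lift3 0 (acoef k) q \<and>
        pd (Vt 1) F q = lift3 0 (d3 (acoef k)) q * q Vtx + lift3 0 (d3 (bcoef k)) q"
      using m_eq[of k] vf_apply_cong[OF m_eq[of k], of K] pd_F[of k] pd_F_tx[of k]
      by eventually_elim (simp add: vf_apply_lift3 vf_K_Vx K0 K1 pd_lift3_0)
    from eventually_sh_iff[THEN iffD2, OF this] F_sh[of k] show ?thesis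
      by eventually_elim (simp add: lift3_sh vf_apply_lift3 vf_K_Vx ft0_def ft1_def vf_K_Vt[symmetric])
  qed
  have "(\<forall>\<^sub>F q in nhds (P k).
      Dop f (\<lambda>z. vf_apply K (m_fun f) z / m_fun f z - m_fun f z + pd (Vt 0) F z / pd Vtx F z) q =
      vf_apply K (m_fun f) q / m_fun f q + m_fun f q - pd (Vt 1) F q) \<longleftrightarrow>
    (\<forall>\<^sub>F q in nhds (P 0).
      Dop f (\<lambda>z. vf_apply K (m_fun f) z / m_fun f z - m_fun f z + pd (Vt 0) F z / pd Vtx F z) (T k q) =
      vf_apply K (m_fun f) (T k q) / m_fun f (T k q) + m_fun f (T k q) - pd (Vt 1) F (T k q))"
    by (rule eventually_sh_iff[symmetric])
  also have "\<dots> \<longleftrightarrow> (\<forall>\<^sub>F q in nhds (P 0). vf_apply K (m (k + 1)) q / m (k + 1) q - m (k + 1) q + ft0 (k + 1) q / a (k + 1) q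
      = vf_apply K (m k) q / m k q + m k q - ft1 k q)"
  proof (rule eventually_cong)
    show "\<forall>\<^sub>F q in nhds (P 0). shift_point f (T k q) = T (k + 1) q \<and>
      (m_fun f (T k q) = m k q \<and> vf_apply K (m_fun f) (T k q) = vf_apply K (m k) q \<and>
      pd (Vt 0) F (T k q) = ft0 k q \<and> pd Vtx F (T k q) = a k q \<and> pd (Vt 1) F (T k q) = ft1 k q) \<and>
      (m_fun f (T (k + 1) q) = m (k + 1) q \<and> vf_apply K (m_fun f) (T (k + 1) q) = vf_apply K (m (k + 1)) q \<and>
      pd (Vt 0) F (T (k + 1) q) = ft0 (k + 1) q \<and> pd Vtx F (T (k + 1) q) = a (k + 1) q \<and> pd (Vt 1) F (T (k + 1) q) = ft1 (k + 1) q)"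
      by (intro eventually_conj shift_sh data)
  qed (simp add: Dop_def)
  finally show ?thesis .
qed

subsection \<open>Dimension four\<close>

abbreviation "L \<equiv> x_ring f g (P 0)"
abbreviation "Bs \<equiv> [vf_X, K, C1, Z1]"

lemma Bs_in_L: "set Bs \<subseteq> L"
  by (auto simp: C1_def Z1_def intro: x_ring.intros)

lemma L_analytic: "V \<in> L \<Longrightarrow> vf_analytic (P 0) V"
  by (induction rule: x_ring.induct)
     (simp_all add: vf_analytic_X K_analytic vf_analytic_add vf_analytic_scale vf_analytic_bracket)

lemma lin_comb_Bs: "lin_comb c Bs v q = c 0 q * vf_X v q + c 1 q * K v q + c 2 q * C1 v q + c 3 q * Z1 v q"
  by (simp add: lin_comb_def numeral_eq_Suc)

lemma lin_comb_Bs_snoc: "lin_comb c (Bs @ [R]) v q = lin_comb c Bs v q + c 4 q * R v q"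
  by (simp add: lin_comb_def numeral_eq_Suc)

text \<open>Direction x isolates K, \<open>t\<^sub>x\<close> isolates X, t then leaves
  \<open>C1\<close>, and \<open>t\<^sub>1\<close> leaves \<open>Z1\<close>. Asking for zeros only in
  these directions lets the lemma also handle a fifth field that vanishes there.\<close>

lemma Bs_coeffs_zero:
  assumes "\<And>v. v \<in> {Vx, Vtx, Vt 0, Vt 1} \<Longrightarrow> \<forall>\<^sub>F q in nhds (P 0). lin_comb c Bs v q = 0" and "i < 4"
  shows "\<forall>\<^sub>F q in nhds (P 0). c i q = 0"
proof -
  have "\<forall>\<^sub>F q in nhds (P 0). c 0 q = 0 \<and> c 1 q = 0 \<and> c 2 q = 0 \<and> c 3 q = 0"
    using assms(1)[of Vx, simplified] assms(1)[of Vtx, simplified] assms(1)[of "Vt 0", simplified]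
      assms(1)[of "Vt 1", simplified] Z1_1_ne
    by eventually_elim (simp add: lin_comb_Bs vf_X_simps vf_K_Vx vf_K_Vtx vf_K_Vt0 C1_simps Z1_simps)
  moreover have "i = 0 \<or> i = 1 \<or> i = 2 \<or> i = 3" using assms(2) by auto
  ultimately show ?thesis by (auto elim: eventually_mono)
qed

lemma Bs_lin_indep: "lin_indep_at (P 0) Bs"
  unfolding lin_indep_at_def vf_eq_at_def using Bs_coeffs_zero by simp

text \<open>A nonzero component of R may still vanish at \<open>P 0\<close>, so it cannot be divided
  out of the relation; the absence of zero divisors among germs settles the last
  coefficient.\<close>

lemma Bs_snoc_lin_indep:
  assumes R: "vf_analytic (P 0) R" and R0: "\<And>v. v \<in> {Vx, Vtx, Vt 0, Vt 1} \<Longrightarrow> \<forall>\<^sub>F q in nhds (P 0). R v q = 0"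
    and "\<not> vf_eq_at (P 0) R (\<lambda>v q. 0)"
  shows "lin_indep_at (P 0) (Bs @ [R])"
  unfolding lin_indep_at_def
proof (intro allI impI, elim conjE)
  fix c i
  assume an: "\<forall>i<length (Bs @ [R]). analytic_germ (P 0) (c i)"
    and eq: "vf_eq_at (P 0) (lin_comb c (Bs @ [R])) (\<lambda>v q. 0)" and i: "i < length (Bs @ [R])"
  have sum0: "\<forall>\<^sub>F q in nhds (P 0). lin_comb c Bs v q + c 4 q * R v q = 0" for v
    using eq unfolding vf_eq_at_def lin_comb_Bs_snoc by blast
  have "\<forall>\<^sub>F q in nhds (P 0). lin_comb c Bs v q = 0" if "v \<in> {Vx, Vtx, Vt 0, Vt 1}" for v
    using sum0[of v] R0[OF that] by eventually_elim simp
  note c0 = Bs_coeffs_zero[of c, OF this]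
  from assms(3) obtain v where v: "\<not> (\<forall>\<^sub>F q in nhds (P 0). R v q = 0)"
    by (auto simp: vf_eq_at_def)
  have "\<forall>\<^sub>F q in nhds (P 0). c 4 q * R v q = 0"
    using sum0[of v] c0[of 0, simplified] c0[of 1, simplified] c0[of 2, simplified] c0[of 3, simplified]
    by eventually_elim (simp add: lin_comb_Bs)
  then have "\<forall>\<^sub>F q in nhds (P 0). c 4 q = 0"
    using analytic_germ_mult_eq_0D[of "P 0" "c 4" "R v"] an vf_analyticD[OF R] v by auto
  then show "\<forall>\<^sub>F q in nhds (P 0). c i q = 0"
    using c0[of i] i by (cases "i = 4") auto
qed

lemma L_decompose:
  assumes "V \<in> L"
  obtains c R where "\<And>i. i < 4 \<Longrightarrow> analytic_germ (P 0) (c i)" "R \<in> L"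
    "\<And>v q. V v q = lin_comb c Bs v q + R v q"
    "\<And>v. v \<in> {Vx, Vtx, Vt 0, Vt 1} \<Longrightarrow> \<forall>\<^sub>F q in nhds (P 0). R v q = 0"
proof -
  note V = vf_analyticD[OF L_analytic[OF assms]]
  \<comment> \<open>The coefficients are read off the triangular system in the order x,
    \<open>t\<^sub>x\<close>, t, \<open>t\<^sub>1\<close>. The only division is by
    \<open>Z1 (Vt 1)\<close>, nonzero at \<open>P 0\<close>, so they are analytic.\<close>
  define c2 where "c2 q = V (Vt 0) q - q Vtx * V Vx q" for q
  define c3 where "c3 q = (V (Vt 1) q - K (Vt 1) q * V Vx q - c2 q * C1 (Vt 1) q) / Z1 (Vt 1) q" for q
  have an2: "analytic_germ (P 0) c2"
    unfolding c2_def by (intro analytic_germ_diff analytic_germ_mult analytic_germ_coord V)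
  have an3: "analytic_germ (P 0) c3"
    unfolding c3_def by (intro analytic_germ_divide analytic_germ_diff analytic_germ_mult an2 V K_an C1_an Z1_an Z1_1_nz)
  define c where "c i = [V Vtx, V Vx, c2, c3] ! i" for i
  have c: "c 0 = V Vtx" "c 1 = V Vx" "c 2 = c2" "c 3 = c3" by (simp_all add: c_def numeral_eq_Suc)
  have an: "analytic_germ (P 0) (c i)" if "i < 4" for i
  proof -
    have "i = 0 \<or> i = 1 \<or> i = 2 \<or> i = 3" using that by auto
    then show ?thesis using c an2 an3 V by auto
  qed
  \<comment> \<open>The difference is written with sums and a factor - 1, so that it is literally
    built by the rules of \<open>x_ring\<close>.\<close>
  define R where "R v q = V v q + - 1 * (c 0 q * vf_X v q + (c 1 q * K v q + (c 2 q * C1 v q + c 3 q * Z1 v q)))" for v q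
  have sc: "(\<lambda>v q. c 0 q * vf_X v q) \<in> L" "(\<lambda>v q. c 1 q * K v q) \<in> L"
    "(\<lambda>v q. c 2 q * C1 v q) \<in> L" "(\<lambda>v q. c 3 q * Z1 v q) \<in> L"
    using Bs_in_L an by (auto intro!: x_ring.scale)
  have "R \<in> L"
    unfolding R_def
    by (rule x_ring.add[OF assms x_ring.scale[OF analytic_germ_const
          x_ring.add[OF sc(1) x_ring.add[OF sc(2) x_ring.add[OF sc(3) sc(4)]]]]])
  moreover have "V v q = lin_comb c Bs v q + R v q" for v q
    by (simp add: R_def lin_comb_Bs)
  moreover have "\<forall>\<^sub>F q in nhds (P 0). R v q = 0" if "v \<in> {Vx, Vtx, Vt 0, Vt 1}" for v
    using Z1_1_ne
  proof eventually_elim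
    case (elim q)
    then have "c3 q * Z1 (Vt 1) q = V (Vt 1) q - K (Vt 1) q * V Vx q - c2 q * C1 (Vt 1) q"
      by (simp add: c3_def)
    then show ?case using that
      by (auto simp: R_def c c(2)[simplified] c2_def vf_X_simps vf_K_Vx vf_K_Vtx vf_K_Vt0 C1_simps Z1_simps algebra_simps)
  qed
  ultimately show ?thesis using that[of c R] an by blast
qed

text \<open>A nonzero remainder of the decomposition would be a fifth independent element of the
  ring.\<close>

lemma dimension_imp_basis:
  assumes "has_dimension_at (P 0) L 4"
  shows "is_basis_at (P 0) L Bs"
  unfolding is_basis_at_def
proof (intro conjI ballI Bs_in_L Bs_lin_indep)
  fix V assume "V \<in> L"
  then obtain c R where c: "\<And>i. i < 4 \<Longrightarrow> analytic_germ (P 0) (c i)" and R: "R \<in> L"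
    "\<And>v q. V v q = lin_comb c Bs v q + R v q"
    "\<And>v. v \<in> {Vx, Vtx, Vt 0, Vt 1} \<Longrightarrow> \<forall>\<^sub>F q in nhds (P 0). R v q = 0"
    using L_decompose by metis
  have "vf_eq_at (P 0) R (\<lambda>v q. 0)"
  proof (rule ccontr)
    assume "\<not> ?thesis"
    from Bs_snoc_lin_indep[OF L_analytic[OF R(1)] R(3) this]
    have "length (Bs @ [R]) \<le> 4"
      using assms Bs_in_L R(1) unfolding has_dimension_at_def
      by (metis empty_set insert_subset list.simps(15) set_append Un_subset_iff empty_subsetI)
    then show False by simp
  qed
  then have "vf_eq_at (P 0) V (lin_comb c Bs)"
    unfolding vf_eq_at_def R(2) by (auto elim: eventually_mono)
  then show "\<exists>c. (\<forall>i<length Bs. analytic_germ (P 0) (c i)) \<and> vf_eq_at (P 0) V (lin_comb c Bs)"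
    using c by (intro exI[of _ c]) auto
qed

text \<open>W has no components at x, \<open>t\<^sub>x\<close> and t, so its coefficients on K, X
  and \<open>C1\<close> vanish; the remaining factor of \<open>Z1\<close> then equals every
  \<open>\<Lambda> k\<close>.\<close>

lemma basis_imp_\<Lambda>_const:
  assumes "is_basis_at (P 0) L Bs"
  shows "\<forall>\<^sub>F q in nhds (P 0). \<Lambda> k q = \<Lambda> 0 q"
proof -
  have "W \<in> L" using Bs_in_L by (auto intro: x_ring.bracket)
  then obtain c where c: "vf_eq_at (P 0) W (lin_comb c Bs)"
    using assms unfolding is_basis_at_def by blast
  have Wc: "\<forall>\<^sub>F q in nhds (P 0). W v q = lin_comb c Bs v q" for v
    using c by (simp add: vf_eq_at_def)
  have c0: "\<forall>\<^sub>F q in nhds (P 0). c 0 q = 0 \<and> c 1 q = 0 \<and> c 2 q = 0"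
    using Wc[of Vx] Wc[of Vtx] Wc[of "Vt 0"]
    by eventually_elim (simp add: lin_comb_Bs W_simps vf_X_simps vf_K_Vx vf_K_Vtx C1_simps Z1_simps)
  have "\<forall>\<^sub>F q in nhds (P 0). W (Vt k) q = c 3 q * Z1 (Vt k) q" for k
    using Wc[of "Vt k"] c0 by eventually_elim (simp add: lin_comb_Bs)
  note l = proportional_imp_\<Lambda>[of "c 3", OF this]
  from l[of k] l[of 0] show ?thesis by eventually_elim simp
qed

lemma \<Lambda>_const_imp_dimension:
  assumes "\<And>k. \<forall>\<^sub>F q in nhds (P 0). \<Lambda> k q = \<Lambda> 0 q"
  shows "has_dimension_at (P 0) L 4"
proof -
  define l where "l = \<Lambda> 0"
  have l_an: "analytic_germ (P 0) l" by (simp add: l_def \<Lambda>_analytic)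
  have "\<forall>\<^sub>F q in nhds (P 0). l q = \<Lambda> k q" for k
    using assms[of k] by (simp add: l_def eq_commute)
  note W_l = \<Lambda>_imp_proportional[of l, OF this]
  have W: "\<forall>\<^sub>F q in nhds (P 0). l q * Z1 v q = W v q" for v
  proof (cases v)
    case (Vt k)
    then show ?thesis using W_l[of k] by (simp add: eq_commute)
  qed (simp_all add: W_simps Z1_simps)
  let ?G = "germ_span (P 0) (set Bs)"
  \<comment> \<open>Fields whose coefficients are free of \<open>t\<^sub>x\<close> commute with
    X.\<close>
  have X0: "vf_bracket vf_X V \<in> ?G" if "vf_analytic (P 0) V" "\<And>v. \<forall>\<^sub>F q in nhds (P 0). pd Vtx (V v) q = 0" for V
  proof (rule germ_span.cong[OF germ_span.zero])
    have "\<forall>\<^sub>F q in nhds (P 0). 0 = vf_bracket vf_X V v q" for v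
      using vf_apply_X[OF vf_analyticD[OF that(1)], of v] that(2)[of v]
      by eventually_elim (cases v; simp add: vf_bracket_def vf_X_simps)
    then show "vf_eq_at (P 0) (\<lambda>v q. 0) (vf_bracket vf_X V)" by (simp add: vf_eq_at_def)
  qed
  have KZ: "W \<in> ?G"
  proof (rule germ_span.cong[OF germ_span.scale[OF l_an germ_span.base]])
    show "vf_eq_at (P 0) (\<lambda>v q. l q * Z1 v q) W" using W by (simp add: vf_eq_at_def)
  qed simp
  \<comment> \<open>Comes from differentiating \<open>l q * Z1 v q = W v q\<close> in
    \<open>t\<^sub>x\<close>: \<open>Z1\<close> is free of it, and \<open>pd_bracket_K\<close>
    identifies the derivative of W.\<close>
  have CZ: "vf_bracket C1 Z1 \<in> ?G"
  proof (rule germ_span.cong[OF germ_span.scale[OF analytic_germ_pd[OF l_an, of Vtx] germ_span.base]])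
    have "\<forall>\<^sub>F q in nhds (P 0). pd Vtx l q * Z1 v q = vf_bracket C1 Z1 v q" for v
      using pd_cong[OF W[of v]] pd_mult[OF l_an Z1_an, of v] pd_Z1[of v] pd_bracket_K[OF Z1_analytic pd_Z1, of v]
    proof eventually_elim
      case (elim q)
      from elim(1,2) have "pd Vtx l q * Z1 v q + l q * pd Vtx (Z1 v) q = pd Vtx (W v) q" by metis
      then show ?case using elim(3,4) by simp
    qed
    then show "vf_eq_at (P 0) (\<lambda>v q. pd Vtx l q * Z1 v q) (vf_bracket C1 Z1)" by (simp add: vf_eq_at_def)
  qed simp
  have self: "vf_bracket V V \<in> ?G" for V
    using germ_span.zero by (simp add: vf_bracket_def)
  have base: "C1 \<in> ?G" "Z1 \<in> ?G" by (auto intro: germ_span.base)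
  have swap: "vf_bracket V W \<in> ?G" if "vf_bracket W V \<in> ?G" for V W
    using germ_span_uminus[OF that] by (subst vf_bracket_swap)
  have forward: "vf_bracket vf_X K \<in> ?G" "vf_bracket vf_X C1 \<in> ?G" "vf_bracket vf_X Z1 \<in> ?G"
    "vf_bracket K C1 \<in> ?G"
    using base X0[OF C1_analytic pd_C1] X0[OF Z1_analytic pd_Z1] by (simp_all add: C1_def[symmetric] Z1_def[symmetric])
  have br: "vf_bracket V W \<in> ?G" if "V \<in> set Bs" "W \<in> set Bs" for V W
    using that self forward KZ CZ swap by auto
  have "vf_analytic (P 0) V" if "V \<in> set Bs" for V
    using that Bs_in_L L_analytic by blast
  then have sub: "L \<subseteq> ?G"
    by (rule x_ring_subset_germ_span[OF _ br]) auto
  show ?thesis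
    unfolding has_dimension_at_def
  proof (intro conjI allI impI)
    show "\<exists>Vs. set Vs \<subseteq> L \<and> length Vs = 4 \<and> lin_indep_at (P 0) Vs"
      using Bs_in_L Bs_lin_indep by (intro exI[of _ Bs]) simp
    fix Vs assume "set Vs \<subseteq> L \<and> lin_indep_at (P 0) Vs"
    then have "length Vs \<le> length Bs"
      using sub by (intro germ_span_lin_indep_length) auto
    then show "length Vs \<le> 4" by simp
  qed
qed

text \<open>The identity is stated as one of germs at every \<open>P k\<close>, because constancy of
  \<open>\<Lambda> k\<close> needs all its shifts; a germ at \<open>P 0\<close> does not by itself
  determine f near the other points of the trajectory.\<close>

theorem dimension_four_iff:
  "(has_dimension_at (P 0) L 4 \<longleftrightarrow>
      (\<forall>k. \<forall>\<^sub>F q in nhds (P k).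
        Dop f (\<lambda>z. vf_apply K (m_fun f) z / m_fun f z - m_fun f z + pd (Vt 0) F z / pd Vtx F z) q =
        vf_apply K (m_fun f) q / m_fun f q + m_fun f q - pd (Vt 1) F q)) \<and>
   (has_dimension_at (P 0) L 4 \<longrightarrow> is_basis_at (P 0) L Bs)"
  unfolding identity_iff \<Lambda>_const_iff[symmetric]
  using dimension_imp_basis basis_imp_\<Lambda>_const \<Lambda>_const_imp_dimension by blast

end

theorem theorem8:
  fixes U :: "('k::{real_normed_field,banach} \<times> 'k \<times> 'k \<times> 'k) set"
    and f g :: "'k \<times> 'k \<times> 'k \<times> 'k \<Rightarrow> 'k"
    and P :: "int \<Rightarrow> 'k point"
  defines "F \<equiv> \<lambda>q. f (fargs q)"
    and "m \<equiv> m_fun f"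
    and "X \<equiv> vf_X"
    and "K \<equiv> vf_K f g"
  defines "C1 \<equiv> vf_bracket X K"
  defines "Z1 \<equiv> vf_bracket K C1"
  assumes "open U"
    and f_analytic: "\<And>q. fargs q \<in> U \<Longrightarrow> analytic_germ q F"
    and f_tx: "\<And>q. fargs q \<in> U \<Longrightarrow> pd Vtx F q \<noteq> 0"
    and g_solves: "\<And>x a b u. (x, a, b, u) \<in> U \<Longrightarrow> g (x, a, b, f (x, a, b, u)) = u"
    and f_tx_tx: "\<And>q. fargs q \<in> U \<Longrightarrow> pd Vtx (pd Vtx F) q = 0"
    and m_nz: "\<And>q. fargs q \<in> U \<Longrightarrow> m q \<noteq> 0"
    and traj: "trajectory U f P"
  shows "(has_dimension_at (P 0) (x_ring f g (P 0)) 4 \<longleftrightarrow>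
           (\<forall>k. \<forall>\<^sub>F q in nhds (P k).
              Dop f (\<lambda>z. vf_apply K m z / m z - m z + pd (Vt 0) F z / pd Vtx F z) q =
              vf_apply K m q / m q + m q - pd (Vt 1) F q)) \<and>
         (has_dimension_at (P 0) (x_ring f g (P 0)) 4 \<longrightarrow>
           is_basis_at (P 0) (x_ring f g (P 0)) [X, K, C1, Z1])"
proof -
  interpret chain: affine_chain U f g P F
    using assms by unfold_locales (auto simp: F_def m_def)
  have "Z1 = chain.Z1" "C1 = chain.C1"
    by (simp_all add: Z1_def C1_def X_def K_def chain.Z1_def chain.C1_def)
  then show ?thesis
    using chain.dimension_four_iff by (simp add: m_def X_def K_def)
qed

end
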